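(* Let $H=\sum_{\mathbf{j}\in V}h_{\mathbf{j}}$ be a Hamiltonian whose frustration graph $G$ is claw-free and contains a simplicial clique $K_s$, let $\chi=\sigma^{\mathbf{j}^*}$ be a simplicial mode with respect to $K_s$, and let $G^*$ be the graph obtained from $G$ by adding the vertex $\mathbf{j}^*$ adjacent exactly to the vertices of $K_s$. For each joint eigenspace $\mathcal{J}$ of the generalized cycle symmetries, with projector $\Pi_{\mathcal{J}}$, there exists a real matrix $\mathbf{A}_{G,\mathcal{J}}$ with rows and columns indexed by induced paths of $G^*$, which is the weighted adjacency matrix of a directed bipartite graph, such that for all integers $k\ge0$ \[ \Pi_{\mathcal{J}}\,\mathrm{ad}_{iH}^{k}(\chi)=(-2i)^k\sum_{P}\big(\mathbf{A}_{G,\mathcal{J}}^k\big)_{\{\mathbf{j}^*\},P}\,\Pi_{\mathcal{J}}h_P, \] where the sum runs over induced paths $P$ of $G^*$ and $\mathrm{ad}_{iH}(X)=[iH,X]$.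
   Context: Setting: $V$ a finite set of distinct $n$-qubit Pauli strings, $H=\sum_{\mathbf{j}\in V}h_{\mathbf{j}}$, $h_{\mathbf{j}}=b_{\mathbf{j}}\sigma^{\mathbf{j}}$ with $b_{\mathbf{j}}\in\mathbb{R}\setminus\{0\}$; frustration graph $G$: edge iff the two terms anticommute; claw-free: no induced $K_{1,3}$. Simplicial clique: a clique $K_s$ such that $\Gamma(\mathbf{j})\setminus K_s$ is a clique for every $\mathbf{j}\in K_s$. Simplicial mode: a Pauli operator $\chi=\sigma^{\mathbf{j}^*}$, $\mathbf{j}^*\notin V$, anticommuting with $h_{\mathbf{k}}$ iff $\mathbf{k}\in K_s$; we set $h_{\mathbf{j}^*}=\chi$. For an induced path $P=\mathbf{j}_0-\mathbf{j}_1-\dots-\mathbf{j}_\ell$ (a vertex set whose only induced edges are between consecutive vertices), $h_P=h_{\mathbf{j}_0}h_{\mathbf{j}_1}\cdots h_{\mathbf{j}_\ell}$, ordered from an endpoint (from $\mathbf{j}^*$ when $\mathbf{j}^*\in P$). Generalized cycle symmetries: for an even hole $C$ (induced cycle of even length $\ge4$) with colour classes $C_a,C_b$, $h_C=h_{C_a}h_{C_b}$; a single-vertex deformation of $C$ by $\mathbf{j}\notin C$ with $\Gamma_C(\mathbf{j})=\{\mathbf{u},\mathbf{k},\mathbf{v}\}$, $\mathbf{u},\mathbf{v}$ the neighbours of $\mathbf{k}$ in $C$, is $(C\setminus\{\mathbf{k}\})\cup\{\mathbf{j}\}$; $\langle C_0\rangle$ is the closure of $\{C_0\}$ under such deformations;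 $J_{\langle C_0\rangle}=\sum_{C\in\langle C_0\rangle}h_C$. These are mutually commuting Hermitian operators and $\{\Pi_{\mathcal{J}}\}$ are the projectors onto their joint eigenspaces. *)

theory Defs
  imports Complex_Main "Jordan_Normal_Form.Matrix"
begin

text \<open>Single-qubit Paulis: code 0 = I, 1 = X, 2 = Y, 3 = Z; entry (r,c), r,c in {0,1}.\<close>
definition pauli1 :: "nat \<Rightarrow> nat \<Rightarrow> nat \<Rightarrow> complex" where
  "pauli1 a r c =
     (if a = 0 then (if r = c then 1 else 0)
      else if a = 1 then (if r \<noteq> c then 1 else 0)
      else if a = 2 then (if r = 0 \<and> c = 1 then - \<i> else if r = 1 \<and> c = 0 then \<i> else 0)
      else (if r = c then (if r = 0 then 1 else -1) else 0))"

definition is_pauli_string :: "nat \<Rightarrow> (nat \<Rightarrow> nat) \<Rightarrow> bool" where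
  "is_pauli_string n p \<longleftrightarrow> (\<forall>q. (q < n \<longrightarrow> p q < 4) \<and> (n \<le> q \<longrightarrow> p q = 0))"

text \<open>sigma^p = tensor product of the single-qubit Paulis (qubit q = bit q of the index).\<close>
definition sigma :: "nat \<Rightarrow> (nat \<Rightarrow> nat) \<Rightarrow> complex mat" where
  "sigma n p = mat (2^n) (2^n)
     (\<lambda>(r, c). \<Prod>q<n. pauli1 (p q) (r div 2^q mod 2) (c div 2^q mod 2))"

definition anticommute :: "complex mat \<Rightarrow> complex mat \<Rightarrow> bool" where
  "anticommute A B \<longleftrightarrow> A * B = - (B * A)"

definition adj :: "nat \<Rightarrow> (nat \<Rightarrow> nat) \<Rightarrow> (nat \<Rightarrow> nat) \<Rightarrow> bool" where
  "adj n j k \<longleftrightarrow> anticommute (sigma n j) (sigma n k)"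

definition claw_free :: "nat \<Rightarrow> (nat \<Rightarrow> nat) set \<Rightarrow> bool" where
  "claw_free n W \<longleftrightarrow> \<not> (\<exists>v\<in>W. \<exists>a\<in>W. \<exists>b\<in>W. \<exists>c\<in>W.
      distinct [v, a, b, c] \<and> adj n v a \<and> adj n v b \<and> adj n v c \<and>
      \<not> adj n a b \<and> \<not> adj n a c \<and> \<not> adj n b c)"

definition is_clique :: "nat \<Rightarrow> (nat \<Rightarrow> nat) set \<Rightarrow> bool" where
  "is_clique n K \<longleftrightarrow> (\<forall>x\<in>K. \<forall>y\<in>K. x \<noteq> y \<longrightarrow> adj n x y)"

definition nbhd :: "nat \<Rightarrow> (nat \<Rightarrow> nat) set \<Rightarrow> (nat \<Rightarrow> nat) \<Rightarrow> (nat \<Rightarrow> nat) set" where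
  "nbhd n W j = {k \<in> W. adj n j k}"

definition simplicial_clique :: "nat \<Rightarrow> (nat \<Rightarrow> nat) set \<Rightarrow> (nat \<Rightarrow> nat) set \<Rightarrow> bool" where
  "simplicial_clique n W K \<longleftrightarrow> K \<subseteq> W \<and> is_clique n K \<and>
     (\<forall>j\<in>K. is_clique n (nbhd n W j - K))"

definition induced_path_list :: "nat \<Rightarrow> (nat \<Rightarrow> nat) set \<Rightarrow> (nat \<Rightarrow> nat) list \<Rightarrow> bool" where
  "induced_path_list n W xs \<longleftrightarrow> xs \<noteq> [] \<and> distinct xs \<and> set xs \<subseteq> W \<and>
     (\<forall>i<length xs. \<forall>l<length xs. adj n (xs ! i) (xs ! l) \<longleftrightarrow> (l = i + 1 \<or> i = l + 1))"

definition induced_paths :: "nat \<Rightarrow> (nat \<Rightarrow> nat) set \<Rightarrow> (nat \<Rightarrow> nat) set set" where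
  "induced_paths n W = {set xs | xs. induced_path_list n W xs}"

definition even_hole_list :: "nat \<Rightarrow> (nat \<Rightarrow> nat) set \<Rightarrow> (nat \<Rightarrow> nat) list \<Rightarrow> bool" where
  "even_hole_list n W xs \<longleftrightarrow> length xs \<ge> 4 \<and> even (length xs) \<and> distinct xs \<and> set xs \<subseteq> W \<and>
     (\<forall>i<length xs. \<forall>l<length xs. adj n (xs ! i) (xs ! l) \<longleftrightarrow>
        (l = Suc i mod length xs \<or> i = Suc l mod length xs))"

definition even_holes :: "nat \<Rightarrow> (nat \<Rightarrow> nat) set \<Rightarrow> (nat \<Rightarrow> nat) set set" where
  "even_holes n W = {set xs | xs. even_hole_list n W xs}"

text \<open>Single-vertex deformation of C by j: Gamma_C(j) = {u,k,v}, u,v the neighbours of k in C.\<close>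
definition deformation :: "nat \<Rightarrow> (nat \<Rightarrow> nat) set \<Rightarrow> (nat \<Rightarrow> nat) set \<Rightarrow> (nat \<Rightarrow> nat) set \<Rightarrow> bool" where
  "deformation n W C C' \<longleftrightarrow> (\<exists>j\<in>W. \<exists>k\<in>C. j \<notin> C \<and>
      nbhd n C j = insert k (nbhd n C k) \<and> C' = insert j (C - {k}))"

inductive_set deform_closure :: "nat \<Rightarrow> (nat \<Rightarrow> nat) set \<Rightarrow> (nat \<Rightarrow> nat) set \<Rightarrow> (nat \<Rightarrow> nat) set set"
  for n W C0 where
  base: "C0 \<in> deform_closure n W C0"
| step: "C \<in> deform_closure n W C0 \<Longrightarrow> deformation n W C C' \<Longrightarrow> C' \<in> deform_closure n W C0"

definition mprod_list :: "nat \<Rightarrow> complex mat list \<Rightarrow> complex mat" where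
  "mprod_list N Ms = foldr (*) Ms (1\<^sub>m N)"

definition msum :: "nat \<Rightarrow> ('b \<Rightarrow> complex mat) \<Rightarrow> 'b set \<Rightarrow> complex mat" where
  "msum N f S = mat N N (\<lambda>ij. \<Sum>x\<in>S. f x $$ ij)"

definition path_op :: "nat \<Rightarrow> (nat \<Rightarrow> nat) set \<Rightarrow> ((nat \<Rightarrow> nat) \<Rightarrow> complex mat) \<Rightarrow> (nat \<Rightarrow> nat)
      \<Rightarrow> (nat \<Rightarrow> nat) set \<Rightarrow> complex mat" where
  "path_op n W h jstar P = mprod_list (2^n) (map h
     (SOME xs. induced_path_list n W xs \<and> set xs = P \<and> (jstar \<in> P \<longrightarrow> hd xs = jstar)))"

text \<open>h_C = h_{C_a} h_{C_b} for an even hole C, C_a/C_b the two colour classes.\<close>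
definition cycle_op :: "nat \<Rightarrow> (nat \<Rightarrow> nat) set \<Rightarrow> ((nat \<Rightarrow> nat) \<Rightarrow> complex mat)
      \<Rightarrow> (nat \<Rightarrow> nat) set \<Rightarrow> complex mat" where
  "cycle_op n W h C = (let xs = (SOME xs. even_hole_list n W xs \<and> set xs = C) in
     mprod_list (2^n) (map h (map (\<lambda>i. xs ! i) (filter even [0..<length xs])))
   * mprod_list (2^n) (map h (map (\<lambda>i. xs ! i) (filter odd [0..<length xs]))))"

definition cycle_symmetry :: "nat \<Rightarrow> (nat \<Rightarrow> nat) set \<Rightarrow> ((nat \<Rightarrow> nat) \<Rightarrow> complex mat)
      \<Rightarrow> (nat \<Rightarrow> nat) set \<Rightarrow> complex mat" where
  "cycle_symmetry n W h C0 = msum (2^n) (cycle_op n W h) (deform_closure n W C0)"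

definition cycle_symmetries :: "nat \<Rightarrow> (nat \<Rightarrow> nat) set \<Rightarrow> ((nat \<Rightarrow> nat) \<Rightarrow> complex mat)
      \<Rightarrow> complex mat set" where
  "cycle_symmetries n W h = cycle_symmetry n W h ` even_holes n W"

definition joint_eigenprojector :: "nat \<Rightarrow> complex mat set \<Rightarrow> complex mat \<Rightarrow> bool" where
  "joint_eigenprojector N Ss Proj \<longleftrightarrow> Proj \<in> carrier_mat N N \<and> Proj \<noteq> 0\<^sub>m N N \<and>
     (\<forall>r<N. \<forall>c<N. Proj $$ (r, c) = cnj (Proj $$ (c, r))) \<and> Proj * Proj = Proj \<and>
     (\<exists>ev. \<forall>v\<in>carrier_vec N. Proj *\<^sub>v v = v \<longleftrightarrow> (\<forall>S\<in>Ss. S *\<^sub>v v = ev S \<cdot>\<^sub>v v))"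

definition ad :: "complex mat \<Rightarrow> complex mat \<Rightarrow> complex mat" where
  "ad X Y = X * Y - Y * X"

fun mpow :: "'i set \<Rightarrow> ('i \<Rightarrow> 'i \<Rightarrow> real) \<Rightarrow> nat \<Rightarrow> 'i \<Rightarrow> 'i \<Rightarrow> real" where
  "mpow I A 0 P Q = (if P = Q then 1 else 0)"
| "mpow I A (Suc k) P Q = (\<Sum>R\<in>I. mpow I A k P R * A R Q)"

definition bipartite_weighted_adj :: "'i set \<Rightarrow> ('i \<Rightarrow> 'i \<Rightarrow> real) \<Rightarrow> bool" where
  "bipartite_weighted_adj I A \<longleftrightarrow> (\<exists>X Y. X \<inter> Y = {} \<and> X \<union> Y = I \<and>
     (\<forall>P\<in>I. \<forall>Q\<in>I. A P Q \<noteq> 0 \<longrightarrow> (P \<in> X \<and> Q \<in> Y) \<or> (P \<in> Y \<and> Q \<in> X)))"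

end

theory Submission
  imports Defs "HOL-Computational_Algebra.Formal_Power_Series"
begin

text \<open>
Adding \<open>jstar\<close> to the frustration graph gives a claw-free graph in which \<open>jstar\<close> is a simplicial vertex.
For an induced path \<open>P\<close> starting at \<open>jstar\<close>, a term anticommutes with \<open>h\<^sub>P\<close> only if it (i) extends \<open>P\<close>,
(ii) is its last vertex, (iii) is adjacent to exactly three consecutive vertices, or (iv) closes a hole attached to
an initial segment \<open>Q\<close> of \<open>P\<close> (a lollipop). If the coefficient of \<open>h\<^sub>P\<close> depends only on the length of \<open>P\<close> and
on the set of vertices outside its closed neighbourhood, then the terms (iii) cancel in pairs, odd lollipops cancel
against their reversals, and the even lollipops on \<open>Q\<close> run over complete deformation classes, so they sum to the cycle
symmetry times \<open>h\<^sub>Q\<close>, and the projector turns the symmetry into its eigenvalue. This defines the matrix.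

That the coefficients \<open>(A ^ k) {jstar} P\<close> have this invariance is an analogue of Godsil's path-tree theorem:
their generating function is \<open>X ^ l * zeta (rest P) / zeta V\<close>, where \<open>l\<close> is the length of \<open>P\<close>, \<open>rest P\<close> is the set of
vertices outside its closed neighbourhood, and \<open>zeta\<close> counts families of pairwise non-touching vertices and even holes.
\<close>

section \<open>Pauli strings\<close>

text \<open>The obstacle is circular: cancelling the terms (iii) requires equal coefficients on
  different paths, while the recursion producing the coefficients runs over all extensions of a path
  and does not visibly preserve such equalities. A closed form breaks the circle. Its source is a
  clique: among the vertices outside the closed neighbourhood of the path without its end, those
  adjacent to the end form a clique, as otherwise there is a claw at the end. A non-touching family
  has at most one member meeting a clique, so sorting the families by that member gives a recursion
  for \<open>zeta\<close>, and its terms are exactly the extension, contraction and lollipop entries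
  of the matrix. A linear equation whose right-hand side carries a factor X has one solution, so the
  closed form is the generating function.

  Only the sum over a deformation class of holes is known behind the projector, never a single hole
  product; each hole therefore receives the eigenvalue divided by the class size. That the projector
  may stand in front at every step needs the cycle symmetries to commute with \<open>H\<close>,
  which comes from a pairing of the same kind as in (iii).\<close>

text \<open>An index below \<open>2^n\<close> is a free choice of n bits, so the sum factors bit by
  bit. This reduces products of tensor products to products of 2 by 2 matrices.\<close>

lemma sum_prod_bits:
  fixes g :: "nat \<Rightarrow> nat \<Rightarrow> 'a::comm_semiring_1"
  shows "(\<Sum>m<2^n. \<Prod>q<n. g q (m div 2^q mod 2)) = (\<Prod>q<n. g q 0 + g q 1)"
proof (induction n)
  case 0 show ?case by simp
next
  case (Suc n)
  have split: "{..<2^Suc n} = {..<2^n} \<union> (\<lambda>m. m + 2^n) ` {..<2^n::nat}"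
  proof (intro equalityI subsetI)
    fix x :: nat assume x: "x \<in> {..<2^Suc n}"
    show "x \<in> {..<2^n} \<union> (\<lambda>m. m + 2^n) ` {..<2^n}"
    proof (cases "x < 2^n")
      case False
      then have "x = (x - 2^n) + 2^n" "x - 2^n < 2^n" using x by auto
      then show ?thesis by blast
    qed auto
  qed auto
  have bit: "(m + 2^n) div 2^q mod 2 = m div 2^q mod 2" if "q < n" for m q :: nat
  proof -
    have e: "(2::nat)^n = 2^q * 2^(n-q)" using that by (simp flip: power_add)
    have "(m + 2^n) div 2^q = m div 2^q + 2^(n-q)" unfolding e by simp
    moreover have "even ((2::nat)^(n-q))" using that by simp
    ultimately show ?thesis by (simp add: mod_add_right_eq[symmetric] even_iff_mod_2_eq_zero)
  qed
  have "(\<Sum>m<2^Suc n. \<Prod>q<Suc n. g q (m div 2^q mod 2))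
      = (\<Sum>m<2^n. \<Prod>q<Suc n. g q (m div 2^q mod 2))
      + (\<Sum>m\<in>(\<lambda>m. m + 2^n) ` {..<2^n}. \<Prod>q<Suc n. g q (m div 2^q mod 2))"
    unfolding split by (rule sum.union_disjoint) auto
  also have "(\<Sum>m\<in>(\<lambda>m. m + 2^n) ` {..<2^n}. \<Prod>q<Suc n. g q (m div 2^q mod 2))
     = (\<Sum>m<2^n. \<Prod>q<Suc n. g q ((m + 2^n) div 2^q mod 2))"
    by (subst sum.reindex) (auto simp: inj_on_def)
  also have "\<dots> = (\<Sum>m<2^n. (\<Prod>q<n. g q (m div 2^q mod 2)) * g n 1)"
    by (rule sum.cong) (simp_all add: bit)
  also have "(\<Sum>m<2^n. \<Prod>q<Suc n. g q (m div 2^q mod 2))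
      = (\<Sum>m<2^n. (\<Prod>q<n. g q (m div 2^q mod 2)) * g n 0)"
    by (rule sum.cong) simp_all
  finally show ?case
    by (simp add: sum_distrib_right[symmetric] Suc distrib_left)
qed

lemma bits_eq_imp_eq:
  assumes "\<And>q. q < n \<Longrightarrow> r div 2^q mod 2 = c div 2^q mod (2::nat)" "r < 2^n" "c < 2^n"
  shows "r = c"
  using assms
proof (induction n arbitrary: r c)
  case (Suc n)
  have "r div 2 = c div 2"
  proof (rule Suc.IH)
    fix q assume "q < n"
    then show "r div 2 div 2^q mod 2 = c div 2 div 2^q mod 2"
      using Suc.prems(1)[of "Suc q"] by (simp add: div_mult2_eq)
  qed (use Suc.prems in auto)
  moreover have "r mod 2 = c mod 2" using Suc.prems(1)[of 0] by simp
  ultimately show ?case by (metis div_mult_mod_eq)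
qed simp

lemma sigma_carrier [simp]: "sigma n p \<in> carrier_mat (2^n) (2^n)"
  by (simp add: sigma_def)

lemma sigma_hermitian:
  assumes "r < 2^n" "c < 2^n"
  shows "sigma n p $$ (r, c) = cnj (sigma n p $$ (c, r))"
  using assms unfolding sigma_def
  by (auto simp: pauli1_def intro!: prod.cong)

lemma sigma_times_entry:
  assumes "r < 2^n" "c < 2^n"
  shows "(sigma n p * sigma n p') $$ (r, c) =
    (\<Prod>q<n. pauli1 (p q) (r div 2^q mod 2) 0 * pauli1 (p' q) 0 (c div 2^q mod 2)
           + pauli1 (p q) (r div 2^q mod 2) 1 * pauli1 (p' q) 1 (c div 2^q mod 2))"
proof -
  have "(sigma n p * sigma n p') $$ (r, c) =
     (\<Sum>m<2^n. \<Prod>q<n. pauli1 (p q) (r div 2^q mod 2) (m div 2^q mod 2)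
                     * pauli1 (p' q) (m div 2^q mod 2) (c div 2^q mod 2))"
    using assms by (simp add: sigma_def scalar_prod_def prod.distrib lessThan_atLeast0)
  then show ?thesis
    using sum_prod_bits[of "\<lambda>q m. pauli1 (p q) (r div 2^q mod 2) m * pauli1 (p' q) m (c div 2^q mod 2)" n]
    by simp
qed

lemma sigma_square: "sigma n p * sigma n p = 1\<^sub>m (2^n)"
proof (rule eq_matI)
  fix r c assume "r < dim_row (1\<^sub>m (2^n) :: complex mat)" "c < dim_col (1\<^sub>m (2^n) :: complex mat)"
  then have rc: "r < 2^n" "c < 2^n" by auto
  have one: "pauli1 a x 0 * pauli1 a 0 y + pauli1 a x 1 * pauli1 a 1 y = (if x = y then 1 else 0)"
    if "x < 2" "y < 2" for a x y
  proof -
    have "x = 0 \<or> x = 1" "y = 0 \<or> y = 1" using that by auto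
    then show ?thesis by (auto simp: pauli1_def)
  qed
  have "(sigma n p * sigma n p) $$ (r, c) =
    (\<Prod>q<n. if r div 2^q mod 2 = c div 2^q mod 2 then 1 else 0)"
    unfolding sigma_times_entry[OF rc] by (rule prod.cong) (simp_all add: one[simplified])
  also have "\<dots> = (if r = c then 1 else 0)"
  proof (cases "r = c")
    case False
    then obtain q where "q < n" "r div 2^q mod 2 \<noteq> c div 2^q mod 2"
      using bits_eq_imp_eq rc by blast
    then show ?thesis using False by (auto intro!: prod_zero)
  qed simp
  finally show "(sigma n p * sigma n p) $$ (r, c) = 1\<^sub>m (2^n) $$ (r, c)" using rc by simp
qed (auto simp: sigma_def)

text \<open>On each qubit two Paulis commute up to a sign, and the strings commute up to the product
  of these signs.\<close>

lemma sigma_commute_or_anticommute: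
  "sigma n p * sigma n p' = sigma n p' * sigma n p \<or> anticommute (sigma n p) (sigma n p')"
proof -
  \<comment> \<open>\<open>pauli1\<close> reads every code from 3 on as Z; \<open>min\<close>
    identifies these codes before they are compared.\<close>
  define e :: "nat \<Rightarrow> complex" where
    "e q = (let a = min (p q) 3; a' = min (p' q) 3 in if a = 0 \<or> a' = 0 \<or> a = a' then 1 else -1)" for q
  have one: "pauli1 (p q) x 0 * pauli1 (p' q) 0 y + pauli1 (p q) x 1 * pauli1 (p' q) 1 y
      = e q * (pauli1 (p' q) x 0 * pauli1 (p q) 0 y + pauli1 (p' q) x 1 * pauli1 (p q) 1 y)"
    if "x < 2" "y < 2" for q x y
  proof -
    have "x = 0 \<or> x = 1" "y = 0 \<or> y = 1" using that by auto
    moreover have "p q = 0 \<or> p q = 1 \<or> p q = 2 \<or> 2 < p q" "p' q = 0 \<or> p' q = 1 \<or> p' q = 2 \<or> 2 < p' q"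
      by auto
    ultimately show ?thesis
      by (elim disjE) (simp_all add: pauli1_def e_def Let_def min_def)
  qed
  define E where "E = (\<Prod>q<n. e q)"
  have eq: "(sigma n p * sigma n p') $$ (r, c) = E * (sigma n p' * sigma n p) $$ (r, c)"
    if "r < 2^n" "c < 2^n" for r c
    unfolding sigma_times_entry[OF that] E_def prod.distrib[symmetric]
    by (rule prod.cong) (simp_all add: one[simplified])
  have "E = 1 \<or> E = -1"
    unfolding E_def by (induction n) (auto simp: e_def Let_def)
  then show ?thesis
  proof
    assume "E = 1"
    then have "sigma n p * sigma n p' = sigma n p' * sigma n p"
      using eq by (intro eq_matI) (auto simp: sigma_def)
    then show ?thesis ..
  next
    assume "E = -1"
    then have "sigma n p * sigma n p' = - (sigma n p' * sigma n p)"
      using eq by (intro eq_matI) (auto simp: sigma_def)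
    then show ?thesis by (simp add: anticommute_def)
  qed
qed

lemma adj_sym: "adj n j k \<longleftrightarrow> adj n k j"
proof -
  have "adj n k j" if "adj n j k" for j k
  proof -
    have "sigma n k * sigma n j = - (- (sigma n k * sigma n j))" by (rule eq_matI) auto
    also have "\<dots> = - (sigma n j * sigma n k)"
      using that by (simp add: adj_def anticommute_def)
    finally show ?thesis by (simp add: adj_def anticommute_def)
  qed
  then show ?thesis by blast
qed

lemma adj_irrefl [simp]: "\<not> adj n j j"
proof
  assume "adj n j j"
  then have "(1\<^sub>m (2^n) :: complex mat) = - 1\<^sub>m (2^n)"
    by (simp add: adj_def anticommute_def sigma_square)
  then have "(1\<^sub>m (2^n) :: complex mat) $$ (0,0) = (- 1\<^sub>m (2^n) :: complex mat) $$ (0,0)" by simp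
  then show False by simp
qed

section \<open>Holes and signed words\<close>

text \<open>\<open>N\<close> stands for the positions on a path at which an outside vertex has
  neighbours, \<open>l\<close> for the last position. \<open>no3\<close> excludes a claw centred at
  the outside vertex, \<open>nb\<close> a claw centred at a path vertex. The same statement later
  serves for a hole that has been cut open.\<close>

lemma odd_index_set_cases:
  fixes N :: "nat set" and l :: nat
  assumes sub: "N \<subseteq> {..l}" and odd: "odd (card N)"
    and no3: "\<And>x y z. x \<in> N \<Longrightarrow> y \<in> N \<Longrightarrow> z \<in> N \<Longrightarrow> x + 1 < y \<Longrightarrow> y + 1 < z \<Longrightarrow> False"
    and nb: "\<And>x. x \<in> N \<Longrightarrow> x < l \<Longrightarrow> x + 1 \<in> N \<or> (\<exists>y\<in>N. y + 1 = x)"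
  shows "N = {l} \<or> (\<exists>i. i + 2 \<le> l \<and> N = {i, i+1, i+2}) \<or> (\<exists>i. i + 2 < l \<and> N = {i, i+1, l})"
proof -
  have fin: "finite N" using sub finite_subset by blast
  have ne: "N \<noteq> {}" using odd by auto
  define i where "i = Min N"
  have iN: "i \<in> N" and imin: "\<And>x. x \<in> N \<Longrightarrow> i \<le> x" using fin ne by (auto simp: i_def)
  show ?thesis
  proof (cases "i = l")
    case True
    then have "N = {l}" using sub iN imin by fastforce
    then show ?thesis by blast
  next
    case False
    then have "i < l" using sub iN by fastforce
    then have i1: "i + 1 \<in> N" using nb[OF iN] imin by fastforce
    define N' where "N' = N - {i, i+1}"
    have "N = insert i (insert (i+1) N')" using iN i1 by (auto simp: N'_def)
    moreover have "i \<notin> N'" "i + 1 \<notin> N'" "finite N'" using fin by (auto simp: N'_def)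
    ultimately have c: "card N = card N' + 2" by simp
    have fin': "finite N'" using fin by (simp add: N'_def)
    have "odd (card N')" using c odd by simp
    then have ne': "N' \<noteq> {}" by auto
    define a where "a = Min N'"
    have aN: "a \<in> N'" and amin: "\<And>x. x \<in> N' \<Longrightarrow> a \<le> x" using fin' ne' by (auto simp: a_def)
    have a2: "i + 2 \<le> a" using aN imin[of a] by (auto simp: N'_def)
    \<comment> \<open>A position beyond \<open>a + 1\<close> would form, with \<open>i\<close> and
      \<open>a\<close>, three separated positions. Oddness then rules out that both \<open>a\<close>
      and \<open>a + 1\<close> occur.\<close>
    have "N' \<subseteq> {a, a+1}"
    proof
      fix y assume y: "y \<in> N'"
      have "\<not> a + 1 < y" using no3[OF iN, of a y] a2 aN y by (auto simp: N'_def)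
      then show "y \<in> {a, a+1}" using amin[OF y] by auto
    qed
    moreover have "a + 1 \<notin> N'"
    proof
      assume "a + 1 \<in> N'"
      then have "N' = {a, a+1}" using \<open>N' \<subseteq> {a, a+1}\<close> aN by auto
      then show False using \<open>odd (card N')\<close> by simp
    qed
    ultimately have N': "N' = {a}" using aN by auto
    then have N: "N = {i, i+1, a}" using iN i1 by (auto simp: N'_def)
    show ?thesis
    proof (cases "a = i + 2")
      case True then show ?thesis using N sub by auto
    next
      case False
      have "\<not> a < l" using nb[of a] N a2 False by auto
      then have "a = l" using N sub by auto
      then have "i + 2 < l \<and> N = {i, i+1, l}" using N a2 False by auto
      then show ?thesis by blast
    qed
  qed
qed

section \<open>Neighbour counts, paths and holes as lists\<close>

text \<open>Its parity is the sign picked up when the term of \<open>j\<close> is moved through the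
  product over \<open>xs\<close>.\<close>

definition deg :: "nat \<Rightarrow> (nat \<Rightarrow> nat) \<Rightarrow> (nat \<Rightarrow> nat) list \<Rightarrow> nat" where
  "deg n j xs = length (filter (adj n j) xs)"

definition nb_idx :: "nat \<Rightarrow> (nat \<Rightarrow> nat) list \<Rightarrow> (nat \<Rightarrow> nat) \<Rightarrow> nat set" where
  "nb_idx n xs j = {i. i < length xs \<and> adj n j (xs ! i)}"

lemma deg_simps [simp]:
  "deg n j [] = 0"
  "deg n j (x # xs) = (if adj n j x then 1 else 0) + deg n j xs"
  "deg n j (xs @ ys) = deg n j xs + deg n j ys"
  by (auto simp: deg_def)

lemma deg_rev [simp]: "deg n j (rev xs) = deg n j xs"
  by (simp add: deg_def flip: rev_filter)

lemma deg_nb_idx: "deg n j xs = card (nb_idx n xs j)"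
  by (simp add: deg_def nb_idx_def length_filter_conv_card)

lemma deg_eq_0: "(\<And>x. x \<in> set xs \<Longrightarrow> \<not> adj n j x) \<Longrightarrow> deg n j xs = 0"
  by (simp add: deg_def filter_empty_conv)

text \<open>Testing only pairs with \<open>i < l\<close> avoids case splits; symmetry and
  irreflexivity of \<open>adj\<close> supply the other pairs.\<close>

definition pathlike :: "nat \<Rightarrow> (nat \<Rightarrow> nat) list \<Rightarrow> bool" where
  "pathlike n xs \<longleftrightarrow> (\<forall>l<length xs. \<forall>i<l. adj n (xs ! i) (xs ! l) \<longleftrightarrow> l = i + 1)"

lemma induced_path_list_iff:
  "induced_path_list n W xs \<longleftrightarrow> xs \<noteq> [] \<and> distinct xs \<and> set xs \<subseteq> W \<and> pathlike n xs"
proof -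
  have "(\<forall>i<length xs. \<forall>l<length xs. adj n (xs ! i) (xs ! l) \<longleftrightarrow> (l = i + 1 \<or> i = l + 1)) \<longleftrightarrow> pathlike n xs"
  proof
    assume p: "pathlike n xs"
    show "\<forall>i<length xs. \<forall>l<length xs. adj n (xs ! i) (xs ! l) \<longleftrightarrow> (l = i + 1 \<or> i = l + 1)"
    proof (intro allI impI)
      fix i l assume il: "i < length xs" "l < length xs"
      consider "i < l" | "i = l" | "l < i" by linarith
      then show "adj n (xs ! i) (xs ! l) \<longleftrightarrow> (l = i + 1 \<or> i = l + 1)"
      proof cases
        case 1 then show ?thesis using p il by (auto simp: pathlike_def)
      next
        case 3 then show ?thesis using p il by (subst adj_sym) (auto simp: pathlike_def)
      qed simp
    qed
  next
    assume "\<forall>i<length xs. \<forall>l<length xs. adj n (xs ! i) (xs ! l) \<longleftrightarrow> (l = i + 1 \<or> i = l + 1)"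
    then show "pathlike n xs" by (auto simp: pathlike_def)
  qed
  then show ?thesis by (auto simp: induced_path_list_def)
qed

lemma pathlike_adj:
  assumes "pathlike n xs" "i < length xs" "l < length xs"
  shows "adj n (xs ! i) (xs ! l) \<longleftrightarrow> l = i + 1 \<or> i = l + 1"
proof -
  consider "i < l" | "i = l" | "l < i" by linarith
  then show ?thesis
  proof cases
    case 1 then show ?thesis using assms by (auto simp: pathlike_def)
  next
    case 3 then show ?thesis using assms by (subst adj_sym) (auto simp: pathlike_def)
  qed simp
qed

text \<open>Holes of either parity, since lollipops with odd holes also arise. Comparing only
  \<open>i < l\<close> replaces the cyclic successor by one extra closing edge from the first to the
  last entry.\<close>

definition hole :: "nat \<Rightarrow> (nat \<Rightarrow> nat) set \<Rightarrow> (nat \<Rightarrow> nat) list \<Rightarrow> bool" where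
  "hole n W ys \<longleftrightarrow> length ys \<ge> 4 \<and> distinct ys \<and> set ys \<subseteq> W \<and>
     (\<forall>l<length ys. \<forall>i<l. adj n (ys ! i) (ys ! l) \<longleftrightarrow> l = i + 1 \<or> (i = 0 \<and> l = length ys - 1))"

lemma cyclic_succ_iff:
  assumes "i < l" "l < m" "4 \<le> (m::nat)"
  shows "(l = Suc i mod m \<or> i = Suc l mod m) \<longleftrightarrow> l = i + 1 \<or> (i = 0 \<and> l = m - 1)"
  using assms by (cases "Suc l = m") auto

lemma even_hole_list_iff: "even_hole_list n W ys \<longleftrightarrow> hole n W ys \<and> even (length ys)"
proof (cases "length ys \<ge> 4")
  case True
  let ?m = "length ys"
  have "(\<forall>i<?m. \<forall>l<?m. adj n (ys ! i) (ys ! l) \<longleftrightarrow> (l = Suc i mod ?m \<or> i = Suc l mod ?m)) \<longleftrightarrow>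
        (\<forall>l<?m. \<forall>i<l. adj n (ys ! i) (ys ! l) \<longleftrightarrow> l = i + 1 \<or> (i = 0 \<and> l = ?m - 1))" (is "?A \<longleftrightarrow> ?B")
  proof
    assume A: ?A
    show ?B
    proof (intro allI impI)
      fix l i assume il: "l < ?m" "i < l"
      show "adj n (ys ! i) (ys ! l) \<longleftrightarrow> l = i + 1 \<or> (i = 0 \<and> l = ?m - 1)"
        using A il cyclic_succ_iff[OF il(2,1) True] by auto
    qed
  next
    assume B: ?B
    show ?A
    proof (intro allI impI)
      fix i l assume il: "i < ?m" "l < ?m"
      consider "i < l" | "i = l" | "l < i" by linarith
      then show "adj n (ys ! i) (ys ! l) \<longleftrightarrow> (l = Suc i mod ?m \<or> i = Suc l mod ?m)"
      proof cases
        case 1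
        then show ?thesis using B il cyclic_succ_iff[OF 1 il(2) True] by auto
      next
        case 2
        then show ?thesis using il True by (cases "Suc l = ?m") auto
      next
        case 3
        then show ?thesis using B il cyclic_succ_iff[OF 3 il(1) True] by (subst adj_sym) auto
      qed
    qed
  qed
  then show ?thesis by (auto simp: even_hole_list_def hole_def)
qed (auto simp: even_hole_list_def hole_def)

lemma hole_adj:
  assumes "hole n W ys" "i < l" "l < length ys"
  shows "adj n (ys ! i) (ys ! l) \<longleftrightarrow> l = i + 1 \<or> (i = 0 \<and> l = length ys - 1)"
  using assms by (auto simp: hole_def)

lemma hole_rotate1:
  assumes "hole n W ys"
  shows "hole n W (rotate1 ys)"
proof -
  let ?m = "length ys"
  have m: "?m \<ge> 4" using assms by (simp add: hole_def)
  have "adj n (rotate1 ys ! i) (rotate1 ys ! l) \<longleftrightarrow> l = i + 1 \<or> (i = 0 \<and> l = ?m - 1)"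
    if il: "i < l" "l < ?m" for i l
  proof (cases "Suc l = ?m")
    case False
    then show ?thesis using il m hole_adj[OF assms, of "Suc i" "Suc l"] by (auto simp: nth_rotate1)
  next
    case True
    then have "adj n (rotate1 ys ! i) (rotate1 ys ! l) \<longleftrightarrow> adj n (ys ! 0) (ys ! Suc i)"
      using il by (simp add: nth_rotate1 adj_sym)
    then show ?thesis using True il m hole_adj[OF assms, of 0 "Suc i"] by auto
  qed
  then show ?thesis using assms by (auto simp: hole_def)
qed

lemma hole_rotate: "hole n W ys \<Longrightarrow> hole n W (rotate k ys)"
  by (induction k) (auto simp: hole_rotate1)

lemma hole_rev:
  assumes "hole n W ys"
  shows "hole n W (rev ys)"
proof -
  let ?m = "length ys"
  have "adj n (rev ys ! i) (rev ys ! l) \<longleftrightarrow> l = i + 1 \<or> (i = 0 \<and> l = ?m - 1)"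
    if il: "i < l" "l < ?m" for i l
  proof -
    have "adj n (rev ys ! i) (rev ys ! l) \<longleftrightarrow> adj n (ys ! (?m - Suc l)) (ys ! (?m - Suc i))"
      using il by (simp add: rev_nth adj_sym)
    then show ?thesis using hole_adj[OF assms, of "?m - Suc l" "?m - Suc i"] il by auto
  qed
  then show ?thesis using assms by (auto simp: hole_def)
qed

lemma rotate_to_hd:
  assumes "x \<in> set ys"
  obtains k where "hd (rotate k ys) = x"
proof -
  obtain i where i: "i < length ys" "ys ! i = x" using assms by (auto simp: in_set_conv_nth)
  then have "hd (rotate i ys) = x" by (subst hd_rotate_conv_nth) auto
  then show ?thesis using that by blast
qed

lemma hole_hd_nbrs:
  assumes "hole n W ys" "y \<in> set ys"
  shows "adj n (hd ys) y \<longleftrightarrow> y = ys ! 1 \<or> y = last ys"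
proof -
  let ?m = "length ys"
  have m: "?m \<ge> 4" and d: "distinct ys" using assms by (auto simp: hole_def)
  have ne: "ys \<noteq> []" using m by auto
  obtain i where i: "i < ?m" "ys ! i = y" using assms by (auto simp: in_set_conv_nth)
  have "y = ys ! 1 \<longleftrightarrow> i = 1" using i m d nth_eq_iff_index_eq[OF d, of i 1] by auto
  moreover have "y = last ys \<longleftrightarrow> i = ?m - 1"
    using i m d nth_eq_iff_index_eq[OF d, of i "?m - 1"] ne by (auto simp: last_conv_nth)
  moreover have "adj n (hd ys) y \<longleftrightarrow> i = 1 \<or> i = ?m - 1"
  proof (cases "i = 0")
    case True then show ?thesis using i m ne by (auto simp: hd_conv_nth)
  next
    case False then show ?thesis using hole_adj[OF assms(1), of 0 i] i ne by (auto simp: hd_conv_nth)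
  qed
  ultimately show ?thesis by blast
qed

text \<open>Once \<open>x\<close> is rotated to the head, its neighbours are the second and the last
  entry, which are distinct and nonadjacent because the cycle has at least four vertices.\<close>

lemma hole_nbrs:
  assumes "hole n W ys" "x \<in> set ys"
  obtains u v where "u \<in> set ys" "v \<in> set ys" "u \<noteq> v" "\<not> adj n u v"
    "\<forall>y\<in>set ys. adj n x y \<longleftrightarrow> y = u \<or> y = v"
proof -
  obtain k where k: "hd (rotate k ys) = x" using rotate_to_hd assms by metis
  define zs where "zs = rotate k ys"
  have h: "hole n W zs" using assms by (simp add: zs_def hole_rotate)
  have s: "set zs = set ys" by (simp add: zs_def)
  have m: "length zs \<ge> 4" and d: "distinct zs" and ne: "zs \<noteq> []" using h by (auto simp: hole_def)
  show ?thesis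
  proof (rule that[of "zs ! 1" "last zs"])
    have l: "last zs = zs ! (length zs - 1)" using ne by (simp add: last_conv_nth)
    show "zs ! 1 \<in> set ys" using m s nth_mem[of 1 zs] by auto
    show "last zs \<in> set ys" using ne s last_in_set by blast
    show "zs ! 1 \<noteq> last zs" using m nth_eq_iff_index_eq[OF d, of 1 "length zs - 1"] l by auto
    show "\<not> adj n (zs ! 1) (last zs)" using hole_adj[OF h, of 1 "length zs - 1"] m l by auto
    show "\<forall>y\<in>set ys. adj n x y \<longleftrightarrow> y = zs ! 1 \<or> y = last zs"
      using hole_hd_nbrs[OF h] k s by (simp add: zs_def)
  qed
qed

lemma hole_no_triangle:
  assumes "hole n W ys" "x \<in> set ys" "y \<in> set ys" "z \<in> set ys" "adj n x y" "adj n x z" "adj n y z"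
  shows False
  using hole_nbrs[OF assms(1,2)] assms(3-) by (metis adj_irrefl adj_sym)

text \<open>The head fixes the starting point and the last entry fixes the direction; from there on
  each vertex has only one neighbour that has not been visited.\<close>

lemma hole_unique:
  assumes "hole n W ys" "hole n W zs" "set ys = set zs" "hd ys = hd zs" "last ys = last zs"
  shows "ys = zs"
proof -
  have len: "length ys = length zs"
    using assms(1-3) by (metis distinct_card hole_def)
  let ?m = "length ys"
  have m: "?m \<ge> 4" and d: "distinct ys" "distinct zs" and ne: "ys \<noteq> []" "zs \<noteq> []"
    using assms(1,2) by (auto simp: hole_def)
  have "\<forall>k\<le>i. ys ! k = zs ! k" if "i < ?m" for i
    using that
  proof (induction i)
    case 0 then show ?case using assms(4) ne by (simp add: hd_conv_nth)
  next
    case (Suc i)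
    then have IH: "\<And>k. k \<le> i \<Longrightarrow> ys ! k = zs ! k" by simp
    have "zs ! Suc i \<in> set ys" using Suc.prems len assms(3) by simp
    then obtain k where k: "k < ?m" "ys ! k = zs ! Suc i" by (metis in_set_conv_nth)
    have ki: "\<not> k \<le> i"
    proof
      assume "k \<le> i"
      then have "zs ! k = zs ! Suc i" using IH k by simp
      then show False using nth_eq_iff_index_eq[OF d(2), of k "Suc i"] Suc.prems \<open>k \<le> i\<close> len by auto
    qed
    have "adj n (zs ! i) (zs ! Suc i)" using hole_adj[OF assms(2), of i "Suc i"] Suc.prems len by auto
    then have "adj n (ys ! i) (ys ! k)" using IH k by simp
    then have "k = i + 1 \<or> (i = 0 \<and> k = ?m - 1)" using hole_adj[OF assms(1), of i k] ki k by auto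
    then have "k = Suc i"
    proof
      \<comment> \<open>Only at the head are two continuations possible; the one along the closing
        edge is the common last entry, which cannot stand at position 1.\<close>
      assume a: "i = 0 \<and> k = ?m - 1"
      then have "zs ! Suc i = last zs" using k assms(5) ne by (simp add: last_conv_nth)
      then have "Suc i = ?m - 1" using nth_eq_iff_index_eq[OF d(2), of "Suc i" "?m - 1"] Suc.prems len ne
        by (simp add: last_conv_nth)
      then show ?thesis using m a by simp
    qed simp
    then show ?case using IH k by (metis le_Suc_eq)
  qed
  then show ?thesis using len by (intro nth_equalityI) auto
qed

text \<open>Rotation brings any edge into the closing position but keeps the direction of the list,
  hence the two alternatives.\<close>

lemma hole_list_with_ends:
  assumes "hole n W ys" "a \<in> set ys" "b \<in> set ys" "adj n a b"
  obtains k where "hd (rotate k ys) = a \<and> last (rotate k ys) = b \<or>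
                   hd (rotate k ys) = b \<and> last (rotate k ys) = a"
proof -
  obtain k where k: "hd (rotate k ys) = a" using rotate_to_hd assms by metis
  let ?z = "rotate k ys"
  have h: "hole n W ?z" using assms hole_rotate by blast
  have ne: "?z \<noteq> []" and m: "length ?z \<ge> 4" using h by (auto simp: hole_def)
  have "b = ?z ! 1 \<or> b = last ?z" using hole_hd_nbrs[OF h, of b] assms k by auto
  then show ?thesis
  proof
    assume "b = last ?z" then show ?thesis using k that by blast
  next
    assume b: "b = ?z ! 1"
    have "hd (rotate1 ?z) = b" "last (rotate1 ?z) = a"
      using b k m ne by (cases ?z; cases "tl ?z"; simp add: hd_append)+
    then show ?thesis using that[of "Suc k"] by simp
  qed
qed

lemma hole_update:
  assumes "hole n W ys" "i < length ys" "j \<in> W" "j \<notin> set ys"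
    and "\<And>y. y \<in> set ys \<Longrightarrow> y \<noteq> ys ! i \<Longrightarrow> adj n j y \<longleftrightarrow> adj n (ys ! i) y"
  shows "hole n W (ys[i := j])"
proof -
  have d: "distinct ys" using assms by (auto simp: hole_def)
  have "adj n (ys[i:=j] ! k) (ys[i:=j] ! l) \<longleftrightarrow> adj n (ys ! k) (ys ! l)"
    if kl: "k < l" "l < length ys" for k l
  proof -
    have ne: "ys ! l \<noteq> ys ! i" if "l \<noteq> i" "l < length ys" for l
      using nth_eq_iff_index_eq[OF d] that assms(2) by blast
    consider "k = i" | "l = i" | "k \<noteq> i" "l \<noteq> i" by blast
    then show ?thesis
    proof cases
      case 1
      then show ?thesis using kl ne[of l] assms(5)[of "ys ! l"] by simp
    next
      case 2
      then show ?thesis using kl ne[of k] assms(5)[of "ys ! k"] by (simp add: adj_sym[of n "ys ! k"])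
    qed simp
  qed
  moreover have "set (ys[i:=j]) \<subseteq> W"
    using assms(1,3) set_update_subset_insert[of ys i j] by (auto simp: hole_def)
  moreover have "distinct (ys[i:=j])" using d assms(4) by (simp add: distinct_list_update)
  ultimately show ?thesis using assms(1) by (auto simp: hole_def)
qed

lemma pathlike_butlast_hole:
  assumes "hole n U ys"
  shows "pathlike n (butlast ys)"
  unfolding pathlike_def
proof (intro allI impI)
  fix l i assume "l < length (butlast ys)" "i < l"
  then show "adj n (butlast ys ! i) (butlast ys ! l) \<longleftrightarrow> l = i + 1"
    using hole_adj[OF assms, of i l] by (auto simp: nth_butlast)
qed

lemma deg_hole_member:
  assumes "hole n U ys" "x \<in> set ys"
  shows "deg n x ys = 2"
proof -
  obtain u v where uv: "u \<in> set ys" "v \<in> set ys" "u \<noteq> v" "\<not> adj n u v"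
    "\<forall>y\<in>set ys. adj n x y \<longleftrightarrow> y = u \<or> y = v" using hole_nbrs[OF assms] by blast
  have "distinct ys" using assms by (simp add: hole_def)
  then have "deg n x ys = card (set (filter (adj n x) ys))"
    unfolding deg_def by (metis distinct_card distinct_filter)
  also have "set (filter (adj n x) ys) = {u, v}" using uv by auto
  finally show ?thesis using uv(3) by simp
qed

section \<open>Signs of reordered products along paths and holes\<close>

text \<open>The model is one entry of a fixed matrix times the product of the terms in a list.
  Keeping only the exchange rule turns operator identities into identities between complex
  numbers.\<close>

locale word_function =
  fixes n :: nat and W :: "(nat \<Rightarrow> nat) list \<Rightarrow> complex"
  assumes swap: "W (xs @ [a, c] @ ys) = (if adj n a c then - W (xs @ [c, a] @ ys) else W (xs @ [c, a] @ ys))"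
begin

lemma move: "W (xs @ [a] @ ys @ zs) = (-1) ^ deg n a ys * W (xs @ ys @ [a] @ zs)"
proof (induction ys arbitrary: xs)
  case (Cons y ys)
  have "W (xs @ [a] @ (y # ys) @ zs) = (if adj n a y then -1 else 1) * W ((xs @ [y]) @ [a] @ ys @ zs)"
    using swap[of xs a y "ys @ zs"] by simp
  also have "\<dots> = (if adj n a y then -1 else 1) * ((-1) ^ deg n a ys * W ((xs @ [y]) @ ys @ [a] @ zs))"
    unfolding Cons ..
  finally show ?case by simp
qed simp

lemma block: "W (xs @ Q @ ys @ zs) = (-1) ^ (\<Sum>q\<leftarrow>Q. deg n q ys) * W (xs @ ys @ Q @ zs)"
proof (induction Q arbitrary: xs)
  case (Cons q Q)
  have "W (xs @ (q # Q) @ ys @ zs) = W ((xs @ [q]) @ Q @ ys @ zs)" by simp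
  also have "\<dots> = (-1) ^ (\<Sum>q\<leftarrow>Q. deg n q ys) * W (xs @ [q] @ ys @ Q @ zs)"
    unfolding Cons by simp
  also have "W (xs @ [q] @ ys @ Q @ zs) = (-1) ^ deg n q ys * W (xs @ ys @ [q] @ Q @ zs)"
    by (rule move)
  finally show ?case by (simp add: power_add)
qed simp

text \<open>Reversal exchanges every pair of factors once, and a path on \<open>length xs\<close>
  vertices has one edge fewer than vertices.\<close>

lemma rev_pathlike:
  assumes "pathlike n xs"
  shows "W (us @ rev xs @ vs) = (-1) ^ (length xs - 1) * W (us @ xs @ vs)"
  using assms
proof (induction xs arbitrary: vs)
  case (Cons x xs)
  have p: "pathlike n xs" unfolding pathlike_def
  proof (intro allI impI)
    fix l i assume "l < length xs" "i < l"
    then show "adj n (xs ! i) (xs ! l) = (l = i + 1)"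
      using pathlike_adj[OF Cons.prems, of "Suc i" "Suc l"] by simp
  qed
  have d: "deg n x xs = (if xs = [] then 0 else 1)"
  proof -
    have "nb_idx n xs x = {i. i < length xs \<and> i = 0}"
      unfolding nb_idx_def using pathlike_adj[OF Cons.prems, of 0 "Suc i" for i] by fastforce
    also have "\<dots> = (if xs = [] then {} else {0})" by auto
    finally show ?thesis by (simp add: deg_nb_idx)
  qed
  have "W (us @ rev (x # xs) @ vs) = (-1) ^ (length xs - 1) * W (us @ xs @ [x] @ vs)"
    using Cons.IH[OF p, of "[x] @ vs"] by simp
  also have "W (us @ xs @ [x] @ vs) = (-1) ^ deg n x xs * W (us @ [x] @ xs @ vs)"
    using move[of us x xs vs] by (simp add: d)
  finally show ?case using d by (cases xs) auto
qed simp

text \<open>The first vertex has exactly two neighbours among the others, so moving it to the end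
  costs no sign.\<close>

lemma hole_rotate1_word:
  assumes "hole n U ys"
  shows "W (us @ rotate1 ys @ vs) = W (us @ ys @ vs)"
proof -
  obtain y zs where ys: "ys = y # zs" using assms by (cases ys) (auto simp: hole_def)
  have "deg n y zs = 2" using deg_hole_member[OF assms, of y] ys by simp
  then show ?thesis using move[of us y zs vs] ys by simp
qed

lemma hole_rotate_word: "hole n U ys \<Longrightarrow> W (us @ rotate k ys @ vs) = W (us @ ys @ vs)"
  by (induction k) (simp_all add: hole_rotate1_word[OF hole_rotate])

text \<open>A cycle has as many edges as vertices. Even holes thus have a product independent of
  direction, while for odd holes the sign flips, which is why odd lollipops cancel.\<close>

lemma hole_rev_word:
  assumes "hole n U ys"
  shows "W (us @ rev ys @ vs) = (-1) ^ length ys * W (us @ ys @ vs)"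
proof -
  obtain zs y where ys: "ys = zs @ [y]" using assms by (cases ys rule: rev_cases) (auto simp: hole_def)
  have len: "length zs \<ge> 3" using assms ys by (simp add: hole_def)
  have "deg n y zs = 2" using deg_hole_member[OF assms, of y] ys by simp
  then have "W (us @ rev ys @ vs) = W (us @ rev zs @ [y] @ vs)"
    using move[of us y "rev zs" vs] ys by simp
  also have "\<dots> = (-1) ^ (length zs - 1) * W (us @ zs @ [y] @ vs)"
    using rev_pathlike[of zs us "[y] @ vs"] pathlike_butlast_hole[OF assms] ys by simp
  also have "(-1::complex) ^ (length zs - 1) = (-1) ^ length ys"
    using len ys by (cases "length zs") auto
  finally show ?thesis using ys by simp
qed

text \<open>Two lists of one hole differ by a rotation and possibly a reversal, both free of sign
  for even length. This makes the arbitrary choice of a list in \<open>cycle_op\<close>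
  harmless.\<close>

lemma even_hole_words_eq:
  assumes "even_hole_list n V ys" "even_hole_list n V zs" "set ys = set zs"
  shows "W (us @ ys @ vs) = W (us @ zs @ vs)"
proof -
  have h: "hole n V ys" "hole n V zs" "even (length ys)" using assms by (auto simp: even_hole_list_iff)
  have m: "length zs \<ge> 4" "zs \<noteq> []" using h by (auto simp: hole_def)
  have "adj n (hd zs) (last zs)" using hole_hd_nbrs[OF h(2), of "last zs"] m by auto
  then obtain k where k: "hd (rotate k ys) = hd zs \<and> last (rotate k ys) = last zs \<or>
                   hd (rotate k ys) = last zs \<and> last (rotate k ys) = hd zs"
    using hole_list_with_ends[OF h(1), of "hd zs" "last zs"] assms(3) m by auto
  let ?r = "rotate k ys"
  have r: "hole n V ?r" "W (us @ ?r @ vs) = W (us @ ys @ vs)" "set ?r = set zs" "even (length ?r)"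
    using h hole_rotate hole_rotate_word assms(3) by auto
  from k show ?thesis
  proof
    assume "hd ?r = hd zs \<and> last ?r = last zs"
    then have "?r = zs" using hole_unique[OF r(1) h(2)] r by blast
    then show ?thesis using r by simp
  next
    assume a: "hd ?r = last zs \<and> last ?r = hd zs"
    have "rev ?r = zs"
      using hole_unique[OF hole_rev[OF r(1)] h(2)] r a m by (simp add: hd_rev last_rev)
    then show ?thesis using hole_rev_word[OF r(1), of us vs] r by simp
  qed
qed

text \<open>In passing from \<open>t\<close> to \<open>t + 1\<close> only \<open>xs ! (2*t)\<close>
  has to move, past the earlier odd positions, and among these it meets one neighbour,
  \<open>xs ! (2*t - 1)\<close>. The first step is free, hence the exponent
  \<open>t - 1\<close>.\<close>

lemma split_even_odd_word:
  assumes "hole n V xs" "2 * t \<le> length xs"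
  shows "W (map ((!) xs) (filter even [0..<2*t]) @ map ((!) xs) (filter odd [0..<2*t]) @ vs)
       = (-1) ^ (t - 1) * W (map ((!) xs) [0..<2*t] @ vs)"
  using assms(2)
proof (induction t arbitrary: vs)
  case (Suc t)
  let ?E = "map ((!) xs) (filter even [0..<2*t])" and ?O = "map ((!) xs) (filter odd [0..<2*t])"
  have d: "deg n (xs ! (2*t)) ?O = (if t = 0 then 0 else 1)"
  proof (cases "t = 0")
    case False
    \<comment> \<open>The closing edge of the hole uses position 0, which is even, so it never
      interferes.\<close>
    have a: "adj n (xs ! (2*t)) (xs ! i) \<longleftrightarrow> i = 2*t - 1" if "i < 2*t" "odd i" for i
    proof -
      have "i \<noteq> 0" using that by (metis even_zero)
      then show ?thesis using hole_adj[OF assms(1), of i "2*t"] that Suc.prems by (auto simp: adj_sym[of n "xs ! (2*t)"])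
    qed
    have "deg n (xs ! (2*t)) ?O = length (filter (\<lambda>i. adj n (xs ! (2*t)) (xs ! i)) (filter odd [0..<2*t]))"
      by (simp add: deg_def filter_map o_def)
    also have "filter (\<lambda>i. adj n (xs ! (2*t)) (xs ! i)) (filter odd [0..<2*t])
      = filter (\<lambda>i. i = 2*t - 1) [0..<2*t]"
      unfolding filter_filter by (rule filter_cong) (use a False in auto)
    also have "\<dots> = [2*t - 1]"
    proof -
      have "[0..<2*t] = [0..<2*t-1] @ [2*t-1]" using False
        by (metis Suc_diff_1 gr0I mult_is_0 upt_Suc_append zero_le zero_neq_numeral)
      then show ?thesis by (simp add: filter_empty_conv)
    qed
    finally show ?thesis using False by simp
  qed simp
  have "W (map ((!) xs) (filter even [0..<2*Suc t]) @ map ((!) xs) (filter odd [0..<2*Suc t]) @ vs)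
     = W (?E @ [xs ! (2*t)] @ ?O @ [xs ! (2*t+1)] @ vs)" by simp
  also have "\<dots> = (-1) ^ (if t = 0 then 0 else 1) * W (?E @ ?O @ [xs ! (2*t)] @ [xs ! (2*t+1)] @ vs)"
    unfolding move d ..
  also have "W (?E @ ?O @ [xs ! (2*t)] @ [xs ! (2*t+1)] @ vs)
     = (-1) ^ (t - 1) * W (map ((!) xs) [0..<2*t] @ [xs ! (2*t)] @ [xs ! (2*t+1)] @ vs)"
    using Suc by simp
  finally show ?case by (cases t) (simp_all add: numeral_2_eq_2)
qed simp

lemma even_odd_word:
  assumes "even_hole_list n V xs"
  shows "W (map (\<lambda>i. xs ! i) (filter even [0..<length xs]) @ map (\<lambda>i. xs ! i) (filter odd [0..<length xs]) @ vs)
       = (-1) ^ (length xs div 2 - 1) * W (xs @ vs)"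
proof -
  have "hole n V xs" "even (length xs)" using assms by (auto simp: even_hole_list_iff)
  then show ?thesis using split_even_odd_word[of V xs "length xs div 2" vs] by (simp add: map_nth)
qed

end

section \<open>Induced paths starting at a simplicial vertex\<close>

text \<open>Counting the pairs of members of a common class in both orders spreads a class sum
  evenly over the class, and \<open>\<phi>\<close> can be carried along because it is constant
  there. The application is to hole products, of which only class sums are known.\<close>

lemma sum_average_over_classes:
  fixes w :: "'b \<Rightarrow> complex"
  assumes fin: "finite S"
    and cl: "\<And>C. C \<in> S \<Longrightarrow> cl C \<subseteq> S" "\<And>C. C \<in> S \<Longrightarrow> C \<in> cl C"
    and cl_eq: "\<And>C C'. C \<in> S \<Longrightarrow> C' \<in> cl C \<Longrightarrow> cl C' = cl C"
    and phi: "\<And>C C'. C \<in> S \<Longrightarrow> C' \<in> cl C \<Longrightarrow> \<phi> C' = \<phi> C"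
    and w: "\<And>C. C \<in> S \<Longrightarrow> (\<Sum>C'\<in>cl C. w C') = ev C * x"
  shows "(\<Sum>C\<in>S. \<phi> C * w C) = (\<Sum>C\<in>S. \<phi> C * (ev C / of_nat (card (cl C))) * x)"
proof -
  have fcl: "finite (cl C)" if "C \<in> S" for C using cl(1)[OF that] fin finite_subset by blast
  have mem: "C' \<in> cl C \<longleftrightarrow> C \<in> cl C'" if "C \<in> S" "C' \<in> S" for C C'
    using cl cl_eq that by metis
  have "(\<Sum>C\<in>S. \<phi> C * (ev C / of_nat (card (cl C))) * x)
      = (\<Sum>C\<in>S. \<Sum>C'\<in>cl C. \<phi> C / of_nat (card (cl C)) * w C')"
  proof (rule sum.cong[OF refl])
    fix C assume "C \<in> S"
    then show "\<phi> C * (ev C / of_nat (card (cl C))) * x = (\<Sum>C'\<in>cl C. \<phi> C / of_nat (card (cl C)) * w C')"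
      unfolding sum_distrib_left[symmetric] using w[of C] by simp
  qed
  also have "\<dots> = (\<Sum>C\<in>S. \<Sum>C'\<in>{C'\<in>S. C' \<in> cl C}. \<phi> C / of_nat (card (cl C)) * w C')"
    using cl(1) by (intro sum.cong) auto
  also have "\<dots> = (\<Sum>C'\<in>S. \<Sum>C\<in>{C\<in>S. C' \<in> cl C}. \<phi> C / of_nat (card (cl C)) * w C')"
    by (rule sum.swap_restrict[OF fin fin])
  also have "\<dots> = (\<Sum>C'\<in>S. \<phi> C' * w C')"
  proof (rule sum.cong[OF refl])
    fix C' assume C': "C' \<in> S"
    have "{C\<in>S. C' \<in> cl C} = cl C'" using mem[of _ C'] C' cl(1) by blast
    moreover have "\<phi> C / of_nat (card (cl C)) * w C' = \<phi> C' / of_nat (card (cl C')) * w C'" if "C \<in> cl C'" for C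
      using cl_eq[OF C' that] phi[OF C' that] by simp
    moreover have "card (cl C') \<noteq> 0" using fcl[OF C'] cl(2)[OF C'] by auto
    ultimately show "(\<Sum>C\<in>{C\<in>S. C' \<in> cl C}. \<phi> C / of_nat (card (cl C)) * w C') = \<phi> C' * w C'"
      by simp
  qed
  finally show ?thesis ..
qed

lemma pathlike_snoc:
  assumes "Q \<noteq> []"
  shows "pathlike n (Q @ [j]) \<longleftrightarrow> pathlike n Q \<and> (\<forall>x\<in>set (butlast Q). \<not> adj n x j) \<and> adj n (last Q) j"
proof -
  let ?m = "length Q"
  have split: "pathlike n (Q @ [j]) \<longleftrightarrow> pathlike n Q \<and> (\<forall>i<?m. adj n (Q ! i) j \<longleftrightarrow> ?m = i + 1)"
    unfolding pathlike_def by (auto simp: nth_append less_Suc_eq)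
  have "(\<forall>i<?m. adj n (Q ! i) j \<longleftrightarrow> ?m = i + 1) \<longleftrightarrow>
     (\<forall>i<?m - 1. \<not> adj n (Q ! i) j) \<and> adj n (last Q) j"
  proof -
    have l: "last Q = Q ! (?m - 1)" "?m - 1 < ?m" using assms by (auto simp: last_conv_nth)
    show ?thesis
    proof
      assume A: "\<forall>i<?m. adj n (Q ! i) j \<longleftrightarrow> ?m = i + 1"
      have "\<not> adj n (Q ! i) j" if "i < ?m - 1" for i using A[rule_format, of i] that by auto
      moreover have "adj n (last Q) j" using A[rule_format, of "?m - 1"] l by auto
      ultimately show "(\<forall>i<?m - 1. \<not> adj n (Q ! i) j) \<and> adj n (last Q) j" by blast
    next
      assume A: "(\<forall>i<?m - 1. \<not> adj n (Q ! i) j) \<and> adj n (last Q) j"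
      show "\<forall>i<?m. adj n (Q ! i) j \<longleftrightarrow> ?m = i + 1"
      proof (intro allI impI)
        fix i assume "i < ?m"
        then show "adj n (Q ! i) j \<longleftrightarrow> ?m = i + 1"
          by (cases "i = ?m - 1") (use A l in auto)
      qed
    qed
  qed
  also have "(\<forall>i<?m - 1. \<not> adj n (Q ! i) j) \<longleftrightarrow> (\<forall>x\<in>set (butlast Q). \<not> adj n x j)"
    by (auto simp: all_set_conv_all_nth nth_butlast)
  finally show ?thesis using split by simp
qed

section \<open>Claw-free graphs with a simplicial vertex\<close>

text \<open>\<open>s\<close> plays the added vertex, and claws are excluded with \<open>s\<close>
  included; deriving this from the simplicial clique is left to the final theorem.\<close>

locale simplicial_graph =
  fixes n :: nat and V :: "(nat \<Rightarrow> nat) set" and s :: "nat \<Rightarrow> nat"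
  assumes finV: "finite V" and s_notin: "s \<notin> V"
    and claw: "\<And>v a c d. v \<in> insert s V \<Longrightarrow> a \<in> insert s V \<Longrightarrow> c \<in> insert s V \<Longrightarrow> d \<in> insert s V \<Longrightarrow>
      adj n v a \<Longrightarrow> adj n v c \<Longrightarrow> adj n v d \<Longrightarrow> a \<noteq> c \<Longrightarrow> a \<noteq> d \<Longrightarrow> c \<noteq> d \<Longrightarrow>
      \<not> adj n a c \<Longrightarrow> \<not> adj n a d \<Longrightarrow> \<not> adj n c d \<Longrightarrow> False"
    and s_clique: "\<And>x y. x \<in> V \<Longrightarrow> y \<in> V \<Longrightarrow> adj n s x \<Longrightarrow> adj n s y \<Longrightarrow> x \<noteq> y \<Longrightarrow> adj n x y"
begin

definition rest :: "(nat \<Rightarrow> nat) set \<Rightarrow> (nat \<Rightarrow> nat) set" where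
  "rest X = {v \<in> V. v \<notin> X \<and> (\<forall>x\<in>X. \<not> adj n x v)}"

text \<open>A vertex away from \<open>X\<close> but adjacent to \<open>k\<close> would be the third
  leaf of a claw at \<open>k\<close>, next to \<open>u\<close> and \<open>w\<close>. This is the
  reason why different paths and holes share the same \<open>rest\<close>.\<close>

lemma rest_insert:
  assumes "k \<in> insert s V" "X \<subseteq> insert s V" "u \<in> X" "w \<in> X" "u \<noteq> w" "\<not> adj n u w" "adj n k u" "adj n k w"
  shows "rest (insert k X) = rest X"
proof (intro equalityI subsetI)
  fix v assume v: "v \<in> rest X"
  have "\<not> adj n k v"
    using claw[of k u w v] v assms by (auto simp: rest_def)
  moreover have "v \<noteq> k" using v assms by (auto simp: rest_def adj_sym[of n k])
  ultimately show "v \<in> rest (insert k X)" using v by (auto simp: rest_def)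
qed (auto simp: rest_def)

text \<open>Starting at \<open>s\<close> fixes the direction, so the list is determined by its
  vertex set.\<close>

definition spath :: "(nat \<Rightarrow> nat) list \<Rightarrow> bool" where
  "spath xs \<longleftrightarrow> induced_path_list n (insert s V) xs \<and> hd xs = s"

lemma spath_iff:
  "spath xs \<longleftrightarrow> xs \<noteq> [] \<and> hd xs = s \<and> distinct xs \<and> set (tl xs) \<subseteq> V \<and> pathlike n xs"
  unfolding spath_def induced_path_list_iff by (cases xs) auto

lemma spath_sing [simp]: "spath [s]"
  by (simp add: spath_iff pathlike_def)

lemma spath_D:
  assumes "spath xs"
  shows "xs \<noteq> []" "hd xs = s" "distinct xs" "set xs \<subseteq> insert s V" "pathlike n xs"
  using assms by (auto simp: spath_def induced_path_list_iff)

lemma finite_spath: "finite {xs. spath xs}"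
proof -
  have "{xs. spath xs} \<subseteq> {xs. set xs \<subseteq> insert s V \<and> distinct xs}"
    using spath_D by blast
  moreover have "finite {xs. set xs \<subseteq> insert s V \<and> distinct xs}"
    using finite_subset_distinct[of "insert s V"] finV by simp
  ultimately show ?thesis using finite_subset by blast
qed

lemma spath_snoc:
  assumes "Q \<noteq> []"
  shows "spath (Q @ [j]) \<longleftrightarrow> spath Q \<and> j \<in> rest (set (butlast Q)) \<and> adj n (last Q) j"
proof -
  have Q: "set Q = insert (last Q) (set (butlast Q))"
    using assms by (metis append_butlast_last_id list.set(1) list.simps(15) set_append Un_insert_right sup_bot_right)
  show ?thesis
    unfolding spath_iff pathlike_snoc[OF assms] rest_def using assms Q
    by (auto simp: hd_append)
qed

lemma spath_butlast:
  assumes "spath Q" "length Q \<ge> 2"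
  shows "spath (butlast Q)"
proof -
  have "butlast Q \<noteq> []" "butlast Q @ [last Q] = Q" using assms by (cases Q; auto)+
  then show ?thesis using spath_snoc[of "butlast Q" "last Q"] assms by simp
qed

lemma last_notin_rest:
  assumes "spath Q"
  shows "last Q \<notin> rest (set (butlast Q))"
proof (cases "length Q \<ge> 2")
  case True
  then have b: "butlast Q \<noteq> []" "butlast Q @ [last Q] = Q" using assms by (cases Q; auto)+
  then have "adj n (last (butlast Q)) (last Q)" using spath_snoc[of "butlast Q" "last Q"] assms by simp
  then show ?thesis using b(1) last_in_set by (auto simp: rest_def)
next
  case False
  then have "Q = [s]" using spath_D[OF assms] by (cases Q; cases "tl Q") auto
  then show ?thesis using s_notin by (auto simp: rest_def)
qed

lemma set_eq_insert_last: "Q \<noteq> [] \<Longrightarrow> set Q = insert (last Q) (set (butlast Q))"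
  by (metis append_butlast_last_id list.set(1) list.simps(15) set_append Un_insert_right sup_bot_right)

lemma rest_step:
  assumes "spath Q"
  shows "rest (set Q) = rest (set (butlast Q)) - {v. adj n (last Q) v}"
  using last_notin_rest[OF assms] set_eq_insert_last[OF spath_D(1)[OF assms]]
  by (auto simp: rest_def)

lemma rest_subset: "rest X \<subseteq> V" by (auto simp: rest_def)

text \<open>Two nonadjacent vertices of this kind would form a claw at \<open>last Q\<close> with
  the vertex before it. The path consisting of \<open>s\<close> alone has no such vertex, and there
  \<open>s_clique\<close> applies.\<close>

lemma last_clique:
  assumes "spath Q" "x \<in> rest (set (butlast Q))" "y \<in> rest (set (butlast Q))"
    "adj n (last Q) x" "adj n (last Q) y" "x \<noteq> y"
  shows "adj n x y"
proof (cases "length Q \<ge> 2")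
  case True
  then have b: "butlast Q \<noteq> []" "butlast Q @ [last Q] = Q" using assms by (cases Q; auto)+
  let ?p = "last (butlast Q)"
  have p: "?p \<in> set (butlast Q)" using b by simp
  have a: "adj n ?p (last Q)" using spath_snoc[of "butlast Q" "last Q"] assms b by simp
  have U: "?p \<in> insert s V" "last Q \<in> insert s V"
    using spath_D(1,4)[OF assms(1)] p in_set_butlastD last_in_set by fastforce+
  show ?thesis
    using claw[of "last Q" ?p x y] U p a assms rest_subset[of "set (butlast Q)"]
    by (auto simp: rest_def adj_sym[of n "last Q" ?p])
next
  case False
  then have "Q = [s]" using spath_D[OF assms(1)] by (cases Q; cases "tl Q") auto
  then show ?thesis using assms s_clique by (auto simp: rest_def)
qed

text \<open>\<open>att Q ys\<close>: the path \<open>Q\<close> and the hole \<open>ys\<close> form a lollipop, glued along the triangle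
spanned by the end of \<open>Q\<close> and the edge between the two ends of the list \<open>ys\<close>.\<close>

definition att :: "(nat \<Rightarrow> nat) list \<Rightarrow> (nat \<Rightarrow> nat) list \<Rightarrow> bool" where
  "att Q ys \<longleftrightarrow> spath Q \<and> hole n V ys \<and> set ys \<subseteq> rest (set (butlast Q)) \<and>
     (\<forall>y\<in>set ys. adj n (last Q) y \<longleftrightarrow> y = hd ys \<or> y = last ys)"

lemma att_rev: "att Q ys \<Longrightarrow> att Q (rev ys)"
  by (auto simp: att_def hole_rev hd_rev last_rev)

lemma att_disjoint:
  assumes "att Q ys"
  shows "set Q \<inter> set ys = {}"
proof -
  have "set ys \<subseteq> rest (set (butlast Q))" "spath Q" using assms by (auto simp: att_def)
  then show ?thesis using last_notin_rest[of Q] set_eq_insert_last[OF spath_D(1)[of Q]]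
    by (auto simp: rest_def)
qed

lemma att_adj:
  assumes "att Q ys" "i < length Q" "k < length ys"
  shows "adj n (Q ! i) (ys ! k) \<longleftrightarrow> Suc i = length Q \<and> (k = 0 \<or> Suc k = length ys)"
proof (cases "Suc i = length Q")
  case True
  have h: "hole n V ys" using assms by (simp add: att_def)
  have ne: "ys \<noteq> []" "distinct ys" "Q \<noteq> []" using h assms by (auto simp: hole_def)
  have "i = length Q - 1" using True by simp
  then have "Q ! i = last Q" using ne by (simp add: last_conv_nth)
  then have "adj n (Q ! i) (ys ! k) \<longleftrightarrow> ys ! k = ys ! 0 \<or> ys ! k = ys ! (length ys - 1)"
    using assms ne by (auto simp: att_def hd_conv_nth last_conv_nth)
  also have "\<dots> \<longleftrightarrow> k = 0 \<or> Suc k = length ys"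
    using nth_eq_iff_index_eq[OF ne(2), of k 0] nth_eq_iff_index_eq[OF ne(2), of k "length ys - 1"] assms ne
    by (cases "length ys") auto
  finally show ?thesis using True by simp
next
  case False
  then have "Q ! i \<in> set (butlast Q)" using assms by (metis Suc_lessI in_set_conv_nth length_butlast less_diff_conv nth_butlast Suc_eq_plus1)
  moreover have "ys ! k \<in> rest (set (butlast Q))" using assms by (auto simp: att_def)
  ultimately show ?thesis using False by (auto simp: rest_def)
qed

text \<open>Deleting \<open>last ys\<close> removes the closing edge of the hole and the second
  contact with \<open>last Q\<close>, which opens the lollipop into an induced path.\<close>

lemma att_spath:
  assumes "att Q ys"
  shows "spath (Q @ butlast ys)"
proof -
  have h: "hole n V ys" and Q: "spath Q" using assms by (auto simp: att_def)
  let ?zs = "butlast ys" and ?q = "length Q" and ?m = "length ys"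
  have m: "?m \<ge> 4" "distinct ys" "set ys \<subseteq> V" using h by (auto simp: hole_def)
  note QD = spath_D[OF Q]
  have "pathlike n (Q @ ?zs)" unfolding pathlike_def
  proof (intro allI impI)
    fix l i assume l: "l < length (Q @ ?zs)" and il: "i < l"
    consider "l < ?q" | "i < ?q" "?q \<le> l" | "?q \<le> i" by linarith
    then show "adj n ((Q @ ?zs) ! i) ((Q @ ?zs) ! l) \<longleftrightarrow> l = i + 1"
    proof cases
      case 1
      then show ?thesis using pathlike_adj[OF QD(5), of i l] il by (auto simp: nth_append)
    next
      case 2
      then have "adj n ((Q @ ?zs) ! i) ((Q @ ?zs) ! l) \<longleftrightarrow> adj n (Q ! i) (ys ! (l - ?q))"
        using l by (simp add: nth_append nth_butlast)
      then show ?thesis using att_adj[OF assms, of i "l - ?q"] 2 l by auto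
    next
      case 3
      then have "adj n ((Q @ ?zs) ! i) ((Q @ ?zs) ! l) \<longleftrightarrow> adj n (ys ! (i - ?q)) (ys ! (l - ?q))"
        using l il by (simp add: nth_append nth_butlast)
      then show ?thesis using hole_adj[OF h, of "i - ?q" "l - ?q"] 3 l il by auto
    qed
  qed
  moreover have "distinct (Q @ ?zs)"
    using QD m att_disjoint[OF assms] by (auto simp: distinct_butlast dest: in_set_butlastD)
  moreover have "set (tl (Q @ ?zs)) \<subseteq> V"
  proof -
    have "set (tl Q) \<subseteq> V" using Q by (simp add: spath_iff)
    then show ?thesis using QD(1) m(3) by (auto simp: dest: in_set_butlastD)
  qed
  ultimately show ?thesis using QD by (simp add: spath_iff)
qed

text \<open>The three positions are the end of \<open>Q\<close>, the head of the hole and the end of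
  the opened hole.\<close>

lemma att_nb_idx:
  assumes "att Q ys"
  shows "nb_idx n (Q @ butlast ys) (last ys) = {length Q - 1, length Q, length Q + length ys - 2}"
proof -
  have h: "hole n V ys" and Q: "spath Q" using assms by (auto simp: att_def)
  let ?zs = "butlast ys" and ?q = "length Q" and ?m = "length ys"
  have m: "?m \<ge> 4" "ys \<noteq> []" using h by (auto simp: hole_def)
  have q: "?q \<ge> 1" using spath_D(1)[OF Q] by (cases Q) auto
  have l: "last ys = ys ! (?m - 1)" using m by (simp add: last_conv_nth)
  have "adj n (last ys) ((Q @ ?zs) ! i) \<longleftrightarrow> i = ?q - 1 \<or> i = ?q \<or> i = ?q + ?m - 2"
    if i: "i < ?q + (?m - 1)" for i
  proof (cases "i < ?q")
    case True
    then have "adj n (last ys) ((Q @ ?zs) ! i) \<longleftrightarrow> adj n (Q ! i) (ys ! (?m - 1))"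
      by (simp add: nth_append l adj_sym)
    then show ?thesis using att_adj[OF assms True, of "?m - 1"] m True by auto
  next
    case False
    then have "adj n (last ys) ((Q @ ?zs) ! i) \<longleftrightarrow> adj n (ys ! (i - ?q)) (ys ! (?m - 1))"
      using i by (simp add: nth_append l adj_sym nth_butlast)
    then show ?thesis using hole_adj[OF h, of "i - ?q" "?m - 1"] m False i q by auto
  qed
  then show ?thesis unfolding nb_idx_def using q m by auto
qed

lemma att_last_notin:
  assumes "att Q ys"
  shows "last ys \<in> V" "last ys \<notin> set (Q @ butlast ys)"
proof -
  have m: "ys \<noteq> []" "distinct ys" "set ys \<subseteq> V" using assms by (auto simp: att_def hole_def)
  then show "last ys \<in> V" using last_in_set by blast
  have "last ys \<notin> set (butlast ys)"
    using m(1,2) by (metis append_butlast_last_id distinct_append disjoint_insert(1) list.simps(15))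
  moreover have "last ys \<notin> set Q" using att_disjoint[OF assms] m last_in_set by blast
  ultimately show "last ys \<notin> set (Q @ butlast ys)" by simp
qed

text \<open>The deleted vertex \<open>last ys\<close> has two nonadjacent neighbours on the opened
  hole, so it sees nothing new. The right-hand side no longer mentions where or in which direction
  the hole was opened.\<close>

lemma rest_att:
  assumes "att Q ys"
  shows "rest (set (Q @ butlast ys)) = rest (set Q \<union> set ys)"
proof -
  have h: "hole n V ys" and Q: "spath Q" using assms by (auto simp: att_def)
  have m: "ys \<noteq> []" "set ys \<subseteq> V" "distinct ys" using h by (auto simp: hole_def)
  obtain u v where uv: "u \<in> set ys" "v \<in> set ys" "u \<noteq> v" "\<not> adj n u v"
    "\<forall>y\<in>set ys. adj n (last ys) y \<longleftrightarrow> y = u \<or> y = v" using hole_nbrs[OF h, of "last ys"] m by auto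
  have ys: "set ys = insert (last ys) (set (butlast ys))" using set_eq_insert_last m by blast
  have "u \<in> set (butlast ys)" "v \<in> set (butlast ys)"
    using uv ys by (metis adj_irrefl insertE)+
  then have "rest (insert (last ys) (set (Q @ butlast ys))) = rest (set (Q @ butlast ys))"
    using uv spath_D(4)[OF Q] m ys by (intro rest_insert[of _ _ u v]) auto
  then show ?thesis using ys by (simp add: Un_commute insert_commute)
qed

text \<open>The smallest neighbour position of the common last vertex is
  \<open>length Q - 1\<close>, which tells where the path stops and the hole begins.\<close>

lemma att_inj:
  assumes "att Q ys" "att Q' ys'" "Q @ butlast ys = Q' @ butlast ys'" "last ys = last ys'"
  shows "Q = Q' \<and> ys = ys'"
proof -
  have ne: "ys \<noteq> []" "ys' \<noteq> []" "length ys \<ge> 4" "length ys' \<ge> 4" "Q \<noteq> []" "Q' \<noteq> []"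
    using assms by (auto simp: att_def hole_def spath_D)
  have "{length Q - 1, length Q, length Q + length ys - 2} = {length Q' - 1, length Q', length Q' + length ys' - 2}"
    using att_nb_idx[OF assms(1)] att_nb_idx[OF assms(2)] assms(3,4) by simp
  then have "Min {length Q - 1, length Q, length Q + length ys - 2} = Min {length Q' - 1, length Q', length Q' + length ys' - 2}"
    by simp
  then have "length Q - 1 = length Q' - 1" using ne by (simp add: min_def split: if_splits)
  then have "length Q = length Q'" using ne by (cases Q; cases Q') auto
  then have "Q = Q'" "butlast ys = butlast ys'" using assms(3) by auto
  then show ?thesis using assms(4) ne by (metis append_butlast_last_id)
qed

end

section \<open>Vertices anticommuting with a path\<close>

lemma sum_involution_zero:
  fixes g :: "'b \<Rightarrow> complex"
  assumes "\<And>x. x \<in> S \<Longrightarrow> \<phi> x \<in> S" "\<And>x. x \<in> S \<Longrightarrow> \<phi> (\<phi> x) = x" "\<And>x. x \<in> S \<Longrightarrow> g (\<phi> x) = - g x"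
  shows "sum g S = 0"
proof -
  have "bij_betw \<phi> S S" by (rule bij_betw_byWitness[where f' = \<phi>]) (use assms in auto)
  then have "sum g S = (\<Sum>x\<in>S. g (\<phi> x))" by (rule sum.reindex_bij_betw[symmetric])
  also have "\<dots> = - sum g S" using assms(3) by (simp add: sum_negf)
  finally show ?thesis by simp
qed

lemma pathlike_take: "pathlike n xs \<Longrightarrow> pathlike n (take k xs)"
  unfolding pathlike_def by simp

lemma hole_D:
  assumes "hole n W ys"
  shows "4 \<le> length ys" "distinct ys" "set ys \<subseteq> W" "ys \<noteq> []"
  using assms unfolding hole_def by auto

context simplicial_graph
begin

lemma spath_nth_0: "spath P \<Longrightarrow> P ! 0 = s"
  using spath_D(1,2) by (metis hd_conv_nth)

lemma spath_nth_in_V: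
  assumes "spath P" "0 < i" "i < length P"
  shows "P ! i \<in> V"
proof -
  note PD = spath_D[OF assms(1)]
  have "P ! i \<noteq> P ! 0" using nth_eq_iff_index_eq[OF PD(3), of i 0] assms PD(1) by auto
  moreover have "P ! i \<in> set P" using assms(3) by simp
  ultimately show ?thesis using PD(4) spath_nth_0[OF assms(1)] by auto
qed

lemma spath_take: "spath P \<Longrightarrow> 0 < k \<Longrightarrow> spath (take k P)"
  unfolding spath_def induced_path_list_iff
  using pathlike_take[of n P k] set_take_subset[of k P] by auto

lemma spath_extend:
  assumes "spath P" "j \<in> V" "j \<notin> set P" "nb_idx n P j = {length P - 1}"
  shows "spath (P @ [j])"
proof -
  note PD = spath_D[OF assms(1)]
  have adj: "adj n j (P ! i) \<longleftrightarrow> i = length P - 1" if "i < length P" for i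
  proof -
    have "adj n j (P ! i) \<longleftrightarrow> i \<in> nb_idx n P j" using that by (simp add: nb_idx_def)
    then show ?thesis unfolding assms(4) by simp
  qed
  have "\<not> adj n x j" if "x \<in> set (butlast P)" for x
  proof -
    obtain i where "i < length (butlast P)" "butlast P ! i = x" using \<open>x \<in> set (butlast P)\<close> by (auto simp: in_set_conv_nth)
    then have "i < length P - 1" "P ! i = x" by (auto simp: nth_butlast)
    then show ?thesis using adj[of i] by (auto simp: adj_sym)
  qed
  then have "j \<in> rest (set (butlast P))" using assms(2,3) by (auto simp: rest_def dest: in_set_butlastD)
  moreover have "adj n (last P) j" using adj[of "length P - 1"] PD(1) by (auto simp: last_conv_nth adj_sym)
  ultimately show ?thesis using spath_snoc[OF PD(1)] assms(1) by blast
qed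

lemma att_of_nb_idx:
  assumes P: "spath P" and j: "j \<in> V" "j \<notin> set P" and i: "i + 2 < length P - 1"
    and nb: "nb_idx n P j = {i, i + 1, length P - 1}"
  shows "att (take (i+1) P) (drop (i+1) P @ [j])"
proof -
  note PD = spath_D[OF P]
  let ?Q = "take (i+1) P" and ?ys = "drop (i+1) P @ [j]" and ?N = "length P"
  \<comment> \<open>The hole consists of the positions \<open>i + 1\<close> to \<open>?N - 1\<close>
    and of \<open>j\<close>; the gap required of \<open>i\<close> makes these at least four
    vertices.\<close>
  let ?m = "?N - i"
  have len: "length ?ys = ?m" "?m \<ge> 4" using i by auto
  have adjj: "adj n (P ! a) j \<longleftrightarrow> a = i \<or> a = i + 1 \<or> a = ?N - 1" if "a < ?N" for a
  proof -
    have "adj n (P ! a) j \<longleftrightarrow> a \<in> nb_idx n P j" using that by (simp add: nb_idx_def adj_sym)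
    then show ?thesis unfolding nb by simp
  qed
  have nth1: "?ys ! a = P ! (i + 1 + a)" if "a < ?m - 1" for a
    using that by (simp add: nth_append)
  have nth2: "?ys ! (?m - 1) = j" using i by (simp add: nth_append)
  have "hole n V ?ys" unfolding hole_def len(1)
  proof (intro conjI allI impI)
    show "4 \<le> ?m" by (rule len)
    show "distinct ?ys" using PD(3) j(2) by (auto dest: in_set_dropD)
    show "set ?ys \<subseteq> V"
    proof
      fix y assume "y \<in> set ?ys"
      then consider "y = j" | a where "a < ?N - (i + 1)" "y = P ! (i + 1 + a)"
        by (auto simp: in_set_conv_nth)
      then show "y \<in> V" using j spath_nth_in_V[OF P] by cases auto
    qed
    fix l a assume l: "l < ?m" and a: "a < l"
    show "adj n (?ys ! a) (?ys ! l) \<longleftrightarrow> l = a + 1 \<or> a = 0 \<and> l = ?m - 1"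
    proof (cases "l = ?m - 1")
      case True
      have "adj n (?ys ! a) (?ys ! l) \<longleftrightarrow> adj n (P ! (i + 1 + a)) j"
        using True a nth1[of a] nth2 by simp
      also have "\<dots> \<longleftrightarrow> a = 0 \<or> i + 1 + a = ?N - 1" using adjj[of "i + 1 + a"] a l by auto
      finally show ?thesis using True a i by auto
    next
      case False
      then have "adj n (?ys ! a) (?ys ! l) \<longleftrightarrow> adj n (P ! (i + 1 + a)) (P ! (i + 1 + l))"
        using nth1[of a] nth1[of l] a l by simp
      then show ?thesis using pathlike_adj[OF PD(5), of "i + 1 + a" "i + 1 + l"] a l False by auto
    qed
  qed
  moreover have Q: "spath ?Q" using spath_take[OF P] by simp
  moreover have bl: "butlast ?Q = take i P" using i by (simp add: butlast_take)
  moreover have "?ys ! a \<in> rest (set (take i P))" if a: "a < ?m" for a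
  proof -
    have in_V: "?ys ! a \<in> V" using \<open>hole n V ?ys\<close> a len nth_mem[of a ?ys] by (auto simp: hole_def)
    have "x \<noteq> ?ys ! a \<and> \<not> adj n x (?ys ! a)" if "x \<in> set (take i P)" for x
    proof -
      obtain c where "c < length (take i P)" "take i P ! c = x" using \<open>x \<in> set (take i P)\<close> by (metis in_set_conv_nth)
      then have c: "c < i" "x = P ! c" "c < ?N" by auto
      show ?thesis
      proof (cases "a = ?m - 1")
        case True
        then show ?thesis using nth2 c adjj[of c] i j by auto
      next
        case False
        then have y: "?ys ! a = P ! (i + 1 + a)" "i + 1 + a < ?N" using nth1[of a] a by auto
        have "P ! c \<noteq> P ! (i + 1 + a)" using nth_eq_iff_index_eq[OF PD(3), of c "i + 1 + a"] c y by simp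
        then show ?thesis unfolding y using c y pathlike_adj[OF PD(5), of c "i + 1 + a"] by simp
      qed
    qed
    then show ?thesis using in_V by (auto simp: rest_def)
  qed
  then have "set ?ys \<subseteq> rest (set (take i P))" using len(1) by (metis in_set_conv_nth subsetI)
  moreover have "adj n (last ?Q) y \<longleftrightarrow> y = hd ?ys \<or> y = last ?ys" if y: "y \<in> set ?ys" for y
  proof -
    have lQ: "last ?Q = P ! i" using i by (simp add: take_Suc_conv_app_nth)
    have hy: "hd ?ys = P ! (i + 1)" using nth1[of 0] len by (simp add: hd_conv_nth)
    obtain a where a: "a < ?m" "y = ?ys ! a" using y len(1) by (metis in_set_conv_nth)
    show ?thesis
    proof (cases "a = ?m - 1")
      case True
      then have "y = j" using a nth2 by simp
      then show ?thesis using lQ adjj[of i] i by simp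
    next
      case False
      then have ya: "y = P ! (i + 1 + a)" "i + 1 + a < ?N" using nth1[of a] a by auto
      have "y = P ! (i + 1) \<longleftrightarrow> a = 0" using nth_eq_iff_index_eq[OF PD(3), of "i + 1 + a" "i + 1"] ya i by simp
      moreover have "y \<noteq> j" using ya j(2) by auto
      moreover have "adj n (P ! i) y \<longleftrightarrow> a = 0" using pathlike_adj[OF PD(5), of i "i + 1 + a"] ya by auto
      ultimately show ?thesis using lQ hy by simp
    qed
  qed
  ultimately show ?thesis unfolding att_def by simp
qed

lemma odd_neighbour_cases:
  assumes P: "spath P" and j: "j \<in> V" and odd: "odd (deg n j P)"
  obtains (ext) "spath (P @ [j])"
    | (con) "2 \<le> length P" "j = last P"
    | (tri) i where "j \<notin> set P" "i + 2 < length P" "nb_idx n P j = {i, i+1, i+2}"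
    | (lol) Q ys where "att Q ys" "P = Q @ butlast ys" "j = last ys"
proof (cases "j \<in> set P")
  case True
  note PD = spath_D[OF P]
  obtain k where k: "k < length P" "P ! k = j" using True by (auto simp: in_set_conv_nth)
  have k0: "k \<noteq> 0" using k(2) spath_nth_0[OF P] j s_notin by metis
  have nb: "nb_idx n P j = {i. i < length P \<and> (i = k + 1 \<or> k = i + 1)}"
    unfolding nb_idx_def using pathlike_adj[OF PD(5) k(1)] k(2) by auto
  \<comment> \<open>An interior vertex of the path has two neighbours on it, an even number, and the
    start of the path is \<open>s\<close>, which is not in \<open>V\<close>.\<close>
  have "k = length P - 1"
  proof (rule ccontr)
    assume "k \<noteq> length P - 1"
    then have "nb_idx n P j = {k - 1, k + 1}" unfolding nb using k k0 by auto
    then have "deg n j P = 2" unfolding deg_nb_idx using k0 by simp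
    then show False using odd by simp
  qed
  then have "2 \<le> length P" "j = last P" using k k0 PD(1) by (auto simp: last_conv_nth)
  then show ?thesis by (rule con)
next
  case False
  note PD = spath_D[OF P]
  let ?N = "nb_idx n P j" and ?l = "length P - 1"
  have jU: "j \<in> insert s V" using j by simp
  have nbD: "i < length P" "adj n j (P ! i)" "P ! i \<in> insert s V" "P ! i \<noteq> j" if "i \<in> ?N" for i
  proof -
    show i: "i < length P" "adj n j (P ! i)" using that by (auto simp: nb_idx_def)
    have "P ! i \<in> set P" using i by simp
    then show "P ! i \<in> insert s V" "P ! i \<noteq> j" using PD(4) False by blast+
  qed
  have "?N = {?l} \<or> (\<exists>i. i + 2 \<le> ?l \<and> ?N = {i, i+1, i+2}) \<or> (\<exists>i. i + 2 < ?l \<and> ?N = {i, i+1, ?l})"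
  proof (rule odd_index_set_cases)
    show "?N \<subseteq> {..?l}" by (auto simp: nb_idx_def)
    show "odd (card ?N)" using odd by (simp add: deg_nb_idx)
  next
    \<comment> \<open>Three separated neighbours would be the leaves of a claw at
      \<open>j\<close>.\<close>
    fix x y z assume xyz: "x \<in> ?N" "y \<in> ?N" "z \<in> ?N" "x + 1 < y" "y + 1 < z"
    have "\<not> adj n (P ! x) (P ! y)" "\<not> adj n (P ! x) (P ! z)" "\<not> adj n (P ! y) (P ! z)"
      using pathlike_adj[OF PD(5)] nbD(1) xyz by auto
    moreover have "P ! x \<noteq> P ! y" "P ! x \<noteq> P ! z" "P ! y \<noteq> P ! z"
      using nth_eq_iff_index_eq[OF PD(3)] nbD(1) xyz by auto
    ultimately show False
      using claw[OF jU nbD(3)[OF xyz(1)] nbD(3)[OF xyz(2)] nbD(3)[OF xyz(3)]] nbD(2) xyz by blast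
  next
    fix x assume x: "x \<in> ?N" "x < ?l"
    show "x + 1 \<in> ?N \<or> (\<exists>y\<in>?N. y + 1 = x)"
    proof (cases "x = 0")
      case True
      \<comment> \<open>The start of the path has no predecessor for a claw; here \<open>j\<close>
        and \<open>P ! 1\<close> are both neighbours of \<open>s\<close>, hence adjacent.\<close>
      have P1: "P ! 1 \<in> V" using spath_nth_in_V[OF P, of 1] x by simp
      have "adj n (P ! 0) (P ! 1)" using pathlike_adj[OF PD(5), of 0 1] x(2) PD(1) by auto
      moreover have "adj n s j" using nbD(2)[OF x(1)] True spath_nth_0[OF P] by (simp add: adj_sym)
      moreover have "P ! 1 \<noteq> j" using False x nth_mem[of 1 P] by auto
      ultimately have "adj n j (P ! 1)" using s_clique[OF j P1] spath_nth_0[OF P] by auto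
      then show ?thesis using True x by (auto simp: nb_idx_def)
    next
      case x0: False
      \<comment> \<open>Unless \<open>j\<close> is adjacent to one of these two, they form a claw
        with \<open>j\<close> at \<open>P ! x\<close>.\<close>
      let ?p = "P ! (x - 1)" and ?q = "P ! (x + 1)"
      have lt: "x - 1 < length P" "x < length P" "x + 1 < length P" using x by auto
      have U: "?p \<in> insert s V" "?q \<in> insert s V" "P ! x \<in> insert s V" using PD(4) lt nth_mem by blast+
      have a: "adj n (P ! x) ?p" "adj n (P ! x) ?q" "\<not> adj n ?p ?q"
        using pathlike_adj[OF PD(5)] lt x0 by auto
      have ne: "?p \<noteq> ?q" "?p \<noteq> j" "?q \<noteq> j"
        using nth_eq_iff_index_eq[OF PD(3), of "x - 1" "x + 1"] lt False nth_mem by auto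
      have "adj n (P ! x) j" using nbD(2)[OF x(1)] by (simp add: adj_sym)
      then have "adj n ?p j \<or> adj n ?q j" using claw[OF U(3,1,2) jU a(1,2)] a(3) ne by blast
      then have "x - 1 \<in> ?N \<or> x + 1 \<in> ?N" using lt by (auto simp: nb_idx_def adj_sym)
      moreover have "(x - 1) + 1 = x" using x0 by simp
      ultimately show ?thesis by blast
    qed
  qed
  then consider "?N = {?l}" | i where "i + 2 \<le> ?l" "?N = {i, i+1, i+2}" | i where "i + 2 < ?l" "?N = {i, i+1, ?l}"
    by blast
  then show ?thesis
  proof cases
    case 1 then show ?thesis using spath_extend[OF P j False] ext by blast
  next
    case 2 then show ?thesis using tri[OF False, of i] PD(1) by (cases P) auto
  next
    case 3
    show ?thesis using att_of_nb_idx[OF P j False 3] by (rule lol) auto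
  qed
qed

section \<open>Sorting the anticommuting pairs into four kinds\<close>

definition odd_pairs :: "((nat \<Rightarrow> nat) list \<times> (nat \<Rightarrow> nat)) set" where
  "odd_pairs = {(P, j). spath P \<and> j \<in> V \<and> odd (deg n j P)}"

text \<open>Parametrised by the longer path, so that a sum over these pairs becomes a sum over the
  path that is produced.\<close>

definition ext_pairs :: "((nat \<Rightarrow> nat) list \<times> (nat \<Rightarrow> nat)) set" where
  "ext_pairs = (\<lambda>xs. (butlast xs, last xs)) ` {xs. spath xs \<and> 2 \<le> length xs}"

definition con_pairs :: "((nat \<Rightarrow> nat) list \<times> (nat \<Rightarrow> nat)) set" where
  "con_pairs = (\<lambda>P. (P, last P)) ` {P. spath P \<and> 2 \<le> length P}"

definition tri_pairs :: "((nat \<Rightarrow> nat) list \<times> (nat \<Rightarrow> nat)) set" where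
  "tri_pairs = {(P, j). spath P \<and> j \<in> V \<and> j \<notin> set P \<and>
     (\<exists>i. i + 2 < length P \<and> nb_idx n P j = {i, i+1, i+2})}"

definition lol_pairs :: "((nat \<Rightarrow> nat) list \<times> (nat \<Rightarrow> nat)) set" where
  "lol_pairs = (\<lambda>(Q, ys). (Q @ butlast ys, last ys)) ` {(Q, ys). att Q ys}"

lemma att_D:
  assumes "att Q ys"
  shows "spath Q" "hole n V ys" "4 \<le> length ys" "distinct ys" "set ys \<subseteq> V" "ys \<noteq> []" "Q \<noteq> []"
  using assms hole_D[of n V ys] spath_D(1)[of Q] unfolding att_def by blast+

lemma finite_att: "finite {(Q, ys). att Q ys}"
proof -
  have "{(Q, ys). att Q ys} \<subseteq> {xs. spath xs} \<times> {xs. set xs \<subseteq> V \<and> distinct xs}"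
    using att_D by blast
  moreover have "finite {xs. set xs \<subseteq> V \<and> distinct xs}" using finite_subset_distinct finV by blast
  ultimately show ?thesis using finite_spath by (meson finite_SigmaI finite_subset)
qed

lemma finite_att_even: "finite {ys. att Q ys \<and> even (length ys)}"
proof -
  have "{ys. att Q ys \<and> even (length ys)} \<subseteq> {xs. set xs \<subseteq> V \<and> distinct xs}"
    using att_D by blast
  then show ?thesis using finite_subset_distinct[OF finV] by (rule finite_subset)
qed

lemma ext_pairsD:
  assumes "(P, j) \<in> ext_pairs"
  shows "spath P" "j \<in> V" "j \<notin> set P" "nb_idx n P j = {length P - 1}"
proof -
  obtain xs where xs: "spath xs" "2 \<le> length xs" "P = butlast xs" "j = last xs"
    using assms by (auto simp: ext_pairs_def)
  then have e: "P \<noteq> []" "P @ [j] = xs" by (cases xs; auto)+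
  note XD = spath_D[OF xs(1)]
  show "spath P" using spath_butlast xs by blast
  show "j \<in> V" using spath_nth_in_V[OF xs(1), of "length xs - 1"] xs XD(1) by (simp add: last_conv_nth)
  show "j \<notin> set P" using XD(3) e by auto
  have len: "length P = length xs - 1" using xs by simp
  have "adj n j (P ! i) \<longleftrightarrow> i = length P - 1" if "i < length P" for i
    using pathlike_adj[OF XD(5), of "length xs - 1" i] that xs XD(1) len
    by (auto simp: nth_butlast last_conv_nth)
  then show "nb_idx n P j = {length P - 1}" using e(1) by (auto simp: nb_idx_def)
qed

lemma con_pairsD:
  assumes "(P, j) \<in> con_pairs"
  shows "spath P" "j \<in> V" "j \<in> set P" "odd (deg n j P)"
proof -
  have P: "spath P" "2 \<le> length P" "j = last P" using assms by (auto simp: con_pairs_def)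
  note PD = spath_D[OF P(1)]
  show "spath P" by fact
  show "j \<in> V" using spath_nth_in_V[OF P(1), of "length P - 1"] P PD(1) by (simp add: last_conv_nth)
  show "j \<in> set P" using P PD(1) by simp
  have j: "j = P ! (length P - 1)" using P(3) PD(1) by (simp add: last_conv_nth)
  have "adj n j (P ! i) \<longleftrightarrow> i = length P - 2" if "i < length P" for i
    unfolding j using pathlike_adj[OF PD(5), of "length P - 1" i] that P(2) by auto
  then have "nb_idx n P j = {length P - 2}" using P(2) by (auto simp: nb_idx_def)
  then show "odd (deg n j P)" by (simp add: deg_nb_idx)
qed

lemma lol_pairsD:
  assumes "(P, j) \<in> lol_pairs"
  shows "spath P" "j \<in> V" "j \<notin> set P" "\<exists>i. i + 2 < length P - 1 \<and> nb_idx n P j = {i, i+1, length P - 1}"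
proof -
  obtain Q ys where a: "att Q ys" "P = Q @ butlast ys" "j = last ys" using assms by (auto simp: lol_pairs_def)
  show "spath P" "j \<in> V" "j \<notin> set P" using att_spath[OF a(1)] att_last_notin[OF a(1)] a by auto
  have "length ys \<ge> 4" "Q \<noteq> []" using a(1) spath_D(1)[of Q] by (auto simp: att_def hole_def)
  then obtain q where "length ys \<ge> 4" "length Q = Suc q" by (cases Q) auto
  then have "(length Q - 1) + 2 < length P - 1 \<and> nb_idx n P j = {length Q - 1, (length Q - 1) + 1, length P - 1}"
    using att_nb_idx[OF a(1)] a by (simp add: numeral_2_eq_2)
  then show "\<exists>i. i + 2 < length P - 1 \<and> nb_idx n P j = {i, i+1, length P - 1}" by blast
qed

lemma odd_pairs_eq: "odd_pairs = ext_pairs \<union> con_pairs \<union> tri_pairs \<union> lol_pairs"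
proof (intro equalityI subsetI)
  fix x assume "x \<in> odd_pairs"
  then obtain P j where x: "x = (P, j)" "spath P" "j \<in> V" "odd (deg n j P)" by (auto simp: odd_pairs_def)
  from x(2-4) show "x \<in> ext_pairs \<union> con_pairs \<union> tri_pairs \<union> lol_pairs"
  proof (cases rule: odd_neighbour_cases)
    case ext
    then have "x \<in> ext_pairs" unfolding ext_pairs_def x(1)
      by (intro image_eqI[of _ _ "P @ [j]"]) (use spath_D(1)[OF x(2)] in \<open>auto simp: Suc_le_eq\<close>)
    then show ?thesis by blast
  next
    case con then show ?thesis using x by (auto simp: con_pairs_def)
  next
    case (tri i)
    then have "x \<in> tri_pairs" unfolding tri_pairs_def x(1) using x(2,3) by blast
    then show ?thesis by blast
  next
    case (lol Q ys)
    then have "x \<in> lol_pairs" unfolding lol_pairs_def x(1) by (intro image_eqI[of _ _ "(Q, ys)"]) auto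
    then show ?thesis by blast
  qed
next
  fix x assume x: "x \<in> ext_pairs \<union> con_pairs \<union> tri_pairs \<union> lol_pairs"
  obtain P j where Pj: "x = (P, j)" by force
  have tri: "odd (card {i, i + 1, i + 2})" for i :: nat by simp
  have lol: "odd (card {i, i + 1, l})" if "i + 2 < l" for i l :: nat using that by simp
  from x consider "x \<in> ext_pairs" | "x \<in> con_pairs" | "x \<in> tri_pairs" | "x \<in> lol_pairs" by blast
  then show "x \<in> odd_pairs"
  proof cases
    case 1
    then show ?thesis using ext_pairsD[of P j] unfolding Pj odd_pairs_def by (simp add: deg_nb_idx)
  next
    case 2
    then show ?thesis using con_pairsD[of P j] unfolding Pj odd_pairs_def by simp
  next
    case 3
    then obtain i where "spath P" "j \<in> V" "nb_idx n P j = {i, i+1, i+2}" unfolding Pj tri_pairs_def by blast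
    then show ?thesis using tri[of i] unfolding Pj odd_pairs_def deg_nb_idx by simp
  next
    case 4
    then obtain i where "i + 2 < length P - 1" "nb_idx n P j = {i, i+1, length P - 1}"
      using lol_pairsD(4)[of P j] unfolding Pj by blast
    then have "odd (deg n j P)" using lol[of i "length P - 1"] unfolding deg_nb_idx by simp
    then show ?thesis using 4 lol_pairsD(1,2)[of P j] unfolding Pj odd_pairs_def by simp
  qed
qed

text \<open>Contractions are the only kind whose vertex lies on the path. The others differ in the
  neighbour positions: one, three consecutive ones, or two consecutive ones and the end behind a
  gap.\<close>

lemma pairs_disjoint:
  "ext_pairs \<inter> con_pairs = {}" "(ext_pairs \<union> con_pairs) \<inter> tri_pairs = {}"
  "(ext_pairs \<union> con_pairs \<union> tri_pairs) \<inter> lol_pairs = {}"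
proof -
  have 1: "\<not> ((P, j) \<in> ext_pairs \<and> (P, j) \<in> con_pairs)" for P j
    using ext_pairsD con_pairsD by blast
  have 2: "\<not> ((P, j) \<in> ext_pairs \<and> (P, j) \<in> tri_pairs)" for P j
  proof
    assume a: "(P, j) \<in> ext_pairs \<and> (P, j) \<in> tri_pairs"
    then obtain i where "nb_idx n P j = {i, i+1, i+2}" unfolding tri_pairs_def by blast
    moreover have "nb_idx n P j = {length P - 1}" using a ext_pairsD(4) by blast
    ultimately have "i \<in> {length P - 1}" "i + 1 \<in> {length P - 1}" by blast+
    then show False by simp
  qed
  have 3: "\<not> ((P, j) \<in> con_pairs \<and> (P, j) \<in> tri_pairs)" for P j
    using con_pairsD(3)[of P j] by (auto simp: tri_pairs_def)
  have 4: "\<not> ((P, j) \<in> ext_pairs \<and> (P, j) \<in> lol_pairs)" for P j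
  proof
    assume a: "(P, j) \<in> ext_pairs \<and> (P, j) \<in> lol_pairs"
    then obtain i where "i + 2 < length P - 1" "nb_idx n P j = {i, i+1, length P - 1}" using lol_pairsD by blast
    moreover have "nb_idx n P j = {length P - 1}" using a ext_pairsD(4) by blast
    ultimately have "i \<in> {length P - 1}" "i + 1 \<in> {length P - 1}" by blast+
    then show False by simp
  qed
  have 5: "\<not> ((P, j) \<in> con_pairs \<and> (P, j) \<in> lol_pairs)" for P j
    using con_pairsD(3) lol_pairsD(3) by blast
  have 6: "\<not> ((P, j) \<in> tri_pairs \<and> (P, j) \<in> lol_pairs)" for P j
  proof
    assume a: "(P, j) \<in> tri_pairs \<and> (P, j) \<in> lol_pairs"
    then obtain i where i: "i + 2 < length P - 1" "nb_idx n P j = {i, i+1, length P - 1}" using lol_pairsD by blast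
    obtain k where k: "nb_idx n P j = {k, k+1, k+2}" using a unfolding tri_pairs_def by blast
    have "i \<in> {k, k+1, k+2}" "length P - 1 \<in> {k, k+1, k+2}" using i(2) k by blast+
    then show False using i(1) by auto
  qed
  show "ext_pairs \<inter> con_pairs = {}" "(ext_pairs \<union> con_pairs) \<inter> tri_pairs = {}"
    "(ext_pairs \<union> con_pairs \<union> tri_pairs) \<inter> lol_pairs = {}"
    using 1 2 3 4 5 6 by (auto simp: disjoint_iff)
qed

lemma finite_odd_pairs: "finite odd_pairs"
  by (rule finite_subset[of _ "{xs. spath xs} \<times> V"])
     (auto simp: odd_pairs_def finite_spath finV)

lemma sum_odd_pairs:
  fixes g :: "_ \<Rightarrow> complex"
  shows "sum g odd_pairs = (\<Sum>xs | spath xs \<and> 2 \<le> length xs. g (butlast xs, last xs))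
     + (\<Sum>P | spath P \<and> 2 \<le> length P. g (P, last P)) + sum g tri_pairs
     + (\<Sum>(Q, ys) | att Q ys. g (Q @ butlast ys, last ys))"
proof -
  have fin: "finite ext_pairs" "finite con_pairs" "finite tri_pairs" "finite lol_pairs"
    using finite_odd_pairs unfolding odd_pairs_eq by auto
  have "sum g odd_pairs = sum g ext_pairs + sum g con_pairs + sum g tri_pairs + sum g lol_pairs"
    unfolding odd_pairs_eq using fin pairs_disjoint
    by (simp add: sum.union_disjoint)
  moreover have "sum g ext_pairs = (\<Sum>xs | spath xs \<and> 2 \<le> length xs. g (butlast xs, last xs))"
    unfolding ext_pairs_def
  proof (subst sum.reindex)
    have "xs = ys" if "2 \<le> length xs" "2 \<le> length ys" "butlast xs = butlast ys" "last xs = last ys" for xs ys :: "(nat \<Rightarrow> nat) list"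
    proof -
      have "xs \<noteq> []" "ys \<noteq> []" using that by auto
      then show ?thesis using that(3,4) by (metis append_butlast_last_id)
    qed
    then show "inj_on (\<lambda>xs. (butlast xs, last xs)) {xs. spath xs \<and> 2 \<le> length xs}"
      by (auto intro!: inj_onI)
  qed (simp add: o_def)
  moreover have "sum g con_pairs = (\<Sum>P | spath P \<and> 2 \<le> length P. g (P, last P))"
    unfolding con_pairs_def by (subst sum.reindex) (auto simp: inj_on_def)
  moreover have "sum g lol_pairs = (\<Sum>(Q, ys) | att Q ys. g (Q @ butlast ys, last ys))"
  proof -
    have "inj_on (\<lambda>(Q, ys). (Q @ butlast ys, last ys)) {(Q, ys). att Q ys}"
      by (rule inj_onI) (use att_inj in auto)
    then show ?thesis unfolding lol_pairs_def by (subst sum.reindex) (simp_all add: o_def case_prod_unfold)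
  qed
  ultimately show ?thesis by simp
qed

end

section \<open>Deformation classes of attached even holes\<close>

lemma deform_closure_trans:
  "D \<in> deform_closure n V C \<Longrightarrow> C \<in> deform_closure n V C0 \<Longrightarrow> D \<in> deform_closure n V C0"
  by (induction rule: deform_closure.induct) (auto intro: deform_closure.step)

text \<open>The new vertex sees exactly the replaced one and its two neighbours, so away from
  position \<open>i\<close> it behaves like \<open>ys ! i\<close>, and the list survives with one
  entry changed.\<close>

lemma deformation_of_hole_list:
  assumes ys: "even_hole_list n V ys" and d: "deformation n V (set ys) C'"
  obtains i j where "i < length ys" "j \<in> V" "j \<notin> set ys"
    "\<forall>y\<in>set ys. adj n j y \<longleftrightarrow> y = ys ! i \<or> adj n (ys ! i) y"
    "C' = insert j (set ys - {ys ! i})" "even_hole_list n V (ys[i := j])" "set (ys[i := j]) = C'"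
proof -
  obtain j k where jk: "j \<in> V" "k \<in> set ys" "j \<notin> set ys"
    "nbhd n (set ys) j = insert k (nbhd n (set ys) k)" "C' = insert j (set ys - {k})"
    using d unfolding deformation_def by blast
  obtain i where i: "i < length ys" "ys ! i = k" using jk(2) by (auto simp: in_set_conv_nth)
  have a: "\<forall>y\<in>set ys. adj n j y \<longleftrightarrow> y = k \<or> adj n k y"
    using jk(2,4) unfolding nbhd_def by blast
  have h: "hole n V ys" "even (length ys)" using ys by (auto simp: even_hole_list_iff)
  have "hole n V (ys[i := j])" using hole_update[OF h(1) i(1) jk(1,3)] a i(2) by blast
  then have "even_hole_list n V (ys[i := j])" using h(2) by (simp add: even_hole_list_iff)
  moreover have "set (ys[i := j]) = C'" using set_update_distinct[OF hole_D(2)[OF h(1)] i(1)] jk(5) i(2) by simp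
  ultimately show ?thesis using that[of i j] i jk a by simp
qed

lemma even_holes_deformation:
  assumes "C \<in> even_holes n V" "deformation n V C C'"
  shows "C' \<in> even_holes n V" "card C' = card C"
proof -
  obtain ys where ys: "even_hole_list n V ys" "C = set ys" using assms(1) by (auto simp: even_holes_def)
  have d: "deformation n V (set ys) C'" using assms(2) ys(2) by simp
  obtain i j where ij: "even_hole_list n V (ys[i := j])" "set (ys[i := j]) = C'"
    using deformation_of_hole_list[OF ys(1) d] by blast
  then show "C' \<in> even_holes n V" by (auto simp: even_holes_def)
  have "distinct ys" "distinct (ys[i := j])" using ys(1) ij(1) by (simp_all add: even_hole_list_def)
  then show "card C' = card C" using distinct_card[of ys] distinct_card[of "ys[i := j]"] ij(2) ys(2) by simp
qed

lemma even_holes_subset: "C \<in> even_holes n V \<Longrightarrow> C \<subseteq> V"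
  by (auto simp: even_holes_def even_hole_list_def)

text \<open>The two exchanged vertices play symmetric roles: \<open>j\<close> becomes the vertex of
  the new hole that \<open>k\<close> replaces. The closures of even holes are thereby equivalence
  classes.\<close>

lemma deformation_sym:
  assumes "C \<subseteq> V" "deformation n V C C'"
  shows "deformation n V C' C"
proof -
  obtain j k where jk: "j \<in> V" "k \<in> C" "j \<notin> C"
    "nbhd n C j = insert k (nbhd n C k)" "C' = insert j (C - {k})"
    using assms(2) unfolding deformation_def by blast
  have a: "adj n j y \<longleftrightarrow> y = k \<or> adj n k y" if "y \<in> C" for y
    using jk(2,4) that unfolding nbhd_def by blast
  have "k \<in> V" "j \<in> C'" "k \<notin> C'" using jk assms(1) by auto
  moreover have "nbhd n C' k = insert j (nbhd n C' j)"
  proof -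
    have jk': "adj n k j" using a[OF jk(2)] adj_sym[of n k j] by blast
    have "adj n k y \<longleftrightarrow> y = j \<or> adj n j y" if "y \<in> C'" for y
      using that a[of y] jk' adj_irrefl[of n j] unfolding jk(5) by blast
    then show ?thesis unfolding nbhd_def using \<open>j \<in> C'\<close> by blast
  qed
  moreover have "C = insert k (C' - {j})" using jk by auto
  ultimately show ?thesis unfolding deformation_def by blast
qed

lemma deform_closure_even_hole:
  assumes "C0 \<in> even_holes n V" "C \<in> deform_closure n V C0"
  shows "C \<in> even_holes n V \<and> card C = card C0 \<and> C0 \<in> deform_closure n V C"
  using assms(2)
proof (induction rule: deform_closure.induct)
  case base then show ?case using assms(1) deform_closure.base by blast
next
  case (step C C')
  have "C \<in> deform_closure n V C'"
    using deform_closure.step[OF deform_closure.base deformation_sym[OF even_holes_subset step(2)]] step(3) by blast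
  then have "C0 \<in> deform_closure n V C'" using step(3) deform_closure_trans[of C0 n V C C'] by blast
  then show ?case using step(3) even_holes_deformation[OF _ step(2)] by simp
qed

lemma deform_closure_eq:
  assumes "C0 \<in> even_holes n V" "C \<in> deform_closure n V C0"
  shows "deform_closure n V C = deform_closure n V C0"
proof
  show "deform_closure n V C \<subseteq> deform_closure n V C0"
    using deform_closure_trans[of _ n V C C0] assms(2) by blast
  show "deform_closure n V C0 \<subseteq> deform_closure n V C"
    using deform_closure_trans[of _ n V C0 C] deform_closure_even_hole[OF assms] by blast
qed

section \<open>Even holes attached to the end of a path\<close>

context simplicial_graph
begin

definition att_holes :: "(nat \<Rightarrow> nat) list \<Rightarrow> (nat \<Rightarrow> nat) set set" where
  "att_holes Q = {C \<in> even_holes n V. C \<subseteq> rest (set (butlast Q)) \<and> (\<exists>y\<in>C. adj n (last Q) y)}"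

lemma finite_att_holes: "finite (att_holes Q)"
proof -
  have "att_holes Q \<subseteq> Pow V" using even_holes_subset by (auto simp: att_holes_def)
  then show ?thesis using finV by (meson finite_Pow_iff finite_subset)
qed

lemma spath_last_in: "spath Q \<Longrightarrow> last Q \<in> insert s V"
  using spath_D(1,4)[of Q] last_in_set[of Q] by blast

text \<open>A claw at \<open>y\<close>, with leaves \<open>last Q\<close> and the two hole
  neighbours of \<open>y\<close>, forces a second contact. All contacts are mutually adjacent by
  \<open>last_clique\<close>, so a third one would create a triangle in the hole.\<close>

lemma attached_edge:
  assumes Q: "spath Q" and h: "hole n V ys" and sub: "set ys \<subseteq> rest (set (butlast Q))"
    and y: "y \<in> set ys" "adj n (last Q) y"
  obtains a c where "a \<in> set ys" "c \<in> set ys" "adj n a c" "\<forall>z\<in>set ys. adj n (last Q) z \<longleftrightarrow> z = a \<or> z = c"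
proof -
  obtain u v where uv: "u \<in> set ys" "v \<in> set ys" "u \<noteq> v" "\<not> adj n u v"
    "\<forall>z\<in>set ys. adj n y z \<longleftrightarrow> z = u \<or> z = v" using hole_nbrs[OF h y(1)] by blast
  have V: "set ys \<subseteq> V" using hole_D[OF h] by blast
  have lU: "last Q \<in> insert s V" by (rule spath_last_in[OF Q])
  have nl: "last Q \<noteq> u" "last Q \<noteq> v" using last_notin_rest[OF Q] sub uv by auto
  have au: "adj n y u" "adj n y v" using uv by blast+
  have al: "adj n y (last Q)" using y(2) adj_sym[of n y "last Q"] by blast
  have U: "y \<in> insert s V" "u \<in> insert s V" "v \<in> insert s V" using V y uv by blast+
  have "adj n u (last Q) \<or> adj n v (last Q)"
    using claw[OF U lU au al uv(3)] nl uv(4) by blast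
  then have "adj n (last Q) u \<or> adj n (last Q) v" using adj_sym[of n u "last Q"] adj_sym[of n v "last Q"] by blast
  then obtain c where c: "c \<in> set ys" "adj n (last Q) c" "adj n y c" using uv au by blast
  have "z = y \<or> z = c" if z: "z \<in> set ys" "adj n (last Q) z" for z
  proof (rule ccontr)
    assume "\<not> (z = y \<or> z = c)"
    then have "adj n z y" "adj n z c" using last_clique[OF Q] z y c sub by blast+
    then show False using hole_no_triangle[OF h z(1) y(1) c(1)] c(3) by blast
  qed
  then show ?thesis using that[OF y(1) c(1) c(3)] y c by blast
qed

lemma att_set_in_att_holes:
  assumes "att Q ys" "even (length ys)"
  shows "set ys \<in> att_holes Q"
proof -
  have "even_hole_list n V ys" using att_D(2)[OF assms(1)] assms(2) by (simp add: even_hole_list_iff)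
  then have "set ys \<in> even_holes n V" by (auto simp: even_holes_def)
  moreover have "hd ys \<in> set ys" using att_D(6)[OF assms(1)] by simp
  moreover have "adj n (last Q) (hd ys)" "set ys \<subseteq> rest (set (butlast Q))"
    using assms(1) \<open>hd ys \<in> set ys\<close> unfolding att_def by blast+
  ultimately show ?thesis unfolding att_holes_def by blast
qed

text \<open>The closing edge of the list has to be the edge seen by \<open>last Q\<close>, which
  leaves only the two directions around the hole. This is the origin of the factor 2 in
  \<open>zeta\<close>.\<close>

lemma att_lists:
  assumes Q: "spath Q" and C: "C \<in> att_holes Q"
  obtains ys where "att Q ys" "set ys = C" "even (length ys)" "ys \<noteq> rev ys"
    "{zs. att Q zs \<and> even (length zs) \<and> set zs = C} = {ys, rev ys}"
proof -
  obtain zs where zs: "even_hole_list n V zs" "set zs = C" using C unfolding att_holes_def even_holes_def by blast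
  have h: "hole n V zs" "even (length zs)" using zs(1) by (auto simp: even_hole_list_iff)
  have sub: "C \<subseteq> rest (set (butlast Q))" using C unfolding att_holes_def by blast
  obtain y where y: "y \<in> C" "adj n (last Q) y" using C unfolding att_holes_def by blast
  obtain a c where ac: "a \<in> C" "c \<in> C" "adj n a c" "\<forall>z\<in>C. adj n (last Q) z \<longleftrightarrow> z = a \<or> z = c"
    using attached_edge[OF Q h(1), unfolded zs(2), OF sub y] by blast
  obtain k where k: "hd (rotate k zs) = a \<and> last (rotate k zs) = c \<or> hd (rotate k zs) = c \<and> last (rotate k zs) = a"
    using hole_list_with_ends[OF h(1), unfolded zs(2), OF ac(1-3)] by blast
  define r where "r = rotate k zs"
  have r: "hole n V r" "set r = C" "even (length r)" using h zs(2) by (simp_all add: r_def hole_rotate)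
  have ends: "\<forall>z\<in>C. adj n (last Q) z \<longleftrightarrow> z = hd r \<or> z = last r" using k ac(4) unfolding r_def by blast
  have att: "att Q r" unfolding att_def using Q r sub ends by simp
  have ne: "hd r \<noteq> last r" using k ac(3) unfolding r_def by auto
  have rne: "r \<noteq> []" using hole_D[OF r(1)] by blast
  have "r \<noteq> rev r" using ne rne by (metis hd_rev)
  moreover have "{zs. att Q zs \<and> even (length zs) \<and> set zs = C} = {r, rev r}"
  proof (intro equalityI subsetI)
    fix ws assume "ws \<in> {zs. att Q zs \<and> even (length zs) \<and> set zs = C}"
    then have w: "att Q ws" "set ws = C" by auto
    have hw: "hole n V ws" and wne: "ws \<noteq> []" using att_D[OF w(1)] by auto
    have in_ws: "hd ws \<in> set ws" "last ws \<in> set ws" using wne by auto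
    then have "adj n (hd ws) (last ws)" using hole_hd_nbrs[OF hw] by blast
    then have wne2: "hd ws \<noteq> last ws" by auto
    have "adj n (last Q) (hd ws)" "adj n (last Q) (last ws)" using w(1) in_ws unfolding att_def by blast+
    then have "hd ws = hd r \<and> last ws = last r \<or> hd ws = last r \<and> last ws = hd r"
      using ends[rule_format, of "hd ws"] ends[rule_format, of "last ws"] in_ws w(2) wne2 by metis
    then show "ws \<in> {r, rev r}"
    proof
      assume "hd ws = hd r \<and> last ws = last r"
      then have "ws = r" using hole_unique[OF hw r(1)] w(2) r(2) by blast
      then show ?thesis by simp
    next
      assume "hd ws = last r \<and> last ws = hd r"
      then have "ws = rev r" using hole_unique[OF hw hole_rev[OF r(1)]] w(2) r(2) rne by (simp add: hd_rev last_rev)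
      then show ?thesis by simp
    qed
  next
    fix ws assume "ws \<in> {r, rev r}"
    then show "ws \<in> {zs. att Q zs \<and> even (length zs) \<and> set zs = C}" using att att_rev[OF att] r by auto
  qed
  ultimately show ?thesis using that[OF att r(2,3)] by blast
qed

lemma sum_att_even:
  fixes \<phi> :: "(nat \<Rightarrow> nat) set \<Rightarrow> 'b::comm_semiring_1"
  assumes "spath Q"
  shows "(\<Sum>ys | att Q ys \<and> even (length ys). \<phi> (set ys)) = 2 * (\<Sum>C\<in>att_holes Q. \<phi> C)"
proof -
  let ?S = "{ys. att Q ys \<and> even (length ys)}"
  have "(\<Sum>ys\<in>?S. \<phi> (set ys)) = (\<Sum>C\<in>att_holes Q. \<Sum>ys\<in>{ys\<in>?S. set ys = C}. \<phi> (set ys))"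
    by (rule sum.group[symmetric, OF finite_att_even finite_att_holes]) (use att_set_in_att_holes in auto)
  also have "\<dots> = (\<Sum>C\<in>att_holes Q. 2 * \<phi> C)"
  proof (rule sum.cong[OF refl])
    fix C assume C: "C \<in> att_holes Q"
    show "(\<Sum>ys\<in>{ys\<in>?S. set ys = C}. \<phi> (set ys)) = 2 * \<phi> C"
    proof (rule att_lists[OF assms C])
      fix ys assume ys: "set ys = C" "ys \<noteq> rev ys"
        "{zs. att Q zs \<and> even (length zs) \<and> set zs = C} = {ys, rev ys}"
      have "{ys\<in>?S. set ys = C} = {ys, rev ys}" unfolding ys(3)[symmetric] by blast
      then show "(\<Sum>ys\<in>{ys\<in>?S. set ys = C}. \<phi> (set ys)) = 2 * \<phi> C"
        using ys(1,2) by (simp add: mult_2)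
    qed
  qed
  finally show ?thesis by (simp add: sum_distrib_left)
qed

text \<open>The old vertex \<open>k\<close> and the new vertex \<open>j\<close> share the
  nonadjacent neighbours \<open>u\<close> and \<open>v\<close>. Each can therefore be added to the
  common part of the two holes without changing \<open>rest\<close>, and \<open>j\<close> cannot see
  an earlier vertex of \<open>Q\<close>.\<close>

lemma att_holes_deformation:
  assumes Q: "spath Q" and C: "C \<in> att_holes Q" and d: "deformation n V C C'"
  shows "C' \<in> att_holes Q \<and> rest (set Q \<union> C') = rest (set Q \<union> C)"
proof -
  obtain ys where ys: "even_hole_list n V ys" "set ys = C" using C unfolding att_holes_def even_holes_def by blast
  have h: "hole n V ys" using ys(1) by (simp add: even_hole_list_iff)
  have sub: "C \<subseteq> rest (set (butlast Q))" using C unfolding att_holes_def by blast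
  obtain i j where ij: "i < length ys" "j \<in> V" "j \<notin> set ys"
    "\<forall>y\<in>set ys. adj n j y \<longleftrightarrow> y = ys ! i \<or> adj n (ys ! i) y" "C' = insert j (set ys - {ys ! i})"
    using deformation_of_hole_list[OF ys(1), unfolded ys(2), OF d] unfolding ys(2) by blast
  define k where "k = ys ! i"
  have kC: "k \<in> C" using ij(1) ys(2) unfolding k_def by auto
  have C'V: "C \<subseteq> V" using hole_D(3)[OF h] ys(2) by blast
  obtain u v where uv: "u \<in> C" "v \<in> C" "u \<noteq> v" "\<not> adj n u v" "\<forall>z\<in>C. adj n k z \<longleftrightarrow> z = u \<or> z = v"
    using hole_nbrs[OF h, of k, unfolded ys(2), OF kC] by blast
  have kuv: "adj n k u" "adj n k v" using uv by blast+
  then have ku: "k \<noteq> u" "k \<noteq> v" "adj n k u" "adj n k v" by auto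
  have ju: "adj n j u" "adj n j v" "adj n j k" using ij(4) uv(1,2) kC kuv ys(2) unfolding k_def by blast+
  have C': "C' = insert j (C - {k})" using ij(5) ys(2) k_def by simp
  have QU: "set Q \<subseteq> insert s V" using spath_D(4)[OF Q] by blast
  \<comment> \<open>A contact \<open>q\<close> on the shortened path would complete a claw at
    \<open>j\<close> with leaves \<open>u\<close>, \<open>v\<close> and \<open>q\<close>.\<close>
  have jR: "j \<in> rest (set (butlast Q))"
  proof -
    have "q \<noteq> j \<and> \<not> adj n q j" if q: "q \<in> set (butlast Q)" for q
    proof -
      have qU: "q \<in> insert s V" using q QU in_set_butlastD by fast
      have qu: "q \<noteq> u" "q \<noteq> v" "\<not> adj n q u" "\<not> adj n q v" using sub uv(1,2) q unfolding rest_def by auto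
      have "q \<noteq> j" using qu ju by auto
      moreover have "\<not> adj n j q"
      proof
        assume jq: "adj n j q"
        have U: "j \<in> insert s V" "u \<in> insert s V" "v \<in> insert s V" using ij(2) uv C'V by blast+
        have "\<not> adj n u q" "\<not> adj n v q" using qu adj_sym[of n u q] adj_sym[of n v q] by blast+
        then show False using claw[OF U qU ju(1,2) jq uv(3)] qu uv(4) by blast
      qed
      ultimately show ?thesis using adj_sym[of n q j] by blast
    qed
    then show ?thesis using ij(2) unfolding rest_def by blast
  qed
  have "C' \<subseteq> rest (set (butlast Q))" using C' jR sub by blast
  moreover have "C' \<in> even_holes n V" using even_holes_deformation(1)[OF _ d] C unfolding att_holes_def by blast
  \<comment> \<open>\<open>last Q\<close> sees two vertices of the old hole and only one vertex is
    removed.\<close>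
  moreover have "\<exists>y\<in>C'. adj n (last Q) y"
  proof -
    obtain y where y: "y \<in> C" "adj n (last Q) y" using C unfolding att_holes_def by blast
    obtain a c where ac: "a \<in> C" "c \<in> C" "adj n a c" "\<forall>z\<in>C. adj n (last Q) z \<longleftrightarrow> z = a \<or> z = c"
      using attached_edge[OF Q h, unfolded ys(2), OF sub y] by blast
    have "a \<noteq> c" using ac(3) by auto
    then show ?thesis using ac(1,2,4) C' by blast
  qed
  moreover have "rest (set Q \<union> C') = rest (set Q \<union> C)"
  proof -
    let ?X = "set Q \<union> (C - {k})"
    have X: "?X \<subseteq> insert s V" "u \<in> ?X" "v \<in> ?X" using QU C'V uv(1,2) ku(1,2) by blast+
    have "rest (insert k ?X) = rest ?X" using rest_insert[OF _ X uv(3,4) ku(3,4)] kC C'V by blast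
    moreover have "rest (insert j ?X) = rest ?X" using rest_insert[OF _ X uv(3,4) ju(1,2)] ij(2) by blast
    moreover have "insert k ?X = set Q \<union> C" "insert j ?X = set Q \<union> C'" using kC C' by auto
    ultimately show ?thesis by simp
  qed
  ultimately show ?thesis unfolding att_holes_def by blast
qed

lemma att_holes_closure:
  assumes "spath Q" "C \<in> att_holes Q" "C' \<in> deform_closure n V C"
  shows "C' \<in> att_holes Q \<and> rest (set Q \<union> C') = rest (set Q \<union> C)"
  using assms(3)
proof (induction rule: deform_closure.induct)
  case base then show ?case using assms(2) by simp
next
  case (step C1 C2)
  then have "C1 \<in> att_holes Q" by blast
  then show ?case using att_holes_deformation[OF assms(1) _ step(2)] step(3) by simp
qed

text \<open>The coefficient of \<open>h\<close> at \<open>Q\<close> after one step. An extension has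
  weight 1 because the new factor is already part of the longer product; a contraction leaves the
  square of a term, hence \<open>b j\<close> squared; a lollipop contributes the number
  \<open>c\<close> that replaces its hole.\<close>

definition path_step :: "((nat \<Rightarrow> nat) \<Rightarrow> real) \<Rightarrow> ((nat \<Rightarrow> nat) set \<Rightarrow> real) \<Rightarrow>
    ((nat \<Rightarrow> nat) list \<Rightarrow> real) \<Rightarrow> (nat \<Rightarrow> nat) list \<Rightarrow> real" where
  "path_step b c f Q = (if 2 \<le> length Q then f (butlast Q) else 0)
     + (\<Sum>j | spath (Q @ [j]). (b j)\<^sup>2 * f (Q @ [j]))
     + (\<Sum>ys | att Q ys \<and> even (length ys). c (set ys) * f (Q @ butlast ys))"

definition nbhd_invariant :: "((nat \<Rightarrow> nat) list \<Rightarrow> 'b) \<Rightarrow> bool" where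
  "nbhd_invariant f \<longleftrightarrow> (\<forall>P P'. spath P \<longrightarrow> spath P' \<longrightarrow> length P = length P' \<longrightarrow> rest (set P) = rest (set P') \<longrightarrow> f P = f P')"

lemma nbhd_invariantD:
  "nbhd_invariant f \<Longrightarrow> spath P \<Longrightarrow> spath P' \<Longrightarrow> length P = length P' \<Longrightarrow> rest (set P) = rest (set P') \<Longrightarrow> f P = f P'"
  unfolding nbhd_invariant_def by blast

lemma nbhd_invariant_att:
  assumes "nbhd_invariant f" "att Q ys" "att Q zs" "card (set ys) = card (set zs)"
    "rest (set Q \<union> set ys) = rest (set Q \<union> set zs)"
  shows "f (Q @ butlast ys) = f (Q @ butlast zs)"
proof (rule nbhd_invariantD[OF assms(1)])
  show "spath (Q @ butlast ys)" "spath (Q @ butlast zs)"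
    using att_spath[OF assms(2)] att_spath[OF assms(3)] .
  show "rest (set (Q @ butlast ys)) = rest (set (Q @ butlast zs))"
    using rest_att[OF assms(2)] rest_att[OF assms(3)] assms(5) by simp
  show "length (Q @ butlast ys) = length (Q @ butlast zs)"
    using assms(4) att_D(4)[OF assms(2)] att_D(4)[OF assms(3)] by (simp add: distinct_card)
qed

end

section \<open>One commutator step\<close>

text \<open>On its way left from the end, \<open>j\<close> passes exactly one neighbour, the vertex
  at position \<open>i + 2\<close>, and stops next to \<open>P ! (i+1)\<close>.\<close>

lemma (in word_function) tri_word:
  assumes i: "i + 2 < length P" and nb: "nb_idx n P j = {i, i+1, i+2}"
  shows "W (P @ [j]) = - W (take (i+1) P @ [P ! (i+1), j] @ drop (i+2) P)"
proof -
  let ?A = "take (i+1) P" and ?k = "P ! (i+1)" and ?B = "drop (i+2) P"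
  have P: "P = ?A @ [?k] @ ?B" using id_take_nth_drop[of "i+1" P] i by simp
  have "nb_idx n ?B j = {0}"
  proof -
    have 1: "a \<in> nb_idx n ?B j \<longleftrightarrow> a < length P - (i+2) \<and> i + 2 + a \<in> nb_idx n P j" for a
      unfolding nb_idx_def by auto
    have "a \<in> nb_idx n ?B j \<longleftrightarrow> a = 0" for a unfolding 1[of a] nb using i by auto
    then show ?thesis by blast
  qed
  then have d: "deg n j ?B = 1" by (simp add: deg_nb_idx)
  have "W (?A @ [?k, j] @ ?B) = - W (?A @ [?k] @ ?B @ [j])"
    using move[of "?A @ [?k]" j ?B "[]"] d by simp
  moreover have "W (P @ [j]) = W (?A @ [?k] @ ?B @ [j])"
  proof (rule arg_cong[of _ _ W])
    have "P @ [j] = (?A @ [?k] @ ?B) @ [j]" using P by (rule arg_cong[of _ _ "\<lambda>x. x @ [j]"])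
    then show "P @ [j] = ?A @ [?k] @ ?B @ [j]" by simp
  qed
  ultimately show ?thesis by simp
qed

context simplicial_graph
begin

text \<open>The vertices at positions \<open>i\<close> and \<open>i + 2\<close> are nonadjacent and
  are neighbours both of \<open>j\<close> and of the vertex it replaces, so neither of the two
  enlarges the closed neighbourhood of the remaining path.\<close>

lemma tri_flip:
  assumes P: "spath P" and j: "j \<in> V" "j \<notin> set P" and i: "i + 2 < length P"
    and nb: "nb_idx n P j = {i, i+1, i+2}"
  defines "P' \<equiv> P[i+1 := j]" and "k \<equiv> P ! (i+1)"
  shows "spath P'" "k \<in> V" "k \<notin> set P'" "nb_idx n P' k = {i, i+1, i+2}" "rest (set P') = rest (set P)" "adj n k j"
proof -
  note PD = spath_D[OF P]
  have adjj: "adj n j (P ! a) \<longleftrightarrow> a = i \<or> a = i+1 \<or> a = i+2" if "a < length P" for a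
  proof -
    have "adj n j (P ! a) \<longleftrightarrow> a \<in> nb_idx n P j" using that by (simp add: nb_idx_def)
    then show ?thesis unfolding nb by simp
  qed
  have adjj': "adj n (P ! a) j \<longleftrightarrow> a = i \<or> a = i+1 \<or> a = i+2" if "a < length P" for a
    using adjj[OF that] adj_sym[of n j "P ! a"] by simp
  have setP': "set P' = insert j (set P - {k})"
    unfolding P'_def k_def using set_update_distinct[OF PD(3), of "i+1"] i by simp
  show kV: "k \<in> V" unfolding k_def using spath_nth_in_V[OF P, of "i+1"] i by simp
  have kP: "k \<in> set P" unfolding k_def using i by simp
  show "k \<notin> set P'" unfolding setP' using j(2) kP by blast
  show kj: "adj n k j" unfolding k_def using adjj'[of "i+1"] i by simp
  have "pathlike n P'" unfolding pathlike_def
  proof (intro allI impI)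
    fix l a assume l: "l < length P'" and a: "a < l"
    have lP: "l < length P" "a < length P" using l a unfolding P'_def by simp_all
    show "adj n (P' ! a) (P' ! l) \<longleftrightarrow> l = a + 1"
    proof (cases "l = i + 1")
      case True
      then show ?thesis unfolding P'_def using a lP adjj'[of a] by auto
    next
      case l': False
      show ?thesis
      proof (cases "a = i + 1")
        case True
        then show ?thesis unfolding P'_def using a lP adjj[of l] by auto
      next
        case False
        then show ?thesis unfolding P'_def using l' lP a pathlike_adj[OF PD(5) lP(2,1)] by auto
      qed
    qed
  qed
  moreover have "distinct P'" unfolding P'_def using PD(3) j(2) by (simp add: distinct_list_update)
  moreover have "set P' \<subseteq> insert s V" unfolding setP' using PD(4) j(1) by blast
  moreover have "hd P' = s" "P' \<noteq> []"
    using spath_nth_0[OF P] PD(1) unfolding P'_def by (simp_all add: hd_conv_nth)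
  ultimately show "spath P'" unfolding spath_def induced_path_list_iff by blast
  have "a \<in> nb_idx n P' k \<longleftrightarrow> a \<in> {i, i+1, i+2}" for a
  proof (cases "a = i + 1")
    case True
    then show ?thesis unfolding nb_idx_def P'_def using i kj by simp
  next
    case False
    then have "a \<in> nb_idx n P' k \<longleftrightarrow> a < length P \<and> adj n (P ! (i+1)) (P ! a)"
      unfolding nb_idx_def P'_def k_def by simp
    then show ?thesis using pathlike_adj[OF PD(5), of "i+1" a] i False by auto
  qed
  then show "nb_idx n P' k = {i, i+1, i+2}" by blast
  let ?X = "set P - {k}" and ?u = "P ! i" and ?w = "P ! (i+2)"
  have uw: "?u \<noteq> ?w" "?u \<noteq> k" "?w \<noteq> k" "\<not> adj n ?u ?w" "adj n k ?u" "adj n k ?w"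
    using nth_eq_iff_index_eq[OF PD(3)] pathlike_adj[OF PD(5)] i unfolding k_def by simp_all
  have X: "?X \<subseteq> insert s V" "?u \<in> ?X" "?w \<in> ?X" using PD(4) uw(2,3) i by auto
  have "rest (insert k ?X) = rest ?X" using rest_insert[OF _ X uw(1,4,5,6)] kV by blast
  moreover have "rest (insert j ?X) = rest ?X"
    using rest_insert[OF _ X uw(1,4)] adjj[of i] adjj[of "i+2"] i j(1) by simp
  moreover have "insert k ?X = set P" using kP by blast
  ultimately show "rest (set P') = rest (set P)" unfolding setP' by simp
qed

end

text \<open>\<open>W_cycle\<close> is what the projector provides: a class sum of hole products in
  front of a path product acts as a number. \<open>\<mu>\<close> refers to holes multiplied in
  cyclic order, so it agrees with the eigenvalue of \<open>cycle_symmetry\<close> only up to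
  sign.\<close>

locale word_graph = simplicial_graph n V s + word_function n W
  for n V s W +
  fixes b :: "(nat \<Rightarrow> nat) \<Rightarrow> real" and \<mu> :: "(nat \<Rightarrow> nat) set \<Rightarrow> real"
  assumes W_square: "\<And>j xs. j \<in> V \<Longrightarrow> W (xs @ [j, j]) = complex_of_real ((b j)\<^sup>2) * W xs"
    and W_cycle: "\<And>C0 Q. C0 \<in> even_holes n V \<Longrightarrow> spath Q \<Longrightarrow>
      (\<Sum>C\<in>deform_closure n V C0. W ((SOME xs. even_hole_list n V xs \<and> set xs = C) @ Q)) = complex_of_real (\<mu> C0) * W Q"
begin

text \<open>Every member of a deformation class is attached to the same paths, so behind the projector each
cycle operator may be replaced by the class average of the eigenvalue.\<close>

definition cycle_weight :: "(nat \<Rightarrow> nat) set \<Rightarrow> real" where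
  "cycle_weight C = \<mu> C / real (card (deform_closure n V C))"

text \<open>Exchanging \<open>j\<close> with the middle one of its three neighbours gives a product
  with the same factors, except that these two anticommuting ones stand in opposite order.
  \<open>nbhd_invariant\<close> makes the coefficients equal.\<close>

lemma sum_tri_pairs:
  assumes f: "nbhd_invariant f"
  shows "(\<Sum>(P, j)\<in>tri_pairs. complex_of_real (f P) * W (P @ [j])) = 0"
proof -
  \<comment> \<open>The position of the triple can be read off as the least neighbour position, and
    it stays the same after the exchange.\<close>
  define \<phi> where "\<phi> = (\<lambda>(P, j). let i = Min (nb_idx n P j) in (P[i+1 := j], P ! (i+1)))"
  have key: "\<phi> (P, j) \<in> tri_pairs \<and> \<phi> (\<phi> (P, j)) = (P, j) \<and>
      (case \<phi> (P, j) of (P', k) \<Rightarrow> complex_of_real (f P') * W (P' @ [k])) = - (complex_of_real (f P) * W (P @ [j]))"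
    if x: "(P, j) \<in> tri_pairs" for P j
  proof -
    from x obtain i where Pj: "spath P" "j \<in> V" "j \<notin> set P" "i + 2 < length P" "nb_idx n P j = {i, i+1, i+2}"
      unfolding tri_pairs_def by blast
    define P' where "P' = P[i+1 := j]"
    define k where "k = P ! (i+1)"
    note fl = tri_flip[OF Pj, folded P'_def k_def]
    have Min: "Min {i, i+1, i+2} = i" by simp
    have len: "length P' = length P" unfolding P'_def by simp
    have p1: "\<phi> (P, j) = (P', k)" unfolding \<phi>_def P'_def k_def using Pj(5) Min by (simp add: Let_def)
    have p2: "\<phi> (P', k) = (P, j)"
    proof -
      have "\<phi> (P', k) = (P'[i+1 := k], P' ! (i+1))" unfolding \<phi>_def using fl(4) Min by (simp add: Let_def)
      moreover have "P'[i+1 := k] = P" unfolding P'_def k_def by simp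
      moreover have "P' ! (i+1) = j" unfolding P'_def using Pj(4) by simp
      ultimately show ?thesis by simp
    qed
    have mem: "(P', k) \<in> tri_pairs"
      unfolding tri_pairs_def using fl(1-4) Pj(4) len by auto
    have fe: "f P' = f P" by (rule nbhd_invariantD[OF f fl(1) Pj(1) len fl(5)])
    have "W (P @ [j]) = - W (take (i+1) P @ [k, j] @ drop (i+2) P)"
      using tri_word[OF Pj(4,5)] unfolding k_def .
    also have "\<dots> = W (take (i+1) P @ [j, k] @ drop (i+2) P)"
      using swap[of "take (i+1) P" k j "drop (i+2) P"] fl(6) by simp
    finally have w1: "W (P @ [j]) = W (take (i+1) P @ [j, k] @ drop (i+2) P)" .
    have "i + 2 < length P'" using Pj(4) len by simp
    then have "W (P' @ [k]) = - W (take (i+1) P' @ [P' ! (i+1), k] @ drop (i+2) P')"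
      using tri_word[OF _ fl(4)] by blast
    moreover have "take (i+1) P' = take (i+1) P" "P' ! (i+1) = j" "drop (i+2) P' = drop (i+2) P"
      unfolding P'_def using Pj(4) by simp_all
    ultimately have w2: "W (P' @ [k]) = - W (take (i+1) P @ [j, k] @ drop (i+2) P)" by simp
    show ?thesis unfolding p1 p2 using mem fe w1 w2 by simp
  qed
  show ?thesis
  proof (rule sum_involution_zero[where \<phi> = \<phi>])
    fix x assume "x \<in> tri_pairs"
    moreover obtain P j where "x = (P, j)" by (cases x)
    ultimately show "\<phi> x \<in> tri_pairs" "\<phi> (\<phi> x) = x"
      "(case \<phi> x of (P, j) \<Rightarrow> complex_of_real (f P) * W (P @ [j])) = - (case x of (P, j) \<Rightarrow> complex_of_real (f P) * W (P @ [j]))"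
      using key[of P j] by auto
  qed
qed

lemma sum_odd_holes:
  assumes f: "nbhd_invariant f"
  shows "(\<Sum>(Q, ys) | att Q ys \<and> odd (length ys). complex_of_real (f (Q @ butlast ys)) * W (Q @ ys)) = 0"
proof (rule sum_involution_zero[where \<phi> = "\<lambda>(Q, ys). (Q, rev ys)"])
  fix x assume x: "x \<in> {(Q, ys). att Q ys \<and> odd (length ys)}"
  obtain Q ys where Qys: "x = (Q, ys)" by (cases x)
  have a: "att Q ys" "odd (length ys)" using x Qys by auto
  show "(case x of (Q, ys) \<Rightarrow> (Q, rev ys)) \<in> {(Q, ys). att Q ys \<and> odd (length ys)}"
    using Qys a att_rev[OF a(1)] by simp
  show "(case case x of (Q, ys) \<Rightarrow> (Q, rev ys) of (Q, ys) \<Rightarrow> (Q, rev ys)) = x" using Qys by simp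
  have "f (Q @ butlast (rev ys)) = f (Q @ butlast ys)"
    by (rule nbhd_invariant_att[OF f att_rev[OF a(1)] a(1)]) simp_all
  moreover have "W (Q @ rev ys) = - W (Q @ ys)"
    using hole_rev_word[OF att_D(2)[OF a(1)], of Q "[]"] a(2) by simp
  ultimately show "(case case x of (Q, ys) \<Rightarrow> (Q, rev ys) of (Q, ys) \<Rightarrow> complex_of_real (f (Q @ butlast ys)) * W (Q @ ys))
     = - (case x of (Q, ys) \<Rightarrow> complex_of_real (f (Q @ butlast ys)) * W (Q @ ys))"
    using Qys by simp
qed

text \<open>\<open>last Q\<close> has two neighbours on the hole and the other vertices of
  \<open>Q\<close> have none, so the number of signs is even. The hole thereby comes to stand
  directly behind the projector.\<close>

lemma att_word_commute:
  assumes "att Q ys"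
  shows "W (Q @ ys) = W (ys @ Q)"
proof -
  note D = att_D[OF assms]
  have "deg n q ys = 0" if "q \<in> set (butlast Q)" for q
  proof (rule deg_eq_0)
    fix x assume "x \<in> set ys"
    then have "x \<in> rest (set (butlast Q))" using assms unfolding att_def by blast
    then show "\<not> adj n q x" using that unfolding rest_def by blast
  qed
  then have "(\<Sum>q\<leftarrow>butlast Q. deg n q ys) = 0" by (simp add: sum_list_eq_0_iff)
  moreover have "deg n (last Q) ys = 2"
  proof -
    have e: "hd ys \<in> set ys" "last ys \<in> set ys" using D(6) by simp_all
    have "adj n (hd ys) (last ys)" using hole_hd_nbrs[OF D(2) e(2)] by blast
    then have ne: "hd ys \<noteq> last ys" by auto
    have "deg n (last Q) ys = card (set (filter (adj n (last Q)) ys))"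
      unfolding deg_def using D(4) by (metis distinct_card distinct_filter)
    also have "set (filter (adj n (last Q)) ys) = {hd ys, last ys}"
    proof -
      have "\<forall>y\<in>set ys. adj n (last Q) y \<longleftrightarrow> y = hd ys \<or> y = last ys" using assms unfolding att_def by blast
      then show ?thesis unfolding set_filter using e by blast
    qed
    finally show ?thesis using ne by simp
  qed
  moreover have "(\<Sum>q\<leftarrow>Q. deg n q ys) = (\<Sum>q\<leftarrow>butlast Q @ [last Q]. deg n q ys)" using D(7) by simp
  ultimately have "(\<Sum>q\<leftarrow>Q. deg n q ys) = 2" by simp
  then show ?thesis using block[of "[]" Q ys "[]"] by simp
qed

text \<open>After the hole product is moved to the front, the coefficient depends on the hole only
  through its vertex set and is constant on deformation classes. Averaging over classes then
  replaces each product by its share of the eigenvalue.\<close>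

lemma sum_even_holes:
  assumes f: "nbhd_invariant f" and Q: "spath Q"
  shows "(\<Sum>ys | att Q ys \<and> even (length ys). complex_of_real (f (Q @ butlast ys)) * W (Q @ ys))
       = (\<Sum>ys | att Q ys \<and> even (length ys). complex_of_real (cycle_weight (set ys) * f (Q @ butlast ys)) * W Q)"
proof -
  \<comment> \<open>\<open>L\<close> is the list that \<open>W_cycle\<close> selects;
    \<open>F\<close> is the coefficient as a function of the vertex set, well defined because
    opening the hole elsewhere changes neither length nor \<open>rest\<close>.\<close>
  define L where "L C = (SOME xs. even_hole_list n V xs \<and> set xs = C)" for C
  define F where "F C = f (Q @ butlast (SOME ys. att Q ys \<and> set ys = C))" for C
  have F: "f (Q @ butlast ys) = F (set ys)" if "att Q ys" for ys
  proof -
    define zs where "zs = (SOME zs. att Q zs \<and> set zs = set ys)"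
    have "att Q zs \<and> set zs = set ys" unfolding zs_def by (rule someI[of _ ys]) (use that in simp)
    then show ?thesis unfolding F_def zs_def[symmetric] using nbhd_invariant_att[OF f that, of zs] by simp
  qed
  have Wl: "W (Q @ ys) = W (L (set ys) @ Q)" if "att Q ys" "even (length ys)" for ys
  proof -
    have y: "even_hole_list n V ys" using att_D(2)[OF that(1)] that(2) by (simp add: even_hole_list_iff)
    have "even_hole_list n V (L (set ys)) \<and> set (L (set ys)) = set ys"
      unfolding L_def by (rule someI[of _ ys]) (use y in simp)
    then show ?thesis using att_word_commute[OF that(1)] even_hole_words_eq[OF y, of "L (set ys)" "[]" Q] by simp
  qed
  have "(\<Sum>ys | att Q ys \<and> even (length ys). complex_of_real (f (Q @ butlast ys)) * W (Q @ ys))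
      = (\<Sum>ys | att Q ys \<and> even (length ys). complex_of_real (F (set ys)) * W (L (set ys) @ Q))"
    by (rule sum.cong) (simp_all add: F Wl)
  also have "\<dots> = 2 * (\<Sum>C\<in>att_holes Q. complex_of_real (F C) * W (L C @ Q))"
    by (rule sum_att_even[OF Q])
  also have "(\<Sum>C\<in>att_holes Q. complex_of_real (F C) * W (L C @ Q))
     = (\<Sum>C\<in>att_holes Q. complex_of_real (F C) * (complex_of_real (\<mu> C) / of_nat (card (deform_closure n V C))) * W Q)"
  proof (rule sum_average_over_classes[OF finite_att_holes])
    fix C assume C: "C \<in> att_holes Q"
    have CE: "C \<in> even_holes n V" using C unfolding att_holes_def by blast
    show "deform_closure n V C \<subseteq> att_holes Q" using att_holes_closure[OF Q C] by blast
    show "C \<in> deform_closure n V C" by (rule deform_closure.base)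
    show "(\<Sum>C'\<in>deform_closure n V C. W (L C' @ Q)) = complex_of_real (\<mu> C) * W Q"
      unfolding L_def by (rule W_cycle[OF CE Q])
    fix C' assume C': "C' \<in> deform_closure n V C"
    show "deform_closure n V C' = deform_closure n V C" by (rule deform_closure_eq[OF CE C'])
    have C'2: "C' \<in> att_holes Q" "rest (set Q \<union> C') = rest (set Q \<union> C)" using att_holes_closure[OF Q C C'] by auto
    have card: "card C' = card C" using deform_closure_even_hole[OF CE C'] by blast
    show "complex_of_real (F C') = complex_of_real (F C)"
    proof (rule att_lists[OF Q C], rule att_lists[OF Q C'2(1)])
      fix ys zs assume ys: "att Q ys" "set ys = C" and zs: "att Q zs" "set zs = C'"
      have "f (Q @ butlast zs) = f (Q @ butlast ys)"
        by (rule nbhd_invariant_att[OF f zs(1) ys(1)]) (use zs(2) ys(2) card C'2(2) in simp_all)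
      then show ?thesis using F[OF ys(1)] F[OF zs(1)] ys(2) zs(2) by simp
    qed
  qed
  also have "2 * \<dots> = 2 * (\<Sum>C\<in>att_holes Q. complex_of_real (cycle_weight C * F C) * W Q)"
    by (simp add: cycle_weight_def mult_ac)
  also have "\<dots> = (\<Sum>ys | att Q ys \<and> even (length ys). complex_of_real (cycle_weight (set ys) * F (set ys)) * W Q)"
    by (rule sum_att_even[OF Q, symmetric])
  also have "\<dots> = (\<Sum>ys | att Q ys \<and> even (length ys). complex_of_real (cycle_weight (set ys) * f (Q @ butlast ys)) * W Q)"
    by (rule sum.cong) (simp_all add: F)
  finally show ?thesis .
qed

text \<open>The repeated last factor squares to a scalar and leaves the product over the shortened
  path.\<close>

lemma sum_con_pairs:
  "(\<Sum>P | spath P \<and> 2 \<le> length P. complex_of_real (f P) * W (P @ [last P]))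
    = (\<Sum>Q | spath Q. \<Sum>j | spath (Q @ [j]). complex_of_real ((b j)\<^sup>2 * f (Q @ [j])) * W Q)"
proof -
  have finj: "finite {j. spath (Q @ [j])}" if "spath Q" for Q
  proof -
    have "{j. spath (Q @ [j])} \<subseteq> insert s V" using spath_D(4) by fastforce
    then show ?thesis using finV by (meson finite_insert finite_subset)
  qed
  have pre: "spath Q" if "spath (Q @ [j])" "Q \<noteq> []" for Q j using spath_snoc[OF that(2)] that(1) by blast
  have "(\<Sum>Q | spath Q. \<Sum>j | spath (Q @ [j]). complex_of_real ((b j)\<^sup>2 * f (Q @ [j])) * W Q)
     = (\<Sum>(Q, j)\<in>(SIGMA Q:{Q. spath Q}. {j. spath (Q @ [j])}). complex_of_real ((b j)\<^sup>2 * f (Q @ [j])) * W Q)"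
    by (rule sum.Sigma) (use finite_spath finj in auto)
  also have "\<dots> = (\<Sum>P | spath P \<and> 2 \<le> length P. complex_of_real (f P) * W (P @ [last P]))"
  proof (rule sum.reindex_bij_witness[of _ "\<lambda>P. (butlast P, last P)" "\<lambda>(Q, j). Q @ [j]"])
    fix x assume x: "x \<in> (SIGMA Q:{Q. spath Q}. {j. spath (Q @ [j])})"
    obtain Q j where Qj: "x = (Q, j)" by (cases x)
    have s: "spath Q" "spath (Q @ [j])" using x Qj by auto
    have Qne: "Q \<noteq> []" using spath_D(1)[OF s(1)] .
    show "(butlast (case x of (Q, j) \<Rightarrow> Q @ [j]), last (case x of (Q, j) \<Rightarrow> Q @ [j])) = x" using Qj by simp
    show "(case x of (Q, j) \<Rightarrow> Q @ [j]) \<in> {P. spath P \<and> 2 \<le> length P}"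
      using Qj s Qne by (cases Q) simp_all
    have "j \<in> V" using spath_snoc[OF Qne] s(2) rest_subset by blast
    then show "complex_of_real (f (case x of (Q, j) \<Rightarrow> Q @ [j])) * W ((case x of (Q, j) \<Rightarrow> Q @ [j]) @ [last (case x of (Q, j) \<Rightarrow> Q @ [j])])
       = (case x of (Q, j) \<Rightarrow> complex_of_real ((b j)\<^sup>2 * f (Q @ [j])) * W Q)"
      using Qj W_square[of j Q] by simp
  next
    fix P assume "P \<in> {P. spath P \<and> 2 \<le> length P}"
    then have P: "spath P" "2 \<le> length P" by auto
    then have "butlast P @ [last P] = P" using spath_D(1) by simp
    then show "(case (butlast P, last P) of (Q, j) \<Rightarrow> Q @ [j]) = P"
      "(butlast P, last P) \<in> (SIGMA Q:{Q. spath Q}. {j. spath (Q @ [j])})"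
      using spath_butlast[OF P] P(1) by simp_all
  qed
  finally show ?thesis ..
qed

theorem sum_odd_pairs_words:
  assumes f: "nbhd_invariant f"
  shows "(\<Sum>(P, j)\<in>odd_pairs. complex_of_real (f P) * W (P @ [j]))
       = (\<Sum>Q | spath Q. complex_of_real (path_step b cycle_weight f Q) * W Q)"
proof -
  have lol: "(\<Sum>(Q, ys) | att Q ys. complex_of_real (f (Q @ butlast ys)) * W (Q @ ys))
     = (\<Sum>Q | spath Q. \<Sum>ys | att Q ys \<and> even (length ys). complex_of_real (cycle_weight (set ys) * f (Q @ butlast ys)) * W Q)"
    (is "?L = ?R")
  proof -
    let ?g = "\<lambda>(Q, ys). complex_of_real (f (Q @ butlast ys)) * W (Q @ ys)"
    let ?E = "{(Q, ys). att Q ys \<and> even (length ys)}" and ?O = "{(Q, ys). att Q ys \<and> odd (length ys)}"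
    have fin: "finite ?E" "finite ?O" by (rule finite_subset[OF _ finite_att]; blast)+
    have "{(Q, ys). att Q ys} = ?E \<union> ?O" by blast
    then have "?L = sum ?g ?E + sum ?g ?O" using fin by (simp add: sum.union_disjoint disjoint_iff)
    also have "sum ?g ?O = 0" by (rule sum_odd_holes[OF f])
    also have "?E = (SIGMA Q:{Q. spath Q}. {ys. att Q ys \<and> even (length ys)})" using att_D(1) by blast
    also have "sum ?g \<dots> = (\<Sum>Q | spath Q. \<Sum>ys | att Q ys \<and> even (length ys). complex_of_real (f (Q @ butlast ys)) * W (Q @ ys))"
      by (rule sum.Sigma[symmetric]) (use finite_spath finite_att_even in auto)
    also have "\<dots> = ?R" by (rule sum.cong[OF refl]) (use sum_even_holes[OF f] in simp)
    finally show ?thesis by simp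
  qed
  have ext: "(\<Sum>xs | spath xs \<and> 2 \<le> length xs. complex_of_real (f (butlast xs)) * W (butlast xs @ [last xs]))
     = (\<Sum>Q | spath Q. complex_of_real (if 2 \<le> length Q then f (butlast Q) else 0) * W Q)"
  proof -
    have "(\<Sum>Q | spath Q. complex_of_real (if 2 \<le> length Q then f (butlast Q) else 0) * W Q)
       = (\<Sum>Q\<in>{Q\<in>{Q. spath Q}. 2 \<le> length Q}. complex_of_real (f (butlast Q)) * W Q)"
      unfolding sum.inter_filter[OF finite_spath] by (rule sum.cong) simp_all
    also have "\<dots> = (\<Sum>xs | spath xs \<and> 2 \<le> length xs. complex_of_real (f (butlast xs)) * W (butlast xs @ [last xs]))"
      by (rule sum.cong) (use spath_D(1) in auto)
    finally show ?thesis ..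
  qed
  have att_last: "(\<Sum>(Q, ys) | att Q ys. complex_of_real (f (Q @ butlast ys)) * W ((Q @ butlast ys) @ [last ys]))
     = (\<Sum>(Q, ys) | att Q ys. complex_of_real (f (Q @ butlast ys)) * W (Q @ ys))"
    by (rule sum.cong) (use att_D(6) in auto)
  have "(\<Sum>(P, j)\<in>odd_pairs. complex_of_real (f P) * W (P @ [j]))
     = (\<Sum>Q | spath Q. complex_of_real (if 2 \<le> length Q then f (butlast Q) else 0) * W Q)
     + (\<Sum>Q | spath Q. \<Sum>j | spath (Q @ [j]). complex_of_real ((b j)\<^sup>2 * f (Q @ [j])) * W Q)
     + (\<Sum>Q | spath Q. \<Sum>ys | att Q ys \<and> even (length ys). complex_of_real (cycle_weight (set ys) * f (Q @ butlast ys)) * W Q)"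
    unfolding sum_odd_pairs[of "\<lambda>(P, j). complex_of_real (f P) * W (P @ [j])"]
    using ext sum_con_pairs[of f] sum_tri_pairs[OF f] lol att_last by simp
  also have "\<dots> = (\<Sum>Q | spath Q. complex_of_real (path_step b cycle_weight f Q) * W Q)"
    unfolding path_step_def of_real_add of_real_sum distrib_right sum.distrib sum_distrib_right ..
  finally show ?thesis .
qed

end

section \<open>Generating functions of weighted walks\<close>

definition touch :: "nat \<Rightarrow> (nat \<Rightarrow> nat) set \<Rightarrow> (nat \<Rightarrow> nat) set \<Rightarrow> bool" where
  "touch n A B \<longleftrightarrow> A \<inter> B \<noteq> {} \<or> (\<exists>x\<in>A. \<exists>y\<in>B. adj n x y)"

lemma touch_sym: "touch n A B \<longleftrightarrow> touch n B A"
proof -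
  have "touch n B A" if "touch n A B" for A B
  proof -
    from that consider "A \<inter> B \<noteq> {}" | x y where "x \<in> A" "y \<in> B" "adj n x y" unfolding touch_def by blast
    then show ?thesis
    proof cases
      case 1 then show ?thesis unfolding touch_def by blast
    next
      case 2 then show ?thesis unfolding touch_def using adj_sym[of n x y] by blast
    qed
  qed
  then show ?thesis by blast
qed

definition ind_families :: "nat \<Rightarrow> (nat \<Rightarrow> nat) set set \<Rightarrow> (nat \<Rightarrow> nat) set \<Rightarrow> (nat \<Rightarrow> nat) set set set" where
  "ind_families n Obj X = {F. F \<subseteq> Obj \<and> (\<forall>A\<in>F. A \<subseteq> X) \<and> (\<forall>A\<in>F. \<forall>B\<in>F. A \<noteq> B \<longrightarrow> \<not> touch n A B)}"

lemma ind_familiesI: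
  assumes "F \<subseteq> Obj" "\<And>A. A \<in> F \<Longrightarrow> A \<subseteq> X" "\<And>A B. A \<in> F \<Longrightarrow> B \<in> F \<Longrightarrow> A \<noteq> B \<Longrightarrow> \<not> touch n A B"
  shows "F \<in> ind_families n Obj X"
  using assms unfolding ind_families_def by simp

lemma ind_familiesD:
  assumes "F \<in> ind_families n Obj X"
  shows "F \<subseteq> Obj" "\<And>A. A \<in> F \<Longrightarrow> A \<subseteq> X" "\<And>A B. A \<in> F \<Longrightarrow> B \<in> F \<Longrightarrow> A \<noteq> B \<Longrightarrow> \<not> touch n A B"
  using assms unfolding ind_families_def by simp_all

text \<open>The weighted independence polynomial of the graph whose vertices are the objects inside
  \<open>X\<close> and whose edges are the touching pairs.\<close>

definition family_poly :: "nat \<Rightarrow> (nat \<Rightarrow> nat) set set \<Rightarrow> ((nat \<Rightarrow> nat) set \<Rightarrow> 'b::comm_ring_1) \<Rightarrow> (nat \<Rightarrow> nat) set \<Rightarrow> 'b" where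
  "family_poly n Obj w X = (\<Sum>F\<in>ind_families n Obj X. \<Prod>A\<in>F. w A)"

definition away :: "nat \<Rightarrow> (nat \<Rightarrow> nat) set \<Rightarrow> (nat \<Rightarrow> nat) set \<Rightarrow> (nat \<Rightarrow> nat) set" where
  "away n X A = {v \<in> X. v \<notin> A \<and> (\<forall>x\<in>A. \<not> adj n x v)}"

lemma subset_away_iff: "B \<subseteq> away n X A \<longleftrightarrow> B \<subseteq> X \<and> \<not> touch n A B"
  unfolding away_def touch_def by blast

text \<open>Objects meeting \<open>L\<close> touch one another, so a family contains at most one of
  them. It either avoids \<open>L\<close> or splits uniquely into such an object \<open>A\<close>
  and a family inside the part of \<open>X\<close> away from \<open>A\<close>.\<close>

lemma family_poly_rec:
  assumes fin: "finite Obj" and ne: "{} \<notin> Obj"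
    and L: "\<And>A B. A \<in> Obj \<Longrightarrow> B \<in> Obj \<Longrightarrow> A \<subseteq> X \<Longrightarrow> B \<subseteq> X \<Longrightarrow> A \<inter> L \<noteq> {} \<Longrightarrow> B \<inter> L \<noteq> {} \<Longrightarrow> touch n A B"
  shows "family_poly n Obj w X = family_poly n Obj w (X - L)
    + (\<Sum>A\<in>{A\<in>Obj. A \<subseteq> X \<and> A \<inter> L \<noteq> {}}. w A * family_poly n Obj w (away n X A))"
proof -
  let ?S = "{A\<in>Obj. A \<subseteq> X \<and> A \<inter> L \<noteq> {}}"
  let ?I = "ind_families n Obj"
  have finI: "finite (?I Y)" for Y
    by (rule finite_subset[of _ "Pow Obj"]) (use fin in \<open>auto simp: ind_families_def\<close>)
  have finF: "finite F" if "F \<in> ?I Y" for F Y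
    using that fin finite_subset unfolding ind_families_def by blast
  have notin: "A \<notin> F" if "A \<in> ?S" "F \<in> ?I (away n X A)" for A F
  proof
    assume "A \<in> F"
    then have "A \<subseteq> away n X A" using ind_familiesD(2)[OF that(2)] by blast
    moreover have "A \<noteq> {}" using that(1) ne by blast
    ultimately show False unfolding away_def by blast
  qed
  have eq: "?I X = ?I (X - L) \<union> (\<Union>A\<in>?S. insert A ` ?I (away n X A))"
  proof (intro equalityI subsetI)
    fix F assume F: "F \<in> ?I X"
    show "F \<in> ?I (X - L) \<union> (\<Union>A\<in>?S. insert A ` ?I (away n X A))"
    proof (cases "\<forall>A\<in>F. A \<inter> L = {}")
      case True
      have "F \<in> ?I (X - L)"
        by (rule ind_familiesI) (use ind_familiesD[OF F] True in \<open>blast+\<close>)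
      then show ?thesis by blast
    next
      case False
      then obtain A where A: "A \<in> F" "A \<inter> L \<noteq> {}" by blast
      have AS: "A \<in> ?S" using A ind_familiesD(1,2)[OF F] by blast
      have "F - {A} \<in> ?I (away n X A)"
      proof -
        have "B \<subseteq> away n X A" if "B \<in> F - {A}" for B
          unfolding subset_away_iff using that ind_familiesD(2,3)[OF F] A(1) by blast
        then show ?thesis
          by (intro ind_familiesI) (use ind_familiesD(1,3)[OF F] in \<open>blast+\<close>)
      qed
      moreover have "F = insert A (F - {A})" using A(1) by blast
      ultimately show ?thesis using AS by blast
    qed
  next
    fix F assume "F \<in> ?I (X - L) \<union> (\<Union>A\<in>?S. insert A ` ?I (away n X A))"
    then consider "F \<in> ?I (X - L)" | A F' where "A \<in> ?S" "F' \<in> ?I (away n X A)" "F = insert A F'" by blast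
    then show "F \<in> ?I X"
    proof cases
      case 1
      show ?thesis by (rule ind_familiesI) (use ind_familiesD[OF 1] in \<open>blast+\<close>)
    next
      case 2
      have B: "B \<subseteq> X \<and> \<not> touch n A B \<and> \<not> touch n B A" if "B \<in> F'" for B
        using ind_familiesD(2)[OF 2(2) that] subset_away_iff[of B n X A] touch_sym[of n A B] by simp
      show ?thesis
      proof (rule ind_familiesI)
        show "F \<subseteq> Obj" using 2(1,3) ind_familiesD(1)[OF 2(2)] by blast
        show "D \<subseteq> X" if "D \<in> F" for D using that 2(1,3) B by blast
        show "\<not> touch n D E" if "D \<in> F" "E \<in> F" "D \<noteq> E" for D E
          using that B[of D] B[of E] ind_familiesD(3)[OF 2(2), of D E] unfolding 2(3) by blast
      qed
    qed
  qed
  have disj1: "?I (X - L) \<inter> (\<Union>A\<in>?S. insert A ` ?I (away n X A)) = {}"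
  proof -
    have False if "F \<in> ?I (X - L)" "A \<in> ?S" "A \<in> F" for F A
      using ind_familiesD(2)[OF that(1,3)] that(2) by blast
    then show ?thesis by blast
  qed
  have disj2: "insert A ` ?I (away n X A) \<inter> insert B ` ?I (away n X B) = {}" if AB: "A \<in> ?S" "B \<in> ?S" "A \<noteq> B" for A B
  proof (rule ccontr)
    assume "\<not> ?thesis"
    then obtain F where F: "F \<in> insert A ` ?I (away n X A)" "F \<in> insert B ` ?I (away n X B)" by blast
    then have "B \<in> F" by blast
    then obtain F' where "F' \<in> ?I (away n X A)" "B \<in> F'" using F(1) AB(3) by blast
    then have "\<not> touch n A B" using subset_away_iff[of B n X A] ind_familiesD(2) by blast
    then show False using L[of A B] AB by blast
  qed
  have "family_poly n Obj w X = (\<Sum>F\<in>?I (X - L). \<Prod>A\<in>F. w A)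
     + (\<Sum>F\<in>(\<Union>A\<in>?S. insert A ` ?I (away n X A)). \<Prod>A\<in>F. w A)"
    unfolding family_poly_def eq using finI fin disj1 by (subst sum.union_disjoint) auto
  also have "(\<Sum>F\<in>(\<Union>A\<in>?S. insert A ` ?I (away n X A)). \<Prod>A\<in>F. w A)
     = (\<Sum>A\<in>?S. \<Sum>F\<in>insert A ` ?I (away n X A). \<Prod>A\<in>F. w A)"
  proof (rule sum.UNION_disjoint)
    show "finite ?S" using fin by simp
    show "\<forall>A\<in>?S. finite (insert A ` ?I (away n X A))" using finI by blast
    show "\<forall>A\<in>?S. \<forall>B\<in>?S. A \<noteq> B \<longrightarrow> insert A ` ?I (away n X A) \<inter> insert B ` ?I (away n X B) = {}"
      by (intro ballI impI disj2)
  qed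
  also have "\<dots> = (\<Sum>A\<in>?S. w A * family_poly n Obj w (away n X A))"
  proof (rule sum.cong[OF refl])
    fix A assume A: "A \<in> ?S"
    have "inj_on (insert A) (?I (away n X A))"
    proof (rule inj_onI)
      fix F F' assume F: "F \<in> ?I (away n X A)" "F' \<in> ?I (away n X A)" "insert A F = insert A F'"
      have "F = insert A F - {A}" using notin[OF A F(1)] by simp
      also have "\<dots> = F'" unfolding F(3) using notin[OF A F(2)] by simp
      finally show "F = F'" .
    qed
    then have "(\<Sum>F\<in>insert A ` ?I (away n X A). \<Prod>A\<in>F. w A) = (\<Sum>F\<in>?I (away n X A). \<Prod>B\<in>insert A F. w B)"
      by (simp add: sum.reindex)
    also have "\<dots> = (\<Sum>F\<in>?I (away n X A). w A * (\<Prod>B\<in>F. w B))"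
      by (rule sum.cong[OF refl]) (use notin[OF A] finF in simp)
    finally show "(\<Sum>F\<in>insert A ` ?I (away n X A). \<Prod>A\<in>F. w A) = w A * family_poly n Obj w (away n X A)"
      by (simp add: family_poly_def sum_distrib_left)
  qed
  finally show ?thesis by (simp add: family_poly_def)
qed

lemma fps_prod_nth_0: "finite F \<Longrightarrow> fps_nth (\<Prod>A\<in>F. w A :: 'a::comm_ring_1 fps) 0 = (\<Prod>A\<in>F. fps_nth (w A) 0)"
  by (induction rule: finite_induct) simp_all

text \<open>Only the empty family contributes to the constant term. This makes \<open>zeta\<close>
  nonzero and hence cancellable.\<close>

lemma family_poly_nth_0:
  fixes w :: "(nat \<Rightarrow> nat) set \<Rightarrow> real fps"
  assumes "finite Obj" "\<And>A. A \<in> Obj \<Longrightarrow> fps_nth (w A) 0 = 0"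
  shows "fps_nth (family_poly n Obj w X) 0 = 1"
proof -
  let ?I = "ind_families n Obj X"
  have finI: "finite ?I" by (rule finite_subset[of _ "Pow Obj"]) (use assms in \<open>auto simp: ind_families_def\<close>)
  have sub: "F \<subseteq> Obj" if "F \<in> ?I" for F using that unfolding ind_families_def by blast
  have "fps_nth (family_poly n Obj w X) 0 = (\<Sum>F\<in>?I. fps_nth (\<Prod>A\<in>F. w A) 0)"
    unfolding family_poly_def by (simp add: fps_sum_nth)
  also have "\<dots> = (\<Sum>F\<in>?I. if F = {} then 1 else 0)"
  proof (rule sum.cong[OF refl])
    fix F assume F: "F \<in> ?I"
    have fF: "finite F" using sub[OF F] assms(1) finite_subset by blast
    show "fps_nth (\<Prod>A\<in>F. w A) 0 = (if F = {} then 1 else 0)"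
    proof (cases "F = {}")
      case False
      then obtain A where "A \<in> F" by blast
      then have "\<exists>A\<in>F. fps_nth (w A) 0 = 0" using assms(2) sub[OF F] by blast
      then show ?thesis unfolding fps_prod_nth_0[OF fF] using False prod_zero[OF fF] by simp
    qed simp
  qed
  also have "\<dots> = 1"
  proof -
    have "{} \<in> ?I" unfolding ind_families_def by blast
    then show ?thesis using finI by simp
  qed
  finally show ?thesis .
qed

lemma sum_weighted_diff:
  fixes k :: "'c \<Rightarrow> 'b::comm_ring_1"
  shows "(\<Sum>x\<in>S. k x * (f x - z * g x)) = (\<Sum>x\<in>S. k x * f x) - z * (\<Sum>x\<in>S. k x * g x)"
  by (simp add: sum_subtractf sum_distrib_left right_diff_distrib mult.left_commute)

section \<open>The recursion for zeta and the walks it counts\<close>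

context simplicial_graph
begin

text \<open>The polynomial \<open>zeta\<close> plays the role of the matching polynomial in Godsil's path-tree theorem.
The factor 2 in the weight of a hole counts the two directions in which a path can run around it.\<close>

definition objs :: "(nat \<Rightarrow> nat) set set" where
  "objs = (\<lambda>j. {j}) ` V \<union> even_holes n V"

text \<open>Exponents count steps: an extension followed by its contraction takes two, and a hole
  with m vertices takes m - 1 extensions and one lollipop step back. The signs are negative because
  \<open>zeta\<close> belongs to the denominator. Cardinality 1 identifies single vertices, as holes
  have at least four.\<close>

definition obj_weight :: "((nat \<Rightarrow> nat) \<Rightarrow> real) \<Rightarrow> ((nat \<Rightarrow> nat) set \<Rightarrow> real) \<Rightarrow> (nat \<Rightarrow> nat) set \<Rightarrow> real fps" where
  "obj_weight b c A = (if card A = 1 then - (fps_X ^ 2 * fps_const ((b (the_elem A))\<^sup>2))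
     else - (2 * fps_const (c A) * fps_X ^ card A))"

lemma card_even_hole: "C \<in> even_holes n V \<Longrightarrow> 4 \<le> card C"
proof -
  assume "C \<in> even_holes n V"
  then obtain xs where "even_hole_list n V xs" "C = set xs" unfolding even_holes_def by blast
  then show ?thesis using distinct_card[of xs] by (simp add: even_hole_list_def)
qed

lemma finite_objs: "finite objs"
proof -
  have "even_holes n V \<subseteq> Pow V" using even_holes_subset by blast
  then show ?thesis unfolding objs_def using finV by (meson finite_Pow_iff finite_UnI finite_imageI finite_subset)
qed

lemma empty_notin_objs: "{} \<notin> objs"
  using card_even_hole[of "{}"] unfolding objs_def by auto

definition zeta :: "((nat \<Rightarrow> nat) \<Rightarrow> real) \<Rightarrow> ((nat \<Rightarrow> nat) set \<Rightarrow> real) \<Rightarrow> (nat \<Rightarrow> nat) set \<Rightarrow> real fps" where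
  "zeta b c X = family_poly n objs (obj_weight b c) X"

lemma zeta_nth_0: "fps_nth (zeta b c X) 0 = 1"
  unfolding zeta_def
proof (rule family_poly_nth_0[OF finite_objs])
  fix A assume A: "A \<in> objs"
  have "card A \<noteq> 0"
  proof -
    from A consider j where "A = {j}" | "A \<in> even_holes n V" unfolding objs_def by blast
    then show ?thesis using card_even_hole[of A] by cases auto
  qed
  then show "fps_nth (obj_weight b c A) 0 = 0" unfolding obj_weight_def by (simp add: fps_X_power_mult_nth fps_mult_nth_0 power_0_left)
qed

lemma objs_meeting:
  assumes Q: "spath Q"
  defines "X \<equiv> rest (set (butlast Q))" and "L \<equiv> {v. adj n (last Q) v}"
  shows "{A\<in>objs. A \<subseteq> X \<and> A \<inter> L \<noteq> {}} = (\<lambda>j. {j}) ` {j. spath (Q @ [j])} \<union> att_holes Q"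
proof -
  have sn: "spath (Q @ [j]) \<longleftrightarrow> j \<in> X \<and> j \<in> L" for j
    using spath_snoc[OF spath_D(1)[OF Q], of j] Q unfolding X_def L_def by blast
  have XV: "X \<subseteq> V" unfolding X_def by (rule rest_subset)
  have att_holes: "att_holes Q = {C \<in> even_holes n V. C \<subseteq> X \<and> C \<inter> L \<noteq> {}}"
    unfolding att_holes_def X_def L_def by blast
  show ?thesis unfolding att_holes objs_def using sn XV by blast
qed

text \<open>A vertex of the region that is adjacent to \<open>last Q\<close> belongs to the same
  clique as \<open>x\<close>, so it is equal or adjacent to \<open>x\<close> and is excluded already
  by being away from \<open>A\<close>.\<close>

lemma away_eq:
  assumes Q: "spath Q" and A: "A \<subseteq> rest (set (butlast Q))" "x \<in> A" "adj n (last Q) x"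
  shows "away n (rest (set (butlast Q))) A = rest (set Q \<union> A)"
proof -
  let ?X = "rest (set (butlast Q))"
  have Qs: "set Q = insert (last Q) (set (butlast Q))" by (rule set_eq_insert_last[OF spath_D(1)[OF Q]])
  have "v \<noteq> last Q \<and> \<not> adj n (last Q) v" if v: "v \<in> away n ?X A" for v
  proof -
    have vX: "v \<in> ?X" "v \<notin> A" "\<forall>x\<in>A. \<not> adj n x v" using v unfolding away_def by blast+
    have "x \<noteq> v" using vX A(2) by blast
    then have "\<not> adj n (last Q) v" using last_clique[OF Q _ vX(1) A(3)] A(1,2) vX(3) by blast
    then show ?thesis using last_notin_rest[OF Q] vX(1) by blast
  qed
  then have "away n ?X A \<subseteq> rest (set Q \<union> A)" unfolding Qs unfolding away_def rest_def by blast
  moreover have "rest (set Q \<union> A) \<subseteq> away n ?X A" unfolding Qs unfolding away_def rest_def by blast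
  ultimately show ?thesis by blast
qed

text \<open>The family recursion with \<open>L\<close> the neighbourhood of \<open>last Q\<close>:
  by \<open>last_clique\<close> all objects meeting it touch, and they are exactly the one-vertex
  extensions of \<open>Q\<close> and the even holes attached to it.\<close>

lemma zeta_rec:
  assumes Q: "spath Q"
  shows "zeta b c (rest (set (butlast Q))) = zeta b c (rest (set Q))
    - (\<Sum>j | spath (Q @ [j]). fps_X ^ 2 * fps_const ((b j)\<^sup>2) * zeta b c (rest (set (Q @ [j]))))
    - 2 * (\<Sum>C\<in>att_holes Q. fps_const (c C) * fps_X ^ card C * zeta b c (rest (set Q \<union> C)))"
proof -
  let ?X = "rest (set (butlast Q))" and ?L = "{v. adj n (last Q) v}"
  have "zeta b c ?X = zeta b c (?X - ?L)
     + (\<Sum>A\<in>{A\<in>objs. A \<subseteq> ?X \<and> A \<inter> ?L \<noteq> {}}. obj_weight b c A * zeta b c (away n ?X A))"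
    unfolding zeta_def
  proof (rule family_poly_rec[OF finite_objs empty_notin_objs])
    fix A B assume AB: "A \<subseteq> ?X" "B \<subseteq> ?X" "A \<inter> ?L \<noteq> {}" "B \<inter> ?L \<noteq> {}"
    then obtain x y where xy: "x \<in> A" "adj n (last Q) x" "y \<in> B" "adj n (last Q) y" by blast
    show "touch n A B"
    proof (cases "x = y")
      case True then show ?thesis using xy unfolding touch_def by blast
    next
      case False
      then have "adj n x y" using last_clique[OF Q, of x y] xy AB(1,2) by blast
      then show ?thesis using xy unfolding touch_def by blast
    qed
  qed
  also have "?X - ?L = rest (set Q)" using rest_step[OF Q] by simp
  also have "(\<Sum>A\<in>{A\<in>objs. A \<subseteq> ?X \<and> A \<inter> ?L \<noteq> {}}. obj_weight b c A * zeta b c (away n ?X A))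
    = (\<Sum>A\<in>{A\<in>objs. A \<subseteq> ?X \<and> A \<inter> ?L \<noteq> {}}. obj_weight b c A * zeta b c (rest (set Q \<union> A)))"
  proof (rule sum.cong[OF refl])
    fix A assume "A \<in> {A\<in>objs. A \<subseteq> ?X \<and> A \<inter> ?L \<noteq> {}}"
    then obtain x where "A \<subseteq> ?X" "x \<in> A" "adj n (last Q) x" by blast
    then show "obj_weight b c A * zeta b c (away n ?X A) = obj_weight b c A * zeta b c (rest (set Q \<union> A))"
      using away_eq[OF Q, of A x] by simp
  qed
  also have "\<dots> = (\<Sum>A\<in>(\<lambda>j. {j}) ` {j. spath (Q @ [j])}. obj_weight b c A * zeta b c (rest (set Q \<union> A)))
      + (\<Sum>A\<in>att_holes Q. obj_weight b c A * zeta b c (rest (set Q \<union> A)))"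
    unfolding objs_meeting[OF Q]
  proof (rule sum.union_disjoint)
    have "{j. spath (Q @ [j])} \<subseteq> insert s V" using spath_D(4) by fastforce
    then show "finite ((\<lambda>j. {j}) ` {j. spath (Q @ [j])})" using finV by (meson finite_imageI finite_insert finite_subset)
    show "finite (att_holes Q)" by (rule finite_att_holes)
    have "C \<noteq> {j}" if "C \<in> att_holes Q" for C j using card_even_hole[of C] that unfolding att_holes_def by auto
    then show "(\<lambda>j. {j}) ` {j. spath (Q @ [j])} \<inter> att_holes Q = {}" by blast
  qed
  also have "(\<Sum>A\<in>(\<lambda>j. {j}) ` {j. spath (Q @ [j])}. obj_weight b c A * zeta b c (rest (set Q \<union> A)))
     = - (\<Sum>j | spath (Q @ [j]). fps_X ^ 2 * fps_const ((b j)\<^sup>2) * zeta b c (rest (set (Q @ [j]))))"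
    by (subst sum.reindex) (simp_all add: obj_weight_def sum_negf)
  also have "(\<Sum>A\<in>att_holes Q. obj_weight b c A * zeta b c (rest (set Q \<union> A)))
     = - (2 * (\<Sum>C\<in>att_holes Q. fps_const (c C) * fps_X ^ card C * zeta b c (rest (set Q \<union> C))))"
  proof -
    have "card C \<noteq> 1" if "C \<in> att_holes Q" for C using card_even_hole[of C] that unfolding att_holes_def by auto
    then have "(\<Sum>A\<in>att_holes Q. obj_weight b c A * zeta b c (rest (set Q \<union> A)))
       = (\<Sum>C\<in>att_holes Q. - (2 * (fps_const (c C) * fps_X ^ card C * zeta b c (rest (set Q \<union> C)))))"
      by (intro sum.cong[OF refl]) (simp add: obj_weight_def mult.assoc)
    then show ?thesis by (simp add: sum_negf sum_distrib_left)
  qed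
  finally show ?thesis by (simp add: algebra_simps)
qed

definition fps_step :: "((nat \<Rightarrow> nat) \<Rightarrow> real) \<Rightarrow> ((nat \<Rightarrow> nat) set \<Rightarrow> real) \<Rightarrow>
    ((nat \<Rightarrow> nat) list \<Rightarrow> real fps) \<Rightarrow> (nat \<Rightarrow> nat) list \<Rightarrow> real fps" where
  "fps_step b c f Q = (if 2 \<le> length Q then f (butlast Q) else 0)
     + (\<Sum>j | spath (Q @ [j]). fps_const ((b j)\<^sup>2) * f (Q @ [j]))
     + (\<Sum>ys | att Q ys \<and> even (length ys). fps_const (c (set ys)) * f (Q @ butlast ys))"

lemma fps_step_nth: "fps_nth (fps_step b c f Q) k = path_step b c (\<lambda>P. fps_nth (f P) k) Q"
  unfolding fps_step_def path_step_def by (simp add: fps_sum_nth)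

lemma fps_step_diff: "fps_step b c (\<lambda>P. f P - z * g P) Q = fps_step b c f Q - z * fps_step b c g Q"
proof -
  have gen: "(u - z * v) + (A - z * B) + (C - z * D) = (u + A + C) - z * (v + B + D)" for u v A B C D :: "real fps"
    by (simp add: algebra_simps)
  have "(if 2 \<le> length Q then f (butlast Q) - z * g (butlast Q) else 0)
     = (if 2 \<le> length Q then f (butlast Q) else 0) - z * (if 2 \<le> length Q then g (butlast Q) else 0)" by simp
  then show ?thesis unfolding fps_step_def sum_weighted_diff by (simp only: gen)
qed

definition walk_num :: "((nat \<Rightarrow> nat) \<Rightarrow> real) \<Rightarrow> ((nat \<Rightarrow> nat) set \<Rightarrow> real) \<Rightarrow> (nat \<Rightarrow> nat) list \<Rightarrow> real fps" where
  "walk_num b c Q = fps_X ^ (length Q - 1) * zeta b c (rest (set Q))"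

text \<open>This is \<open>zeta_rec\<close> multiplied by a power of X and solved for
  \<open>zeta\<close> of \<open>rest (set Q)\<close>, so that each summand becomes the numerator of
  a path one step away.\<close>

lemma walk_num_eq:
  assumes Q: "spath Q"
  shows "walk_num b c Q = (if Q = [s] then zeta b c V else 0) + fps_X * fps_step b c (walk_num b c) Q"
proof -
  define m where "m = length Q - 1"
  have len: "length Q = Suc m" using spath_D(1)[OF Q] unfolding m_def by (cases Q) simp_all
  \<comment> \<open>For the path consisting of \<open>s\<close> alone the shortened path is empty
    and \<open>rest {} = V\<close>, which gives the source term.\<close>
  have A: "fps_X ^ m * zeta b c (rest (set (butlast Q)))
    = (if Q = [s] then zeta b c V else 0) + fps_X * (if 2 \<le> length Q then walk_num b c (butlast Q) else 0)"
  proof (cases m)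
    case 0
    then have "Q = [s]" using len spath_D(2)[OF Q] by (cases Q) simp_all
    moreover have "rest {} = V" unfolding rest_def by simp
    ultimately show ?thesis using 0 len by simp
  next
    case (Suc m')
    then have "Q \<noteq> [s]" using len by auto
    then show ?thesis using Suc len by (simp add: walk_num_def)
  qed
  have B: "fps_X * (\<Sum>j | spath (Q @ [j]). fps_const ((b j)\<^sup>2) * walk_num b c (Q @ [j]))
    = fps_X ^ m * (\<Sum>j | spath (Q @ [j]). fps_X ^ 2 * fps_const ((b j)\<^sup>2) * zeta b c (rest (set (Q @ [j]))))"
    unfolding sum_distrib_left
    by (rule sum.cong[OF refl]) (simp add: walk_num_def len power2_eq_square mult_ac)
  have C: "fps_X * (\<Sum>ys | att Q ys \<and> even (length ys). fps_const (c (set ys)) * walk_num b c (Q @ butlast ys))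
    = fps_X ^ m * (2 * (\<Sum>C\<in>att_holes Q. fps_const (c C) * fps_X ^ card C * zeta b c (rest (set Q \<union> C))))"
  proof -
    have "fps_X * (\<Sum>ys | att Q ys \<and> even (length ys). fps_const (c (set ys)) * walk_num b c (Q @ butlast ys))
      = (\<Sum>ys | att Q ys \<and> even (length ys). fps_X ^ m * (fps_const (c (set ys)) * fps_X ^ card (set ys) * zeta b c (rest (set Q \<union> set ys))))"
      unfolding sum_distrib_left
    proof (rule sum.cong[OF refl])
      fix ys assume "ys \<in> {ys. att Q ys \<and> even (length ys)}"
      then have a: "att Q ys" by blast
      \<comment> \<open>The opened hole adds \<open>l\<close> vertices to the path; the factor
        \<open>fps_X\<close> in front accounts for the remaining one.\<close>
      obtain l where l: "length ys = Suc l" using att_D(6)[OF a] by (cases ys) simp_all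
      have cs: "card (set ys) = Suc l" using att_D(4)[OF a] l by (simp add: distinct_card)
      have "walk_num b c (Q @ butlast ys) = fps_X ^ (m + l) * zeta b c (rest (set Q \<union> set ys))"
        unfolding walk_num_def rest_att[OF a] by (simp add: len l)
      then show "fps_X * (fps_const (c (set ys)) * walk_num b c (Q @ butlast ys))
         = fps_X ^ m * (fps_const (c (set ys)) * fps_X ^ card (set ys) * zeta b c (rest (set Q \<union> set ys)))"
        unfolding cs by (simp add: power_add mult_ac)
    qed
    also have "\<dots> = 2 * (\<Sum>C\<in>att_holes Q. fps_X ^ m * (fps_const (c C) * fps_X ^ card C * zeta b c (rest (set Q \<union> C))))"
      by (rule sum_att_even[OF Q])
    finally show ?thesis by (simp add: sum_distrib_left mult_ac)
  qed
  have "walk_num b c Q = fps_X ^ m * zeta b c (rest (set Q))" unfolding walk_num_def m_def ..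
  also have "zeta b c (rest (set Q)) = zeta b c (rest (set (butlast Q)))
    + (\<Sum>j | spath (Q @ [j]). fps_X ^ 2 * fps_const ((b j)\<^sup>2) * zeta b c (rest (set (Q @ [j]))))
    + 2 * (\<Sum>C\<in>att_holes Q. fps_const (c C) * fps_X ^ card C * zeta b c (rest (set Q \<union> C)))"
    using zeta_rec[OF Q, of b c] by (simp add: algebra_simps)
  finally show ?thesis
    unfolding fps_step_def distrib_left A[symmetric] B[symmetric] C[symmetric]
    unfolding A by (simp add: add.assoc)
qed

fun walk :: "((nat \<Rightarrow> nat) \<Rightarrow> real) \<Rightarrow> ((nat \<Rightarrow> nat) set \<Rightarrow> real) \<Rightarrow> nat \<Rightarrow> (nat \<Rightarrow> nat) list \<Rightarrow> real" where
  "walk b c 0 = (\<lambda>Q. if Q = [s] then 1 else 0)"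
| "walk b c (Suc k) = path_step b c (walk b c k)"

text \<open>Both sides solve the same equation with source \<open>zeta b c V\<close> at the path
  \<open>[s]\<close>. Their difference is X times its own image under \<open>fps_step\<close>, so
  each coefficient is determined by the preceding ones and all vanish.\<close>

lemma walk_gf:
  assumes "spath Q"
  shows "walk_num b c Q = zeta b c V * Abs_fps (\<lambda>k. walk b c k Q)"
proof -
  define F where "F Q = Abs_fps (\<lambda>k. walk b c k Q)" for Q
  have F: "F Q = (if Q = [s] then 1 else 0) + fps_X * fps_step b c F Q" for Q
  proof (rule fps_ext)
    fix k
    show "fps_nth (F Q) k = fps_nth ((if Q = [s] then 1 else 0) + fps_X * fps_step b c F Q) k"
    proof (cases k)
      case (Suc k')
      have "(\<lambda>P. fps_nth (F P) k') = walk b c k'" unfolding F_def by simp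
      then show ?thesis using Suc by (simp add: F_def fps_step_nth fps_X_mult_nth[abs_def] del: walk.simps(1))
    qed (simp add: F_def)
  qed
  define D where "D Q = walk_num b c Q - zeta b c V * F Q" for Q
  have D: "D Q = fps_X * fps_step b c D Q" if "spath Q" for Q
  proof -
    have "D Q = walk_num b c Q - zeta b c V * F Q" unfolding D_def ..
    also have "\<dots> = fps_X * fps_step b c (walk_num b c) Q - zeta b c V * (fps_X * fps_step b c F Q)"
      unfolding walk_num_eq[OF that] by (subst F) (simp add: algebra_simps)
    also have "\<dots> = fps_X * fps_step b c D Q"
      unfolding D_def fps_step_diff by (simp add: algebra_simps)
    finally show ?thesis .
  qed
  have "\<forall>Q. spath Q \<longrightarrow> fps_nth (D Q) k = 0" for k
  proof (induction k)
    case 0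
    show ?case
    proof (intro allI impI)
      fix Q assume "spath Q"
      then have "fps_nth (D Q) 0 = fps_nth (fps_X * fps_step b c D Q) 0" using D by simp
      then show "fps_nth (D Q) 0 = 0" by simp
    qed
  next
    case (Suc k)
    show ?case
    proof (intro allI impI)
      fix Q assume Q: "spath Q"
      have "fps_nth (D Q) (Suc k) = fps_nth (fps_X * fps_step b c D Q) (Suc k)" using D[OF Q] by simp
      also have "\<dots> = path_step b c (\<lambda>P. fps_nth (D P) k) Q" by (simp add: fps_step_nth)
      also have "\<dots> = 0"
        unfolding path_step_def using Suc spath_butlast[OF Q] att_spath by simp
      finally show "fps_nth (D Q) (Suc k) = 0" .
    qed
  qed
  then have "D Q = 0" using assms by (intro fps_ext) simp
  then show ?thesis unfolding D_def F_def by simp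
qed

text \<open>The numerator depends only on the length and on \<open>rest\<close>, and the common
  factor \<open>zeta b c V\<close> has constant term 1, so it can be cancelled.\<close>

theorem walk_nbhd_invariant: "nbhd_invariant (walk b c k)"
  unfolding nbhd_invariant_def
proof (intro allI impI)
  fix P P' assume P: "spath P" "spath P'" "length P = length P'" "rest (set P) = rest (set P')"
  have "walk_num b c P = walk_num b c P'" unfolding walk_num_def using P(3,4) by simp
  then have "zeta b c V * Abs_fps (\<lambda>k. walk b c k P) = zeta b c V * Abs_fps (\<lambda>k. walk b c k P')"
    using walk_gf[OF P(1)] walk_gf[OF P(2)] by simp
  moreover have "zeta b c V \<noteq> 0" using zeta_nth_0[of b c V] by auto
  ultimately have "Abs_fps (\<lambda>k. walk b c k P) = Abs_fps (\<lambda>k. walk b c k P')" by simp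
  then have "fps_nth (Abs_fps (\<lambda>k. walk b c k P)) k = fps_nth (Abs_fps (\<lambda>k. walk b c k P')) k" by simp
  then show "walk b c k P = walk b c k P'" by simp
qed

end

section \<open>Matrix words and joint eigenprojectors\<close>

lemma msum_carrier [simp]: "msum N f S \<in> carrier_mat N N"
  by (simp add: msum_def)

lemma msum_entry: "r < N \<Longrightarrow> c < N \<Longrightarrow> msum N f S $$ (r, c) = (\<Sum>x\<in>S. f x $$ (r, c))"
  by (simp add: msum_def)

lemma mult_entry:
  assumes "A \<in> carrier_mat N N" "B \<in> carrier_mat N N" "r < N" "c < N"
  shows "(A * B) $$ (r, c) = (\<Sum>k<N. A $$ (r, k) * B $$ (k, c))"
  using assms by (simp add: scalar_prod_def lessThan_atLeast0)

lemma mult_msum_entry: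
  fixes M :: "complex mat"
  assumes "M \<in> carrier_mat N N" "\<And>x. x \<in> S \<Longrightarrow> f x \<in> carrier_mat N N" "r < N" "c < N"
  shows "(M * msum N f S) $$ (r, c) = (\<Sum>x\<in>S. (M * f x) $$ (r, c))"
proof -
  have "(M * msum N f S) $$ (r, c) = (\<Sum>k<N. \<Sum>x\<in>S. M $$ (r, k) * f x $$ (k, c))"
    unfolding mult_entry[OF assms(1) msum_carrier assms(3,4)]
    by (rule sum.cong[OF refl]) (simp add: msum_entry assms(4) sum_distrib_left)
  also have "\<dots> = (\<Sum>x\<in>S. \<Sum>k<N. M $$ (r, k) * f x $$ (k, c))" by (rule sum.swap)
  also have "\<dots> = (\<Sum>x\<in>S. (M * f x) $$ (r, c))"
    by (rule sum.cong[OF refl]) (simp only: mult_entry[OF assms(1) assms(2) assms(3,4)])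
  finally show ?thesis .
qed

lemma msum_mult_entry:
  fixes M :: "complex mat"
  assumes "M \<in> carrier_mat N N" "\<And>x. x \<in> S \<Longrightarrow> f x \<in> carrier_mat N N" "r < N" "c < N"
  shows "(msum N f S * M) $$ (r, c) = (\<Sum>x\<in>S. (f x * M) $$ (r, c))"
proof -
  have "(msum N f S * M) $$ (r, c) = (\<Sum>k<N. \<Sum>x\<in>S. f x $$ (r, k) * M $$ (k, c))"
    unfolding mult_entry[OF msum_carrier assms(1) assms(3,4)]
    by (rule sum.cong[OF refl]) (simp add: msum_entry assms(3) sum_distrib_right)
  also have "\<dots> = (\<Sum>x\<in>S. \<Sum>k<N. f x $$ (r, k) * M $$ (k, c))" by (rule sum.swap)
  also have "\<dots> = (\<Sum>x\<in>S. (f x * M) $$ (r, c))"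
    by (rule sum.cong[OF refl]) (simp only: mult_entry[OF assms(2) assms(1) assms(3,4)])
  finally show ?thesis .
qed

section \<open>Adjoints and joint eigenprojectors\<close>

definition dagger :: "complex mat \<Rightarrow> complex mat" where
  "dagger A = mat (dim_col A) (dim_row A) (\<lambda>(r, c). cnj (A $$ (c, r)))"

lemma dagger_carrier [simp]: "A \<in> carrier_mat N M \<Longrightarrow> dagger A \<in> carrier_mat M N"
  by (auto simp: dagger_def)

lemma dagger_mult:
  assumes "A \<in> carrier_mat N N" "B \<in> carrier_mat N N"
  shows "dagger (A * B) = dagger B * dagger A"
proof (rule eq_matI)
  fix r c assume "r < dim_row (dagger B * dagger A)" "c < dim_col (dagger B * dagger A)"
  then have rc: "r < N" "c < N" using assms by (simp_all add: dagger_def)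
  have "dagger (A * B) $$ (r, c) = cnj ((A * B) $$ (c, r))" using rc assms by (simp add: dagger_def)
  also have "\<dots> = (\<Sum>k<N. cnj (A $$ (c, k)) * cnj (B $$ (k, r)))"
    unfolding mult_entry[OF assms rc(2,1)] by simp
  also have "\<dots> = (\<Sum>k<N. dagger B $$ (r, k) * dagger A $$ (k, c))"
    by (rule sum.cong[OF refl]) (use rc assms in \<open>simp add: dagger_def mult.commute\<close>)
  also have "\<dots> = (dagger B * dagger A) $$ (r, c)"
    by (rule mult_entry[symmetric]) (use assms rc in simp_all)
  finally show "dagger (A * B) $$ (r, c) = (dagger B * dagger A) $$ (r, c)" .
qed (use assms in \<open>simp_all add: dagger_def\<close>)

lemma dagger_smult: "dagger (k \<cdot>\<^sub>m A) = cnj k \<cdot>\<^sub>m dagger A"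
  by (rule eq_matI) (auto simp: dagger_def)

lemma hermitian_iff:
  assumes "A \<in> carrier_mat N N"
  shows "dagger A = A \<longleftrightarrow> (\<forall>r<N. \<forall>c<N. A $$ (r, c) = cnj (A $$ (c, r)))"
proof
  assume a: "dagger A = A"
  show "\<forall>r<N. \<forall>c<N. A $$ (r, c) = cnj (A $$ (c, r))"
  proof (intro allI impI)
    fix r c assume "r < N" "c < N"
    then have "dagger A $$ (r, c) = cnj (A $$ (c, r))" using assms by (simp add: dagger_def)
    then show "A $$ (r, c) = cnj (A $$ (c, r))" using a by simp
  qed
next
  assume a: "\<forall>r<N. \<forall>c<N. A $$ (r, c) = cnj (A $$ (c, r))"
  show "dagger A = A"
  proof (rule eq_matI)
    fix r c assume "r < dim_row A" "c < dim_col A"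
    then have rc: "r < N" "c < N" using assms by simp_all
    then have "dagger A $$ (r, c) = cnj (A $$ (c, r))" using assms by (simp add: dagger_def)
    then show "dagger A $$ (r, c) = A $$ (r, c)" using a rc by metis
  qed (use assms in \<open>simp_all add: dagger_def\<close>)
qed

text \<open>An operator commuting with the symmetries maps each joint eigenspace into itself, which
  gives \<open>Pr * (H * Pr) = H * Pr\<close>. As \<open>H\<close> and \<open>Pr\<close> are
  Hermitian, the adjoint of this identity gives \<open>Pr * H * Pr = Pr * H\<close>.\<close>

lemma joint_eigenprojector_commute:
  assumes P: "joint_eigenprojector N Ss Pr"
    and S: "\<And>S. S \<in> Ss \<Longrightarrow> S \<in> carrier_mat N N"
    and H: "H \<in> carrier_mat N N" "dagger H = H" "\<And>S. S \<in> Ss \<Longrightarrow> S * H = H * S"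
  shows "Pr * H = H * Pr"
proof -
  have Pc: "Pr \<in> carrier_mat N N" and PP: "Pr * Pr = Pr" and Pd: "dagger Pr = Pr"
    using P hermitian_iff unfolding joint_eigenprojector_def by blast+
  obtain ev where ev: "\<And>v. v \<in> carrier_vec N \<Longrightarrow> Pr *\<^sub>v v = v \<longleftrightarrow> (\<forall>S\<in>Ss. S *\<^sub>v v = ev S \<cdot>\<^sub>v v)"
    using P unfolding joint_eigenprojector_def by blast
  have "Pr * (H * Pr) = H * Pr"
  proof (rule mat_col_eqI)
    fix c assume "c < dim_col (H * Pr)"
    then have c: "c < N" using Pc by simp
    define v where "v = col Pr c"
    have v: "v \<in> carrier_vec N" unfolding v_def using Pc c by simp
    have "Pr *\<^sub>v v = col (Pr * Pr) c" unfolding v_def by (rule col_mult2[OF Pc Pc c, symmetric])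
    then have "Pr *\<^sub>v v = v" unfolding PP v_def .
    then have Sv: "S *\<^sub>v v = ev S \<cdot>\<^sub>v v" if "S \<in> Ss" for S using ev[OF v] that by blast
    have Hv: "H *\<^sub>v v \<in> carrier_vec N" using H(1) v by simp
    have "S *\<^sub>v (H *\<^sub>v v) = ev S \<cdot>\<^sub>v (H *\<^sub>v v)" if "S \<in> Ss" for S
    proof -
      have "S *\<^sub>v (H *\<^sub>v v) = (S * H) *\<^sub>v v" using assoc_mult_mat_vec[OF S[OF that] H(1) v] by simp
      also have "\<dots> = H *\<^sub>v (S *\<^sub>v v)" unfolding H(3)[OF that] by (rule assoc_mult_mat_vec[OF H(1) S[OF that] v])
      also have "\<dots> = ev S \<cdot>\<^sub>v (H *\<^sub>v v)" unfolding Sv[OF that] using H(1) v by (simp add: mult_mat_vec)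
      finally show ?thesis .
    qed
    then have "Pr *\<^sub>v (H *\<^sub>v v) = H *\<^sub>v v" using ev[OF Hv] by blast
    moreover have "col (H * Pr) c = H *\<^sub>v v" unfolding v_def by (rule col_mult2[OF H(1) Pc c])
    moreover have "col (Pr * (H * Pr)) c = Pr *\<^sub>v col (H * Pr) c"
      by (rule col_mult2[OF Pc _ c]) (use H(1) Pc in simp)
    ultimately show "col (Pr * (H * Pr)) c = col (H * Pr) c" by simp
  qed (use H(1) Pc in simp_all)
  then have 1: "Pr * (H * Pr) = H * Pr" .
  have "dagger (Pr * (H * Pr)) = Pr * H * Pr"
    using Pc H(1,2) Pd by (simp add: dagger_mult[of _ N])
  moreover have "dagger (H * Pr) = Pr * H" using Pc H(1,2) Pd by (simp add: dagger_mult[of _ N])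
  ultimately have "Pr * H * Pr = Pr * H" using 1 by simp
  then show ?thesis using 1 assoc_mult_mat[OF Pc H(1) Pc] by simp
qed

text \<open>The eigenvalue acts on the left of \<open>Pr\<close>, its conjugate on the right;
  comparing the two through \<open>Pr * S * Pr\<close> shows that it is real because
  \<open>Pr\<close> is nonzero. Reality is needed for a real matrix.\<close>

lemma joint_eigenprojector_eigenvalue:
  assumes P: "joint_eigenprojector N Ss Pr"
    and S: "S \<in> Ss" "S \<in> carrier_mat N N" "dagger S = S"
  obtains x where "Pr * S = complex_of_real x \<cdot>\<^sub>m Pr"
proof -
  have Pc: "Pr \<in> carrier_mat N N" and PP: "Pr * Pr = Pr" and Pd: "dagger Pr = Pr" and P0: "Pr \<noteq> 0\<^sub>m N N"
    using P hermitian_iff unfolding joint_eigenprojector_def by blast+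
  obtain ev where ev: "\<And>v. v \<in> carrier_vec N \<Longrightarrow> Pr *\<^sub>v v = v \<longleftrightarrow> (\<forall>S\<in>Ss. S *\<^sub>v v = ev S \<cdot>\<^sub>v v)"
    using P unfolding joint_eigenprojector_def by blast
  define e where "e = ev S"
  have 1: "S * Pr = e \<cdot>\<^sub>m Pr"
  proof (rule mat_col_eqI)
    fix c assume "c < dim_col (e \<cdot>\<^sub>m Pr)"
    then have c: "c < N" using Pc by simp
    define v where "v = col Pr c"
    have v: "v \<in> carrier_vec N" unfolding v_def using Pc c by simp
    have "Pr *\<^sub>v v = col (Pr * Pr) c" unfolding v_def by (rule col_mult2[OF Pc Pc c, symmetric])
    then have "Pr *\<^sub>v v = v" unfolding PP v_def .
    then have "S *\<^sub>v v = e \<cdot>\<^sub>v v" using ev[OF v] S(1) unfolding e_def by blast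
    moreover have "col (S * Pr) c = S *\<^sub>v v" unfolding v_def by (rule col_mult2[OF S(2) Pc c])
    moreover have "col (e \<cdot>\<^sub>m Pr) c = e \<cdot>\<^sub>v v" unfolding v_def using Pc c by simp
    ultimately show "col (S * Pr) c = col (e \<cdot>\<^sub>m Pr) c" by simp
  qed (use S(2) Pc in simp_all)
  have 2: "Pr * S = cnj e \<cdot>\<^sub>m Pr"
  proof -
    have "dagger (S * Pr) = Pr * S" using dagger_mult[OF S(2) Pc] Pd S(3) by simp
    then show ?thesis unfolding 1 dagger_smult Pd by simp
  qed
  have "e \<cdot>\<^sub>m Pr = cnj e \<cdot>\<^sub>m Pr"
  proof -
    have "e \<cdot>\<^sub>m Pr = Pr * (S * Pr)" unfolding 1 using mult_smult_distrib[OF Pc Pc] PP by simp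
    also have "\<dots> = (Pr * S) * Pr" using assoc_mult_mat[OF Pc S(2) Pc] by simp
    also have "\<dots> = cnj e \<cdot>\<^sub>m Pr" unfolding 2 using mult_smult_assoc_mat[OF Pc Pc] PP by simp
    finally show ?thesis .
  qed
  moreover obtain r c where rc: "r < N" "c < N" "Pr $$ (r, c) \<noteq> 0"
  proof -
    have "\<exists>r c. r < N \<and> c < N \<and> Pr $$ (r, c) \<noteq> 0"
    proof (rule ccontr)
      assume "\<not> ?thesis"
      then have "Pr = 0\<^sub>m N N" using Pc by (intro eq_matI) auto
      then show False using P0 by blast
    qed
    then show ?thesis using that by blast
  qed
  ultimately have "(e \<cdot>\<^sub>m Pr) $$ (r, c) = (cnj e \<cdot>\<^sub>m Pr) $$ (r, c)" by simp
  then have "e = cnj e" using rc Pc by simp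
  then have "complex_of_real (Re e) = e" by (metis complex_cnj_cancel_iff complex_eq_iff complex.sel Im_complex_of_real Re_complex_of_real cnj.sel(2) equal_neg_zero)
  then show ?thesis using that[of "Re e"] 2 \<open>e = cnj e\<close> by simp
qed

section \<open>Products of Pauli terms as words\<close>

text \<open>The coefficients are a parameter so that the simplicial mode can enter as one more term,
  with coefficient 1.\<close>

definition hterm :: "nat \<Rightarrow> ((nat \<Rightarrow> nat) \<Rightarrow> real) \<Rightarrow> (nat \<Rightarrow> nat) \<Rightarrow> complex mat" where
  "hterm n \<beta> j = complex_of_real (\<beta> j) \<cdot>\<^sub>m sigma n j"

lemma hterm_carrier [simp]: "hterm n \<beta> j \<in> carrier_mat (2^n) (2^n)"
  by (simp add: hterm_def)

lemma dagger_hterm: "dagger (hterm n \<beta> j) = hterm n \<beta> j"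
proof -
  have "dagger (sigma n j) = sigma n j"
    unfolding hermitian_iff[OF sigma_carrier] using sigma_hermitian by blast
  then show ?thesis unfolding hterm_def dagger_smult by simp
qed

lemma hterm_mult: "hterm n \<beta> j * hterm n \<beta> k = complex_of_real (\<beta> j * \<beta> k) \<cdot>\<^sub>m (sigma n j * sigma n k)"
proof -
  have c: "complex_of_real (\<beta> k) \<cdot>\<^sub>m sigma n k \<in> carrier_mat (2^n) (2^n)" by simp
  show ?thesis unfolding hterm_def mult_smult_assoc_mat[OF sigma_carrier c] mult_smult_distrib[OF sigma_carrier sigma_carrier]
    by (rule eq_matI) (auto simp: mult.assoc)
qed

lemma hterm_square: "hterm n \<beta> j * hterm n \<beta> j = complex_of_real ((\<beta> j)\<^sup>2) \<cdot>\<^sub>m 1\<^sub>m (2^n)"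
  unfolding hterm_mult sigma_square by (simp add: power2_eq_square)

lemma hterm_swap: "hterm n \<beta> j * hterm n \<beta> k = (if adj n j k then -1 else 1) \<cdot>\<^sub>m (hterm n \<beta> k * hterm n \<beta> j)"
proof -
  have "sigma n j * sigma n k = (if adj n j k then -1 else 1) \<cdot>\<^sub>m (sigma n k * sigma n j)"
  proof (cases "adj n j k")
    case True
    then have "sigma n j * sigma n k = - (sigma n k * sigma n j)" by (simp add: adj_def anticommute_def)
    also have "\<dots> = -1 \<cdot>\<^sub>m (sigma n k * sigma n j)" by (rule eq_matI) auto
    finally show ?thesis using True by simp
  next
    case False
    then have "sigma n j * sigma n k = sigma n k * sigma n j"
      using sigma_commute_or_anticommute[of n j k] by (simp add: adj_def)
    moreover have "1 \<cdot>\<^sub>m (sigma n k * sigma n j) = sigma n k * sigma n j" by (rule eq_matI) auto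
    ultimately show ?thesis using False by simp
  qed
  then show ?thesis unfolding hterm_mult
    by (intro eq_matI) (auto simp: mult.commute)
qed

definition word :: "nat \<Rightarrow> ((nat \<Rightarrow> nat) \<Rightarrow> real) \<Rightarrow> (nat \<Rightarrow> nat) list \<Rightarrow> complex mat" where
  "word n \<beta> xs = mprod_list (2^n) (map (hterm n \<beta>) xs)"

lemma word_Nil [simp]: "word n \<beta> [] = 1\<^sub>m (2^n)"
  by (simp add: word_def mprod_list_def)

lemma word_Cons: "word n \<beta> (x # xs) = hterm n \<beta> x * word n \<beta> xs"
  by (simp add: word_def mprod_list_def)

lemma word_carrier [simp]: "word n \<beta> xs \<in> carrier_mat (2^n) (2^n)"
proof (induction xs)
  case (Cons x xs)
  then show ?case unfolding word_Cons by (rule mult_carrier_mat[OF hterm_carrier])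
qed simp

lemma word_append: "word n \<beta> (xs @ ys) = word n \<beta> xs * word n \<beta> ys"
proof (induction xs)
  case Nil show ?case using left_mult_one_mat[OF word_carrier] by simp
next
  case (Cons x xs)
  then show ?case by (simp add: word_Cons assoc_mult_mat[OF hterm_carrier word_carrier word_carrier])
qed

lemma word_single: "word n \<beta> [x] = hterm n \<beta> x"
  unfolding word_Cons word_Nil by (rule right_mult_one_mat[OF hterm_carrier])

lemma word_swap:
  "word n \<beta> (xs @ [a, c] @ ys) = (if adj n a c then -1 else 1) \<cdot>\<^sub>m word n \<beta> (xs @ [c, a] @ ys)"
proof -
  let ?e = "if adj n a c then -1 else 1 :: complex"
  have two: "word n \<beta> [a, c] = hterm n \<beta> a * hterm n \<beta> c" for a c by (simp only: word_Cons[of _ _ a] word_single)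
  have "word n \<beta> [a, c] = ?e \<cdot>\<^sub>m word n \<beta> [c, a]" unfolding two by (rule hterm_swap)
  then have "word n \<beta> (xs @ [a, c] @ ys) = word n \<beta> xs * ((?e \<cdot>\<^sub>m word n \<beta> [c, a]) * word n \<beta> ys)"
    unfolding word_append[of n \<beta> xs] word_append[of n \<beta> "[a, c]"] by simp
  also have "(?e \<cdot>\<^sub>m word n \<beta> [c, a]) * word n \<beta> ys = ?e \<cdot>\<^sub>m (word n \<beta> [c, a] * word n \<beta> ys)"
    by (rule mult_smult_assoc_mat[OF word_carrier word_carrier])
  also have "\<dots> = ?e \<cdot>\<^sub>m word n \<beta> ([c, a] @ ys)" unfolding word_append ..
  also have "word n \<beta> xs * (?e \<cdot>\<^sub>m word n \<beta> ([c, a] @ ys)) = ?e \<cdot>\<^sub>m (word n \<beta> xs * word n \<beta> ([c, a] @ ys))"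
    by (rule mult_smult_distrib[OF word_carrier word_carrier])
  also have "word n \<beta> xs * word n \<beta> ([c, a] @ ys) = word n \<beta> (xs @ [c, a] @ ys)" by (rule word_append[symmetric])
  finally show ?thesis .
qed

lemma word_square: "word n \<beta> (xs @ [j, j]) = complex_of_real ((\<beta> j)\<^sup>2) \<cdot>\<^sub>m word n \<beta> xs"
proof -
  have "word n \<beta> [j, j] = complex_of_real ((\<beta> j)\<^sup>2) \<cdot>\<^sub>m 1\<^sub>m (2^n)"
    by (simp only: word_Cons[of _ _ j] word_single hterm_square)
  then have "word n \<beta> (xs @ [j, j]) = word n \<beta> xs * (complex_of_real ((\<beta> j)\<^sup>2) \<cdot>\<^sub>m 1\<^sub>m (2^n))"
    unfolding word_append by simp
  also have "\<dots> = complex_of_real ((\<beta> j)\<^sup>2) \<cdot>\<^sub>m (word n \<beta> xs * 1\<^sub>m (2^n))"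
    by (rule mult_smult_distrib[OF word_carrier one_carrier_mat])
  finally show ?thesis by (simp add: right_mult_one_mat[OF word_carrier])
qed

lemma dagger_word: "dagger (word n \<beta> xs) = word n \<beta> (rev xs)"
proof (induction xs)
  case Nil show ?case by (rule eq_matI) (auto simp: dagger_def)
next
  case (Cons x xs)
  then show ?case
    unfolding word_Cons dagger_mult[OF hterm_carrier word_carrier] dagger_hterm
    by (simp add: word_append word_single)
qed

lemma word_function_word:
  assumes "M \<in> carrier_mat (2^n) (2^n)" "r < 2^n" "c < 2^n"
  shows "word_function n (\<lambda>xs. (M * word n \<beta> xs) $$ (r, c))"
proof
  fix xs a d ys
  have "M * word n \<beta> (xs @ [a, d] @ ys) = (if adj n a d then -1 else 1) \<cdot>\<^sub>m (M * word n \<beta> (xs @ [d, a] @ ys))"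
    unfolding word_swap[of n \<beta> xs a d ys] by (rule mult_smult_distrib[OF assms(1) word_carrier])
  then show "(M * word n \<beta> (xs @ [a, d] @ ys)) $$ (r, c) =
     (if adj n a d then - (M * word n \<beta> (xs @ [d, a] @ ys)) $$ (r, c) else (M * word n \<beta> (xs @ [d, a] @ ys)) $$ (r, c))"
    using assms carrier_matD[OF word_carrier[of n \<beta>]] by simp
qed

lemma word_function_word1:
  assumes "r < 2^n" "c < 2^n"
  shows "word_function n (\<lambda>xs. word n \<beta> xs $$ (r, c))"
  using word_function_word[OF one_carrier_mat assms, of \<beta>]
  by (simp add: left_mult_one_mat[OF word_carrier])

section \<open>Cycle symmetries\<close>

definition hole_list :: "nat \<Rightarrow> (nat \<Rightarrow> nat) set \<Rightarrow> (nat \<Rightarrow> nat) set \<Rightarrow> (nat \<Rightarrow> nat) list" where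
  "hole_list n V C = (SOME xs. even_hole_list n V xs \<and> set xs = C)"

lemma hole_list:
  assumes "C \<in> even_holes n V"
  shows "even_hole_list n V (hole_list n V C)" "set (hole_list n V C) = C"
    "hole n V (hole_list n V C)" "even (length (hole_list n V C))" "length (hole_list n V C) = card C"
proof -
  obtain ys where "even_hole_list n V ys \<and> set ys = C" using assms unfolding even_holes_def by blast
  then have *: "even_hole_list n V (hole_list n V C) \<and> set (hole_list n V C) = C"
    unfolding hole_list_def by (rule someI)
  then show a: "even_hole_list n V (hole_list n V C)" "set (hole_list n V C) = C" by blast+
  then show "hole n V (hole_list n V C)" "even (length (hole_list n V C))" by (simp_all add: even_hole_list_iff)
  then have "distinct (hole_list n V C)" by (blast dest: hole_D(2))
  then show "length (hole_list n V C) = card C" using a(2) distinct_card[of "hole_list n V C"] by simp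
qed

text \<open>The sign of reordering the cyclic product of a hole into its two colour classes.\<close>

definition cycle_sign :: "(nat \<Rightarrow> nat) set \<Rightarrow> real" where
  "cycle_sign C = (-1) ^ (card C div 2 - 1)"

lemma cycle_sign_square [simp]: "cycle_sign C * cycle_sign C = 1"
  unfolding cycle_sign_def by (simp flip: power_mult_distrib)

text \<open>Colour order differs from cyclic order by the sign of \<open>even_odd_word\<close>. The
  coefficients may be changed outside \<open>V\<close>, since holes lie inside
  \<open>V\<close>.\<close>

lemma cycle_op_word:
  assumes C: "C \<in> even_holes n V" and \<beta>: "\<And>j. j \<in> V \<Longrightarrow> \<beta> j = b j"
  shows "cycle_op n V (hterm n b) C = complex_of_real (cycle_sign C) \<cdot>\<^sub>m word n \<beta> (hole_list n V C)"
proof -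
  let ?xs = "hole_list n V C"
  let ?E = "map (\<lambda>i. ?xs ! i) (filter even [0..<length ?xs])" and ?O = "map (\<lambda>i. ?xs ! i) (filter odd [0..<length ?xs])"
  have sub: "set ?xs \<subseteq> V" using hole_D(3)[OF hole_list(3)[OF C]] .
  have eq: "map (hterm n b) (map (\<lambda>i. ?xs ! i) (filter p [0..<length ?xs]))
          = map (hterm n \<beta>) (map (\<lambda>i. ?xs ! i) (filter p [0..<length ?xs]))" for p
  proof (rule map_cong[OF refl])
    fix x assume "x \<in> set (map (\<lambda>i. ?xs ! i) (filter p [0..<length ?xs]))"
    then have "x \<in> V" using sub by auto
    then show "hterm n b x = hterm n \<beta> x" unfolding hterm_def using \<beta> by simp
  qed
  have "cycle_op n V (hterm n b) C = word n \<beta> ?E * word n \<beta> ?O"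
    unfolding cycle_op_def hole_list_def[symmetric] Let_def word_def eq ..
  also have "\<dots> = word n \<beta> (?E @ ?O)" by (rule word_append[symmetric])
  also have "\<dots> = complex_of_real (cycle_sign C) \<cdot>\<^sub>m word n \<beta> ?xs"
  proof (rule eq_matI)
    fix r c assume "r < dim_row (complex_of_real (cycle_sign C) \<cdot>\<^sub>m word n \<beta> ?xs)" "c < dim_col (complex_of_real (cycle_sign C) \<cdot>\<^sub>m word n \<beta> ?xs)"
    then have rc: "r < 2^n" "c < 2^n" using carrier_matD[OF word_carrier[of n \<beta> ?xs]] by simp_all
    interpret word_function n "\<lambda>xs. word n \<beta> xs $$ (r, c)" by (rule word_function_word1[OF rc])
    have "word n \<beta> (?E @ ?O) $$ (r, c) = (-1) ^ (card C div 2 - 1) * word n \<beta> ?xs $$ (r, c)"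
      using even_odd_word[OF hole_list(1)[OF C], of "[]"] hole_list(5)[OF C] by simp
    then show "word n \<beta> (?E @ ?O) $$ (r, c) = (complex_of_real (cycle_sign C) \<cdot>\<^sub>m word n \<beta> ?xs) $$ (r, c)"
      using rc carrier_matD[OF word_carrier[of n \<beta> ?xs]] by (simp add: cycle_sign_def)
  qed (use carrier_matD[OF word_carrier[of n \<beta>]] in simp_all)
  finally show ?thesis .
qed

lemma cycle_op_carrier:
  assumes "C \<in> even_holes n V"
  shows "cycle_op n V (hterm n b) C \<in> carrier_mat (2^n) (2^n)"
  unfolding cycle_op_word[OF assms, of b b, OF refl] by simp

lemma cycle_sign_deform_closure:
  assumes "C0 \<in> even_holes n V" "C \<in> deform_closure n V C0"
  shows "cycle_sign C = cycle_sign C0"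
  using deform_closure_even_hole[OF assms] unfolding cycle_sign_def by simp

text \<open>The adjoint reverses a hole product, and reversal of an even hole costs no sign, so
  every summand is Hermitian by itself.\<close>

lemma dagger_cycle_symmetry:
  assumes C0: "C0 \<in> even_holes n V"
  shows "dagger (cycle_symmetry n V (hterm n b) C0) = cycle_symmetry n V (hterm n b) C0"
proof -
  have "cycle_symmetry n V (hterm n b) C0 $$ (r, c) = cnj (cycle_symmetry n V (hterm n b) C0 $$ (c, r))"
    if rc: "r < 2^n" "c < 2^n" for r c
  proof -
    have "cycle_op n V (hterm n b) C $$ (r, c) = cnj (cycle_op n V (hterm n b) C $$ (c, r))"
      if "C \<in> deform_closure n V C0" for C
    proof -
      have C: "C \<in> even_holes n V" using deform_closure_even_hole[OF C0 that] by blast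
      let ?xs = "hole_list n V C"
      interpret word_function n "\<lambda>xs. word n b xs $$ (r, c)" by (rule word_function_word1[OF rc])
      have "word n b ?xs $$ (r, c) = word n b (rev ?xs) $$ (r, c)"
        using hole_rev_word[OF hole_list(3)[OF C], of "[]" "[]"] hole_list(4)[OF C] by simp
      also have "\<dots> = dagger (word n b ?xs) $$ (r, c)" unfolding dagger_word ..
      also have "\<dots> = cnj (word n b ?xs $$ (c, r))"
        using rc carrier_matD[OF word_carrier[of n b ?xs]] by (simp add: dagger_def)
      finally show ?thesis unfolding cycle_op_word[OF C, of b b, OF refl]
        using rc carrier_matD[OF word_carrier[of n b ?xs]] by simp
    qed
    then show ?thesis unfolding cycle_symmetry_def msum_entry[OF rc] msum_entry[OF rc(2,1)] by simp
  qed
  moreover have "cycle_symmetry n V (hterm n b) C0 \<in> carrier_mat (2^n) (2^n)" by (simp add: cycle_symmetry_def)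
  ultimately show ?thesis using hermitian_iff by blast
qed

section \<open>The cycle symmetries commute with the Hamiltonian\<close>

context simplicial_graph
begin

text \<open>\<open>k\<close> is the vertex of the hole that a deformation by \<open>j\<close> would
  replace.\<close>

definition centre :: "(nat \<Rightarrow> nat) set \<Rightarrow> (nat \<Rightarrow> nat) \<Rightarrow> (nat \<Rightarrow> nat) \<Rightarrow> bool" where
  "centre C j k \<longleftrightarrow> k \<in> C \<and> j \<notin> C \<and> (\<forall>y\<in>C. adj n j y \<longleftrightarrow> y = k \<or> adj n k y)"

text \<open>Cutting the hole at a vertex not adjacent to \<open>j\<close> turns it into a path as
  far as the neighbours of \<open>j\<close> are concerned, and the same index analysis leaves only
  three consecutive positions.\<close>

lemma hole_odd_centre:
  assumes h: "hole n V ys" "even (length ys)" and j: "j \<in> V" "odd (deg n j ys)"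
  shows "\<exists>k. centre (set ys) j k"
proof -
  have jn: "j \<notin> set ys"
  proof
    assume "j \<in> set ys"
    have "deg n j ys = 2" using deg_hole_member[OF h(1) \<open>j \<in> set ys\<close>] .
    then show False using j(2) by simp
  qed
  \<comment> \<open>The hole has an even number of vertices, an odd number of which are adjacent to
    \<open>j\<close>.\<close>
  have "\<exists>x\<in>set ys. \<not> adj n j x"
  proof (rule ccontr)
    assume "\<not> ?thesis"
    then have "filter (adj n j) ys = ys" by (simp add: filter_id_conv)
    then have "deg n j ys = length ys" by (simp add: deg_def)
    then show False using h(2) j(2) by simp
  qed
  then obtain x where x: "x \<in> set ys" "\<not> adj n j x" by blast
  obtain r where r: "hd (rotate r ys) = x" using rotate_to_hd[OF x(1)] by blast
  define zs where "zs = rotate r ys"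
  have hz: "hole n V zs" unfolding zs_def by (rule hole_rotate[OF h(1)])
  note D = hole_D[OF hz]
  have sz: "set zs = set ys" unfolding zs_def by simp
  have z0: "zs ! 0 = x" using r D(4) unfolding zs_def[symmetric] by (simp add: hd_conv_nth)
  have degz: "deg n j zs = deg n j ys"
  proof -
    have "deg n j zs = card (set (filter (adj n j) zs))" "deg n j ys = card (set (filter (adj n j) ys))"
      unfolding deg_def
      using distinct_card[OF distinct_filter[OF D(2), of "adj n j"]]
        distinct_card[OF distinct_filter[OF hole_D(2)[OF h(1)], of "adj n j"]] by simp_all
    then show ?thesis using sz by simp
  qed
  let ?N = "nb_idx n zs j" and ?m = "length zs"
  have nbD: "i < ?m" "adj n j (zs ! i)" "0 < i" if "i \<in> ?N" for i
  proof -
    show i: "i < ?m" "adj n j (zs ! i)" using that by (simp_all add: nb_idx_def)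
    have "i \<noteq> 0" using i(2) z0 x(2) by metis
    then show "0 < i" by simp
  qed
  have U: "zs ! i \<in> insert s V" if "i < ?m" for i using D(3) nth_mem[OF that] by blast
  have jU: "j \<in> insert s V" using j(1) by simp
  have nej: "zs ! i \<noteq> j" if "i < ?m" for i using nth_mem[OF that] sz jn by blast
  have neq: "zs ! i \<noteq> zs ! l" if "i < ?m" "l < ?m" "i \<noteq> l" for i l using nth_eq_iff_index_eq[OF D(2)] that by simp
  \<comment> \<open>The bound is taken as \<open>?m\<close>, one beyond the last index, so that the
    two alternatives containing it are impossible.\<close>
  have "?N = {?m} \<or> (\<exists>i. i + 2 \<le> ?m \<and> ?N = {i, i+1, i+2}) \<or> (\<exists>i. i + 2 < ?m \<and> ?N = {i, i+1, ?m})"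
  proof (rule odd_index_set_cases)
    show "?N \<subseteq> {..?m}" by (auto simp: nb_idx_def)
    show "odd (card ?N)" using j(2) degz by (simp add: deg_nb_idx)
  next
    fix a c d assume N: "a \<in> ?N" "c \<in> ?N" "d \<in> ?N" and lt: "a + 1 < c" "c + 1 < d"
    have "\<not> adj n (zs ! a) (zs ! c)" "\<not> adj n (zs ! a) (zs ! d)" "\<not> adj n (zs ! c) (zs ! d)"
      using hole_adj[OF hz, of a c] hole_adj[OF hz, of a d] hole_adj[OF hz, of c d] lt nbD(1,3)[OF N(1)] nbD(1)[OF N(2)] nbD(1)[OF N(3)]
      by simp_all
    moreover have "zs ! a \<noteq> zs ! c" "zs ! a \<noteq> zs ! d" "zs ! c \<noteq> zs ! d"
      using neq nbD(1)[OF N(1)] nbD(1)[OF N(2)] nbD(1)[OF N(3)] lt by simp_all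
    ultimately show False
      using claw[OF jU U[OF nbD(1)[OF N(1)]] U[OF nbD(1)[OF N(2)]] U[OF nbD(1)[OF N(3)]]
        nbD(2)[OF N(1)] nbD(2)[OF N(2)] nbD(2)[OF N(3)]] by blast
  next
    fix a assume a: "a \<in> ?N"
    let ?p = "a - 1" and ?q = "if a + 1 = ?m then 0 else a + 1"
    have am: "a < ?m" "0 < a" using nbD[OF a] by simp_all
    have m4: "4 \<le> ?m" by (rule D(1))
    have pq: "?p < ?m" "?q < ?m" "?p \<noteq> ?q" using am m4 by auto
    have ap: "adj n (zs ! ?p) (zs ! a)" using hole_adj[OF hz, of ?p a] am by simp
    have aq: "adj n (zs ! a) (zs ! ?q)"
    proof (cases "a + 1 = ?m")
      case True
      then have "adj n (zs ! 0) (zs ! a)" using hole_adj[OF hz, of 0 a] am by auto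
      then show ?thesis using True adj_sym[of n "zs ! a" "zs ! 0"] by simp
    next
      case False
      then show ?thesis using hole_adj[OF hz, of a "a + 1"] am by simp
    qed
    have npq: "\<not> adj n (zs ! ?p) (zs ! ?q)"
    proof (cases "a + 1 = ?m")
      case True
      then have "\<not> adj n (zs ! 0) (zs ! ?p)" using hole_adj[OF hz, of 0 ?p] am m4 by auto
      then show ?thesis using True adj_sym[of n "zs ! ?p" "zs ! 0"] by simp
    next
      case False
      then show ?thesis using hole_adj[OF hz, of ?p "a + 1"] am m4 by auto
    qed
    have "adj n (zs ! a) (zs ! ?p)" using ap adj_sym[of n "zs ! ?p" "zs ! a"] by blast
    moreover have "adj n (zs ! a) j" using nbD(2)[OF a] adj_sym[of n j "zs ! a"] by blast
    ultimately have "adj n (zs ! ?p) j \<or> adj n (zs ! ?q) j"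
      using claw[OF U[OF am(1)] U[OF pq(1)] U[OF pq(2)] jU _ aq] neq[OF pq] nej[OF pq(1)] nej[OF pq(2)] npq by blast
    then have "?p \<in> ?N \<or> ?q \<in> ?N"
      unfolding nb_idx_def using pq adj_sym[of n "zs ! ?p" j] adj_sym[of n "zs ! ?q" j] by blast
    moreover have "0 \<notin> ?N" using nbD(3) by blast
    moreover have "?p + 1 = a" using am by simp
    ultimately show "a + 1 \<in> ?N \<or> (\<exists>y\<in>?N. y + 1 = a)" by (cases "a + 1 = ?m") auto
  qed
  moreover have "?m \<notin> ?N" by (simp add: nb_idx_def)
  ultimately obtain i where i: "i + 2 \<le> ?m" "?N = {i, i+1, i+2}" by blast
  have "i \<in> ?N" "i + 2 \<in> ?N" using i(2) by blast+
  then have i': "0 < i" "i + 2 < ?m" using nbD by blast+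
  let ?k = "zs ! (i+1)"
  have "adj n j (zs ! a) \<longleftrightarrow> zs ! a = ?k \<or> adj n ?k (zs ! a)" if am: "a < ?m" for a
  proof -
    have "adj n j (zs ! a) \<longleftrightarrow> a \<in> {i, i+1, i+2}" using am unfolding i(2)[symmetric] by (simp add: nb_idx_def)
    moreover have "zs ! a = ?k \<longleftrightarrow> a = i + 1" using neq[OF am, of "i+1"] i' by auto
    moreover have "adj n ?k (zs ! a) \<longleftrightarrow> a = i \<or> a = i + 2"
    proof -
      consider "a < i + 1" | "a = i + 1" | "i + 1 < a" by linarith
      then show ?thesis
      proof cases
        case 1
        then show ?thesis using hole_adj[OF hz, of a "i+1"] i' adj_sym[of n ?k "zs ! a"] by auto
      next
        case 3
        then show ?thesis using hole_adj[OF hz, of "i+1" a] am i' by auto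
      qed simp
    qed
    ultimately show ?thesis by auto
  qed
  then have "\<forall>y\<in>set zs. adj n j y \<longleftrightarrow> y = ?k \<or> adj n ?k y" unfolding all_set_conv_all_nth by blast
  moreover have "?k \<in> set zs" using i' by simp
  ultimately have "centre (set ys) j ?k" unfolding centre_def using sz jn by simp
  then show ?thesis by blast
qed

lemma centre_card:
  assumes "hole n V ys" "centre (set ys) j k"
  shows "deg n j ys = 3"
proof -
  have k: "k \<in> set ys" using assms(2) unfolding centre_def by blast
  obtain u v where uv: "u \<in> set ys" "v \<in> set ys" "u \<noteq> v" "\<not> adj n u v"
    "\<forall>y\<in>set ys. adj n k y \<longleftrightarrow> y = u \<or> y = v" using hole_nbrs[OF assms(1) k] by blast
  have ku: "adj n k u" "adj n k v" using uv by blast+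
  then have ne: "k \<noteq> u" "k \<noteq> v" by auto
  have "deg n j ys = card (set (filter (adj n j) ys))"
    unfolding deg_def using hole_D(2)[OF assms(1)] by (metis distinct_card distinct_filter)
  also have "set (filter (adj n j) ys) = {k, u, v}"
    unfolding set_filter using assms(2) uv(1,2,5) k unfolding centre_def by blast
  finally show ?thesis using ne uv(3) by simp
qed

text \<open>Of the three neighbours of \<open>j\<close> on the hole, only the middle one is adjacent
  to both others.\<close>

lemma centre_unique:
  assumes "hole n V ys" "centre (set ys) j k" "centre (set ys) j k'"
  shows "k' = k"
proof (rule ccontr)
  assume ne: "k' \<noteq> k"
  have k: "k \<in> set ys" "k' \<in> set ys" using assms(2,3) unfolding centre_def by blast+
  obtain u v where uv: "u \<in> set ys" "v \<in> set ys" "u \<noteq> v" "\<not> adj n u v"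
    "\<forall>y\<in>set ys. adj n k y \<longleftrightarrow> y = u \<or> y = v" using hole_nbrs[OF assms(1) k(1)] by blast
  have j: "adj n j u" "adj n j v" "adj n j k'" using assms(2,3) uv(1,2,5) k unfolding centre_def by blast+
  have "adj n k k'" using j(3) ne assms(2) k(2) unfolding centre_def by blast
  then consider "k' = u" | "k' = v" using uv(5) k(2) by blast
  then show False
  proof cases
    case 1
    have "v = k' \<or> adj n k' v" using assms(3) j(2) uv(2) unfolding centre_def by blast
    then show False using 1 uv(3,4) by simp
  next
    case 2
    have "u = k' \<or> adj n k' u" using assms(3) j(1) uv(1) unfolding centre_def by blast
    then show False using 2 uv(3,4) adj_sym[of n u v] by simp
  qed
qed

text \<open>A vertex \<open>j\<close> anticommuting with the hole product has a centre
  \<open>k\<close>. Deforming the hole by \<open>j\<close> and multiplying by \<open>k\<close> gives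
  the same factors, with the anticommuting \<open>j\<close> and \<open>k\<close> exchanged, and the
  new hole belongs to the same class.\<close>

lemma sum_hole_words_zero:
  assumes W: "word_function n W" and C0: "C0 \<in> even_holes n V"
  shows "(\<Sum>(C, j) | C \<in> deform_closure n V C0 \<and> j \<in> V \<and> odd (deg n j (hole_list n V C)). W (hole_list n V C @ [j])) = 0"
proof -
  interpret word_function n W by (rule W)
  let ?L = "hole_list n V"
  let ?S = "{(C, j). C \<in> deform_closure n V C0 \<and> j \<in> V \<and> odd (deg n j (?L C))}"
  define \<phi> where "\<phi> = (\<lambda>(C, j). let k = (THE k. centre C j k) in (insert j (C - {k}), k))"
  have key: "\<phi> (C, j) \<in> ?S \<and> \<phi> (\<phi> (C, j)) = (C, j) \<and> (case \<phi> (C, j) of (C', k) \<Rightarrow> W (?L C' @ [k])) = - W (?L C @ [j])"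
    if Cj: "C \<in> deform_closure n V C0" "j \<in> V" "odd (deg n j (?L C))" for C j
  proof -
    have C: "C \<in> even_holes n V" using deform_closure_even_hole[OF C0 Cj(1)] by blast
    note H = hole_list[OF C]
    obtain k where k: "centre C j k" using hole_odd_centre[OF H(3,4) Cj(2,3)] H(2) by auto
    have the: "(THE k. centre C j k) = k" using centre_unique[OF H(3)] H(2) k by (intro the_equality) simp_all
    define C' where "C' = insert j (C - {k})"
    have p1: "\<phi> (C, j) = (C', k)" unfolding \<phi>_def C'_def by (simp add: the Let_def)
    have kC: "k \<in> C" "j \<notin> C" "\<forall>y\<in>C. adj n j y \<longleftrightarrow> y = k \<or> adj n k y" using k unfolding centre_def by blast+
    have jk: "j \<noteq> k" using kC by blast
    have CV: "C \<subseteq> V" by (rule even_holes_subset[OF C])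
    have "nbhd n C j = insert k (nbhd n C k)" unfolding nbhd_def using kC by blast
    then have "deformation n V C C'" unfolding deformation_def C'_def using Cj(2) kC(1,2) by blast
    then have C'cl: "C' \<in> deform_closure n V C0" by (rule deform_closure.step[OF Cj(1)])
    have C': "C' \<in> even_holes n V" using deform_closure_even_hole[OF C0 C'cl] by blast
    note H' = hole_list[OF C']
    have adjkj: "adj n k j" using kC(1,3) adj_sym[of n j k] by blast
    have k': "centre C' k j"
    proof -
      have "adj n k y \<longleftrightarrow> y = j \<or> adj n j y" if "y \<in> C'" for y
      proof (cases "y = j")
        case False
        then have "y \<in> C" "y \<noteq> k" using that unfolding C'_def by blast+
        then show ?thesis using kC(3) False by blast
      qed (simp add: adjkj)
      then show ?thesis unfolding centre_def C'_def using jk by blast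
    qed
    have deg': "odd (deg n k (?L C'))" using centre_card[OF H'(3)] k' H'(2) by simp
    have S: "\<phi> (C, j) \<in> ?S" unfolding p1 using C'cl kC(1) CV deg' by blast
    have the': "(THE k'. centre C' k k') = j" using centre_unique[OF H'(3)] H'(2) k' by (intro the_equality) simp_all
    have "\<phi> (C', k) = (insert k (C' - {j}), j)" unfolding \<phi>_def by (simp add: the' Let_def)
    moreover have "insert k (C' - {j}) = C" unfolding C'_def using kC(1,2) by blast
    ultimately have p2: "\<phi> (\<phi> (C, j)) = (C, j)" unfolding p1 by simp
    have kL: "k \<in> set (?L C)" using kC(1) H(2) by simp
    obtain t where t: "hd (rotate t (?L C)) = k" using rotate_to_hd[OF kL] by blast
    define zs where "zs = rotate t (?L C)"
    have hz: "hole n V zs" "even (length zs)" "set zs = C" unfolding zs_def using hole_rotate[OF H(3)] H(2,4) by simp_all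
    obtain us where us: "zs = k # us" using t hole_D(4)[OF hz(1)] unfolding zs_def[symmetric] by (cases zs) simp_all
    have ez: "even_hole_list n V (k # us)" using hz us by (simp add: even_hole_list_iff)
    have "hole n V (zs[0 := j])"
    proof (rule hole_update[OF hz(1)])
      show "0 < length zs" using us by simp
      show "j \<in> V" by (rule Cj(2))
      show "j \<notin> set zs" using kC(2) hz(3) by simp
      fix y assume y: "y \<in> set zs" "y \<noteq> zs ! 0"
      have "zs ! 0 = k" using us by simp
      then show "adj n j y \<longleftrightarrow> adj n (zs ! 0) y" using kC(3) hz(3) y by blast
    qed
    then have hj: "hole n V (j # us)" using us by simp
    then have ej: "even_hole_list n V (j # us)" using hz(2) us by (simp add: even_hole_list_iff)
    have sj: "set (j # us) = C'" unfolding C'_def using hz(3) hole_D(2)[OF hz(1)] us by auto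
    have w1: "W (?L C @ [j]) = W (k # us @ [j])"
      using even_hole_words_eq[OF H(1) ez, of "[]" "[j]"] H(2) hz(3) us by simp
    have w2: "W (?L C' @ [k]) = W (j # us @ [k])"
      using even_hole_words_eq[OF H'(1) ej, of "[]" "[k]"] H'(2) sj by simp
    have "deg n j zs = 3" using centre_card[OF hz(1)] k hz(3) by simp
    \<comment> \<open>One of the three hole neighbours of \<open>j\<close> is \<open>k\<close>
      itself, so moving \<open>j\<close> across the rest of the hole is free of sign.\<close>
    then have d1: "deg n j us = 2" using us adjkj adj_sym[of n j k] by simp
    have d2: "deg n k us = 2" using deg_hole_member[OF hz(1), of k] us by simp
    have "W ([k, j] @ us) = W (k # us @ [j])" using move[of "[k]" j us "[]"] d1 by simp
    moreover have "W ([j, k] @ us) = W (j # us @ [k])" using move[of "[j]" k us "[]"] d2 by simp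
    moreover have "W ([k, j] @ us) = - W ([j, k] @ us)" using swap[of "[]" k j us] adjkj by simp
    ultimately have "W (?L C' @ [k]) = - W (?L C @ [j])" using w1 w2 by simp
    then show ?thesis using S p2 unfolding p1 by simp
  qed
  show ?thesis
  proof (rule sum_involution_zero[where \<phi> = \<phi>])
    fix x assume x: "x \<in> ?S"
    obtain C j where Cj: "x = (C, j)" by (cases x)
    have m: "C \<in> deform_closure n V C0" "j \<in> V" "odd (deg n j (?L C))" using x Cj by simp_all
    show "\<phi> x \<in> ?S" "\<phi> (\<phi> x) = x" "(case \<phi> x of (C, j) \<Rightarrow> W (?L C @ [j])) = - (case x of (C, j) \<Rightarrow> W (?L C @ [j]))"
      using key[OF m] unfolding Cj by simp_all
  qed
qed

lemma finite_deform_closure: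
  assumes "C0 \<in> even_holes n V"
  shows "finite (deform_closure n V C0)"
proof -
  have "deform_closure n V C0 \<subseteq> Pow V"
    using deform_closure_even_hole[OF assms] even_holes_subset by blast
  then show ?thesis using finV by (meson finite_Pow_iff finite_subset)
qed

text \<open>In the commutator the commuting pairs of a hole and a term drop out and the
  anticommuting ones are doubled. All members of a class carry the same \<open>cycle_sign\<close>,
  so it factors out and the rest cancels in pairs.\<close>

lemma cycle_symmetry_commute:
  assumes C0: "C0 \<in> even_holes n V"
  shows "cycle_symmetry n V (hterm n b) C0 * msum (2^n) (hterm n b) V = msum (2^n) (hterm n b) V * cycle_symmetry n V (hterm n b) C0"
    (is "?J * ?H = ?H * ?J")
proof (rule eq_matI)
  fix r c assume "r < dim_row (?H * ?J)" "c < dim_col (?H * ?J)"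
  then have rc: "r < 2^n" "c < 2^n" by (simp_all add: msum_def cycle_symmetry_def)
  let ?D = "deform_closure n V C0" and ?L = "hole_list n V"
  let ?w = "\<lambda>xs. word n b xs $$ (r, c)"
  let ?e = "complex_of_real (cycle_sign C0)"
  interpret word_function n ?w by (rule word_function_word1[OF rc])
  have mem: "C \<in> even_holes n V" if "C \<in> ?D" for C using deform_closure_even_hole[OF C0 that] by blast
  have cop: "cycle_op n V (hterm n b) C = ?e \<cdot>\<^sub>m word n b (?L C)" if "C \<in> ?D" for C
    using cycle_op_word[OF mem[OF that], of b b, OF refl] cycle_sign_deform_closure[OF C0 that] by simp
  have copc: "cycle_op n V (hterm n b) C \<in> carrier_mat (2^n) (2^n)" if "C \<in> ?D" for C
    by (rule cycle_op_carrier[OF mem[OF that]])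
  have e1: "(cycle_op n V (hterm n b) C * hterm n b j) $$ (r, c) = ?e * ?w (?L C @ [j])" if "C \<in> ?D" for C j
  proof -
    have "cycle_op n V (hterm n b) C * hterm n b j = ?e \<cdot>\<^sub>m word n b (?L C @ [j])"
      unfolding cop[OF that] word_append word_single by (rule mult_smult_assoc_mat[OF word_carrier hterm_carrier])
    then show ?thesis using rc carrier_matD[OF word_carrier[of n b]] by simp
  qed
  have e2: "(hterm n b j * cycle_op n V (hterm n b) C) $$ (r, c) = ?e * ((-1) ^ deg n j (?L C) * ?w (?L C @ [j]))" if "C \<in> ?D" for C j
  proof -
    have "hterm n b j * cycle_op n V (hterm n b) C = ?e \<cdot>\<^sub>m word n b (j # ?L C)"
      unfolding cop[OF that] word_Cons by (rule mult_smult_distrib[OF hterm_carrier word_carrier])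
    then have "(hterm n b j * cycle_op n V (hterm n b) C) $$ (r, c) = ?e * ?w (j # ?L C)"
      using rc carrier_matD[OF word_carrier[of n b]] by simp
    then show ?thesis using move[of "[]" j "?L C" "[]"] by simp
  qed
  have 1: "(?J * ?H) $$ (r, c) = (\<Sum>C\<in>?D. \<Sum>j\<in>V. ?e * ?w (?L C @ [j]))"
  proof -
    have "(?J * ?H) $$ (r, c) = (\<Sum>C\<in>?D. (cycle_op n V (hterm n b) C * ?H) $$ (r, c))"
      unfolding cycle_symmetry_def by (rule msum_mult_entry[OF msum_carrier copc rc])
    also have "\<dots> = (\<Sum>C\<in>?D. \<Sum>j\<in>V. (cycle_op n V (hterm n b) C * hterm n b j) $$ (r, c))"
      by (rule sum.cong[OF refl]) (rule mult_msum_entry[OF copc hterm_carrier rc])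
    also have "\<dots> = (\<Sum>C\<in>?D. \<Sum>j\<in>V. ?e * ?w (?L C @ [j]))"
      by (rule sum.cong[OF refl], rule sum.cong[OF refl], rule e1)
    finally show ?thesis .
  qed
  have 2: "(?H * ?J) $$ (r, c) = (\<Sum>C\<in>?D. \<Sum>j\<in>V. ?e * ((-1) ^ deg n j (?L C) * ?w (?L C @ [j])))"
  proof -
    have "(?H * ?J) $$ (r, c) = (\<Sum>C\<in>?D. (?H * cycle_op n V (hterm n b) C) $$ (r, c))"
      unfolding cycle_symmetry_def by (rule mult_msum_entry[OF msum_carrier copc rc])
    also have "\<dots> = (\<Sum>C\<in>?D. \<Sum>j\<in>V. (hterm n b j * cycle_op n V (hterm n b) C) $$ (r, c))"
      by (rule sum.cong[OF refl]) (rule msum_mult_entry[OF copc hterm_carrier rc])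
    also have "\<dots> = (\<Sum>C\<in>?D. \<Sum>j\<in>V. ?e * ((-1) ^ deg n j (?L C) * ?w (?L C @ [j])))"
      by (rule sum.cong[OF refl], rule sum.cong[OF refl], rule e2)
    finally show ?thesis .
  qed
  have "(?J * ?H) $$ (r, c) - (?H * ?J) $$ (r, c)
     = (\<Sum>C\<in>?D. \<Sum>j\<in>V. 2 * ?e * (if odd (deg n j (?L C)) then ?w (?L C @ [j]) else 0))"
    unfolding 1 2 sum_subtractf[symmetric]
    by (rule sum.cong[OF refl], rule sum.cong[OF refl]) simp
  also have "\<dots> = 2 * ?e * (\<Sum>C\<in>?D. \<Sum>j\<in>V. if odd (deg n j (?L C)) then ?w (?L C @ [j]) else 0)"
    by (simp add: sum_distrib_left)
  also have "(\<Sum>C\<in>?D. \<Sum>j\<in>V. if odd (deg n j (?L C)) then ?w (?L C @ [j]) else 0)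
     = (\<Sum>C\<in>?D. \<Sum>j\<in>{j\<in>V. odd (deg n j (?L C))}. ?w (?L C @ [j]))"
    by (rule sum.cong[OF refl]) (rule sum.inter_filter[OF finV, symmetric])
  also have "\<dots> = (\<Sum>(C, j)\<in>(SIGMA C:?D. {j\<in>V. odd (deg n j (?L C))}). ?w (?L C @ [j]))"
    by (rule sum.Sigma) (use finite_deform_closure[OF C0] finV in simp_all)
  also have "(SIGMA C:?D. {j\<in>V. odd (deg n j (?L C))}) = {(C, j). C \<in> ?D \<and> j \<in> V \<and> odd (deg n j (?L C))}" by blast
  also have "(\<Sum>(C, j)\<in>\<dots>. ?w (?L C @ [j])) = 0"
    by (rule sum_hole_words_zero[OF word_function_axioms C0])
  finally show "(?J * ?H) $$ (r, c) = (?H * ?J) $$ (r, c)" by simp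
qed (simp_all add: msum_def cycle_symmetry_def)

end

section \<open>The Krylov expansion\<close>

lemma smult_smult_mat: "k \<cdot>\<^sub>m (l \<cdot>\<^sub>m A) = (k * l :: complex) \<cdot>\<^sub>m A"
  by (rule eq_matI) auto

lemma msum_mult:
  fixes M :: "complex mat"
  assumes "M \<in> carrier_mat N N" "\<And>x. x \<in> S \<Longrightarrow> f x \<in> carrier_mat N N"
  shows "msum N f S * M = msum N (\<lambda>x. f x * M) S"
  by (rule eq_matI) (use assms msum_mult_entry[OF assms] in \<open>auto simp: msum_entry msum_def\<close>)

lemma mult_msum:
  fixes M :: "complex mat"
  assumes "M \<in> carrier_mat N N" "\<And>x. x \<in> S \<Longrightarrow> f x \<in> carrier_mat N N"
  shows "M * msum N f S = msum N (\<lambda>x. M * f x) S"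
  by (rule eq_matI) (use assms mult_msum_entry[OF assms] in \<open>auto simp: msum_entry msum_def\<close>)

context simplicial_graph
begin

lemma spath_set_inj:
  assumes "spath P" "spath Q" "set P = set Q"
  shows "P = Q"
proof -
  note PD = spath_D[OF assms(1)] and QD = spath_D[OF assms(2)]
  have len: "length P = length Q" using PD(3) QD(3) assms(3) by (metis distinct_card)
  have "\<forall>k\<le>i. P ! k = Q ! k" if "i < length P" for i
    using that
  proof (induction i)
    case 0 then show ?case using spath_nth_0[OF assms(1)] spath_nth_0[OF assms(2)] by simp
  next
    case (Suc i)
    then have IH: "\<And>k. k \<le> i \<Longrightarrow> P ! k = Q ! k" by simp
    have "P ! Suc i \<in> set Q" using Suc.prems assms(3) nth_mem by blast
    then obtain k where k: "k < length Q" "Q ! k = P ! Suc i" by (auto simp: in_set_conv_nth)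
    have "\<not> k \<le> i"
    proof
      assume "k \<le> i"
      then have "P ! k = P ! Suc i" using IH k by simp
      then show False using nth_eq_iff_index_eq[OF PD(3), of k "Suc i"] Suc.prems \<open>k \<le> i\<close> by simp
    qed
    have "adj n (P ! i) (P ! Suc i)" using pathlike_adj[OF PD(5), of i "Suc i"] Suc.prems by simp
    then have "adj n (Q ! i) (Q ! k)" using IH[of i] k by simp
    then have "k = i + 1 \<or> i = k + 1" using pathlike_adj[OF QD(5), of i k] k Suc.prems len by simp
    then have "k = Suc i" using \<open>\<not> k \<le> i\<close> by simp
    then show ?case using IH k by (simp add: le_Suc_eq)
  qed
  then show ?thesis using len by (intro nth_equalityI) auto
qed

lemma inj_on_spath: "inj_on set {P. spath P}"
  by (rule inj_onI) (use spath_set_inj in simp)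

lemma path_op_spath:
  assumes "spath Q"
  shows "path_op n (insert s V) (hterm n \<beta>) s (set Q) = word n \<beta> Q"
proof -
  have sQ: "s \<in> set Q" using spath_D(1,2)[OF assms] hd_in_set by blast
  have "(SOME xs. induced_path_list n (insert s V) xs \<and> set xs = set Q \<and> (s \<in> set Q \<longrightarrow> hd xs = s)) = Q"
  proof (rule some_equality)
    show "induced_path_list n (insert s V) Q \<and> set Q = set Q \<and> (s \<in> set Q \<longrightarrow> hd Q = s)"
      using assms unfolding spath_def by simp
    fix xs assume "induced_path_list n (insert s V) xs \<and> set xs = set Q \<and> (s \<in> set Q \<longrightarrow> hd xs = s)"
    then show "xs = Q" using spath_set_inj[OF _ assms] sQ unfolding spath_def by blast
  qed
  then show ?thesis unfolding path_op_def word_def by simp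
qed

section \<open>The matrix on induced paths and its powers\<close>

definition delta :: "(nat \<Rightarrow> nat) list \<Rightarrow> (nat \<Rightarrow> nat) list \<Rightarrow> real" where
  "delta P Q = (if Q = P then 1 else 0)"

text \<open>\<open>path_step\<close> is linear, and a step from \<open>Q\<close> only reads values
  at paths, so its matrix entries are its values on the indicators \<open>delta P\<close>.\<close>

lemma path_step_delta:
  assumes Q: "spath Q"
  shows "path_step b c f Q = (\<Sum>P | spath P. f P * path_step b c (delta P) Q)"
proof -
  have ev: "f X = (\<Sum>P | spath P. f P * delta P X)" if "spath X" for X
    using finite_spath that unfolding delta_def by (simp add: if_distrib sum.delta cong: if_cong)
  have 1: "(if 2 \<le> length Q then f (butlast Q) else 0)
     = (\<Sum>P | spath P. f P * (if 2 \<le> length Q then delta P (butlast Q) else 0))"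
    using ev[of "butlast Q"] spath_butlast[OF Q] by simp
  have 2: "(\<Sum>j | spath (Q @ [j]). (b j)\<^sup>2 * f (Q @ [j]))
     = (\<Sum>P | spath P. f P * (\<Sum>j | spath (Q @ [j]). (b j)\<^sup>2 * delta P (Q @ [j])))"
  proof -
    have "(\<Sum>j | spath (Q @ [j]). (b j)\<^sup>2 * f (Q @ [j]))
       = (\<Sum>j | spath (Q @ [j]). \<Sum>P | spath P. f P * ((b j)\<^sup>2 * delta P (Q @ [j])))"
    proof (rule sum.cong[OF refl])
      fix j assume "j \<in> {j. spath (Q @ [j])}"
      then show "(b j)\<^sup>2 * f (Q @ [j]) = (\<Sum>P | spath P. f P * ((b j)\<^sup>2 * delta P (Q @ [j])))"
        using ev[of "Q @ [j]"] by (simp add: sum_distrib_left mult.left_commute)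
    qed
    also have "\<dots> = (\<Sum>P | spath P. \<Sum>j | spath (Q @ [j]). f P * ((b j)\<^sup>2 * delta P (Q @ [j])))" by (rule sum.swap)
    finally show ?thesis by (simp add: sum_distrib_left)
  qed
  have 3: "(\<Sum>ys | att Q ys \<and> even (length ys). c (set ys) * f (Q @ butlast ys))
     = (\<Sum>P | spath P. f P * (\<Sum>ys | att Q ys \<and> even (length ys). c (set ys) * delta P (Q @ butlast ys)))"
  proof -
    have "(\<Sum>ys | att Q ys \<and> even (length ys). c (set ys) * f (Q @ butlast ys))
       = (\<Sum>ys | att Q ys \<and> even (length ys). \<Sum>P | spath P. f P * (c (set ys) * delta P (Q @ butlast ys)))"
    proof (rule sum.cong[OF refl])
      fix ys assume "ys \<in> {ys. att Q ys \<and> even (length ys)}"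
      then have "spath (Q @ butlast ys)" using att_spath by blast
      then show "c (set ys) * f (Q @ butlast ys) = (\<Sum>P | spath P. f P * (c (set ys) * delta P (Q @ butlast ys)))"
        using ev[of "Q @ butlast ys"] by (simp add: sum_distrib_left mult.left_commute)
    qed
    also have "\<dots> = (\<Sum>P | spath P. \<Sum>ys | att Q ys \<and> even (length ys). f P * (c (set ys) * delta P (Q @ butlast ys)))"
      by (rule sum.swap)
    finally show ?thesis by (simp add: sum_distrib_left)
  qed
  show ?thesis unfolding path_step_def 1 2 3 distrib_left sum.distrib ..
qed

text \<open>Extensions and contractions change the length by one, and opening an even hole adds an
  odd number of vertices. The two sides of the bipartite graph are thus the paths of even and of odd
  size.\<close>

lemma path_step_delta_parity:
  assumes "path_step b c (delta P) Q \<noteq> 0" "spath Q"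
  shows "even (length P) \<longleftrightarrow> odd (length Q)"
proof (rule ccontr)
  assume par: "\<not> ?thesis"
  have z: "delta P X = 0" if "even (length X) \<longleftrightarrow> odd (length Q)" for X
    using that par unfolding delta_def by auto
  have Qne: "Q \<noteq> []" using spath_D(1)[OF assms(2)] .
  have "(if 2 \<le> length Q then delta P (butlast Q) else 0) = 0" using z[of "butlast Q"] Qne by simp
  moreover have "delta P (Q @ [j]) = 0" for j using z[of "Q @ [j]"] by simp
  moreover have "c (set ys) * delta P (Q @ butlast ys) = 0" if "ys \<in> {ys. att Q ys \<and> even (length ys)}" for ys
  proof -
    have a: "att Q ys" "even (length ys)" using that by blast+
    obtain l where "length ys = Suc l" using att_D(6)[OF a(1)] by (cases ys) auto
    then show ?thesis using z[of "Q @ butlast ys"] a(2) by simp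
  qed
  then have "(\<Sum>ys | att Q ys \<and> even (length ys). c (set ys) * delta P (Q @ butlast ys)) = 0" by (rule sum.neutral[rule_format])
  ultimately have "path_step b c (delta P) Q = 0" unfolding path_step_def by simp
  then show False using assms(1) by blast
qed

text \<open>Paths are determined by their vertex sets once they start at \<open>s\<close>; the matrix vanishes on induced paths
that do not start there.\<close>

definition path_matrix :: "((nat \<Rightarrow> nat) \<Rightarrow> real) \<Rightarrow> ((nat \<Rightarrow> nat) set \<Rightarrow> real) \<Rightarrow>
    (nat \<Rightarrow> nat) set \<Rightarrow> (nat \<Rightarrow> nat) set \<Rightarrow> real" where
  "path_matrix b c X Y = (if X \<in> set ` {P. spath P} \<and> Y \<in> set ` {P. spath P}
     then path_step b c (delta (the_inv_into {P. spath P} set X)) (the_inv_into {P. spath P} set Y) else 0)"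

lemma path_matrix_spath:
  assumes "spath P" "spath Q"
  shows "path_matrix b c (set P) (set Q) = path_step b c (delta P) Q"
proof -
  have "the_inv_into {P. spath P} set (set P) = P" "the_inv_into {P. spath P} set (set Q) = Q"
    using the_inv_into_f_f[OF inj_on_spath] assms by simp_all
  then show ?thesis unfolding path_matrix_def using assms by simp
qed

lemma bipartite_path_matrix: "bipartite_weighted_adj (induced_paths n (insert s V)) (path_matrix b c)"
proof -
  let ?I = "induced_paths n (insert s V)"
  have "even (card X) \<longleftrightarrow> odd (card Y)" if "path_matrix b c X Y \<noteq> 0" for X Y
  proof -
    from that have XY: "X \<in> set ` {P. spath P}" "Y \<in> set ` {P. spath P}" unfolding path_matrix_def by (auto split: if_splits)
    obtain P where P: "X = set P" "spath P" using XY(1) by blast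
    obtain Q where Q: "Y = set Q" "spath Q" using XY(2) by blast
    have "path_step b c (delta P) Q \<noteq> 0" using that unfolding P(1) Q(1) path_matrix_spath[OF P(2) Q(2)] .
    then show ?thesis using path_step_delta_parity[OF _ Q(2)] P Q spath_D(3) by (simp add: distinct_card)
  qed
  then show ?thesis unfolding bipartite_weighted_adj_def
    by (intro exI[of _ "{X \<in> ?I. even (card X)}"] exI[of _ "{X \<in> ?I. odd (card X)}"]) blast
qed

lemma spath_in_induced_paths: "set ` {P. spath P} \<subseteq> induced_paths n (insert s V)"
  unfolding induced_paths_def spath_def by blast

lemma finite_induced_paths: "finite (induced_paths n (insert s V))"
proof -
  have "induced_paths n (insert s V) \<subseteq> Pow (insert s V)" unfolding induced_paths_def induced_path_list_def by blast
  then show ?thesis using finV by (meson finite_Pow_iff finite_insert finite_subset)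
qed

lemma sum_induced_paths:
  fixes g :: "(nat \<Rightarrow> nat) set \<Rightarrow> 'b::comm_monoid_add"
  assumes "\<And>X. X \<notin> set ` {P. spath P} \<Longrightarrow> g X = 0"
  shows "(\<Sum>X\<in>induced_paths n (insert s V). g X) = (\<Sum>P | spath P. g (set P))"
proof -
  have "(\<Sum>X\<in>induced_paths n (insert s V). g X) = (\<Sum>X\<in>set ` {P. spath P}. g X)"
    by (rule sum.mono_neutral_right[OF finite_induced_paths spath_in_induced_paths]) (use assms in blast)
  then show ?thesis by (simp add: sum.reindex[OF inj_on_spath])
qed

lemma mpow_path_matrix:
  fixes b c
  defines "I \<equiv> induced_paths n (insert s V)"
  shows "spath Q \<Longrightarrow> mpow I (path_matrix b c) k {s} (set Q) = walk b c k Q"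
    and "X \<notin> set ` {P. spath P} \<Longrightarrow> mpow I (path_matrix b c) k {s} X = 0"
proof -
  have "(\<forall>Q. spath Q \<longrightarrow> mpow I (path_matrix b c) k {s} (set Q) = walk b c k Q) \<and>
        (\<forall>X. X \<notin> set ` {P. spath P} \<longrightarrow> mpow I (path_matrix b c) k {s} X = 0)"
  proof (induction k)
    case 0
    have "{s} = set Q \<longleftrightarrow> Q = [s]" if "spath Q" for Q using spath_set_inj[OF that spath_sing] by auto
    moreover have "{s} \<in> set ` {P. spath P}" by (rule image_eqI[of _ _ "[s]"]) simp_all
    ultimately show ?case by auto
  next
    case (Suc k)
    have "mpow I (path_matrix b c) (Suc k) {s} (set Q) = walk b c (Suc k) Q" if Q: "spath Q" for Q
    proof -
      have "mpow I (path_matrix b c) (Suc k) {s} (set Q)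
        = (\<Sum>P | spath P. mpow I (path_matrix b c) k {s} (set P) * path_matrix b c (set P) (set Q))"
        unfolding mpow.simps I_def by (rule sum_induced_paths) (simp add: path_matrix_def)
      also have "\<dots> = (\<Sum>P | spath P. walk b c k P * path_step b c (delta P) Q)"
        by (rule sum.cong[OF refl]) (use Suc Q in \<open>simp add: path_matrix_spath\<close>)
      also have "\<dots> = walk b c (Suc k) Q" unfolding walk.simps by (rule path_step_delta[OF Q, symmetric])
      finally show ?thesis .
    qed
    moreover have "mpow I (path_matrix b c) (Suc k) {s} X = 0" if "X \<notin> set ` {P. spath P}" for X
      using that by (simp add: path_matrix_def)
    ultimately show ?case by blast
  qed
  then show "spath Q \<Longrightarrow> mpow I (path_matrix b c) k {s} (set Q) = walk b c k Q"
    "X \<notin> set ` {P. spath P} \<Longrightarrow> mpow I (path_matrix b c) k {s} X = 0" by blast+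
qed

text \<open>Induction on \<open>k\<close>: the projector passes through \<open>H\<close> and stays
  in front of every product, and one commutator turns the coefficients \<open>walk k\<close> into
  \<open>walk (Suc k)\<close>, matrix entry by matrix entry.\<close>

lemma krylov_expansion:
  assumes Proj: "joint_eigenprojector (2^n) (cycle_symmetries n V (hterm n b)) Proj"
    and \<beta>: "\<And>j. j \<in> V \<Longrightarrow> \<beta> j = b j" "\<beta> s = 1"
  obtains c where "\<And>k. Proj * ((ad (\<i> \<cdot>\<^sub>m msum (2^n) (hterm n b) V)) ^^ k) (sigma n s)
     = ((- 2 * \<i>) ^ k) \<cdot>\<^sub>m msum (2^n) (\<lambda>P. complex_of_real (walk b c k P) \<cdot>\<^sub>m (Proj * word n \<beta> P)) {P. spath P}"
proof -
  let ?N = "2^n :: nat" and ?J = "cycle_symmetry n V (hterm n b)" and ?L = "hole_list n V"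
  define H where "H = msum ?N (hterm n b) V"
  have Hc: "H \<in> carrier_mat ?N ?N" unfolding H_def by simp
  have Hd: "dagger H = H"
  proof -
    have "H $$ (r, c) = cnj (H $$ (c, r))" if rc: "r < ?N" "c < ?N" for r c
    proof -
      have "hterm n b j $$ (r, c) = cnj (hterm n b j $$ (c, r))" for j
        using hermitian_iff[OF hterm_carrier[of n b j]] dagger_hterm rc by blast
      then show ?thesis unfolding H_def msum_entry[OF rc] msum_entry[OF rc(2,1)] by simp
    qed
    then show ?thesis using hermitian_iff[OF Hc] by blast
  qed
  have Pc: "Proj \<in> carrier_mat ?N ?N" using Proj unfolding joint_eigenprojector_def by blast
  have Jc: "?J C0 \<in> carrier_mat ?N ?N" for C0 unfolding cycle_symmetry_def by simp
  have PH: "Proj * H = H * Proj"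
  proof (rule joint_eigenprojector_commute[OF Proj _ Hc Hd])
    fix S assume "S \<in> cycle_symmetries n V (hterm n b)"
    then obtain C0 where C0: "C0 \<in> even_holes n V" "S = ?J C0" unfolding cycle_symmetries_def by blast
    show "S \<in> carrier_mat ?N ?N" unfolding C0(2) by (rule Jc)
    show "S * H = H * S" unfolding C0(2) H_def by (rule cycle_symmetry_commute[OF C0(1)])
  qed
  have "\<exists>x. Proj * ?J C0 = complex_of_real x \<cdot>\<^sub>m Proj" if "C0 \<in> even_holes n V" for C0
  proof -
    have "?J C0 \<in> cycle_symmetries n V (hterm n b)" unfolding cycle_symmetries_def using that by blast
    then show ?thesis
      using joint_eigenprojector_eigenvalue[OF Proj _ Jc dagger_cycle_symmetry[OF that]] by blast
  qed
  then obtain lam where lam: "\<And>C0. C0 \<in> even_holes n V \<Longrightarrow> Proj * ?J C0 = complex_of_real (lam C0) \<cdot>\<^sub>m Proj" by metis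
  \<comment> \<open>\<open>lam\<close> belongs to holes in colour order, \<open>\<mu>\<close> to
    holes in cyclic order; \<open>cycle_sign\<close> is its own inverse.\<close>
  define \<mu> where "\<mu> C = cycle_sign C * lam C" for C
  define c0 where "c0 C = \<mu> C / real (card (deform_closure n V C))" for C
  have cyc: "(\<Sum>C\<in>deform_closure n V C0. (Proj * word n \<beta> (?L C @ Q)) $$ (r, c)) = complex_of_real (\<mu> C0) * (Proj * word n \<beta> Q) $$ (r, c)"
    if C0: "C0 \<in> even_holes n V" and rc: "r < ?N" "c < ?N" for C0 Q r c
  proof -
    let ?D = "deform_closure n V C0" and ?e = "complex_of_real (cycle_sign C0)"
    have mem: "C \<in> even_holes n V" if "C \<in> ?D" for C using deform_closure_even_hole[OF C0 that] by blast
    have copc: "cycle_op n V (hterm n b) C * word n \<beta> Q \<in> carrier_mat ?N ?N" if "C \<in> ?D" for C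
      by (rule mult_carrier_mat[OF cycle_op_carrier[OF mem[OF that]] word_carrier])
    have e: "Proj * word n \<beta> (?L C @ Q) = ?e \<cdot>\<^sub>m (Proj * (cycle_op n V (hterm n b) C * word n \<beta> Q))" if "C \<in> ?D" for C
    proof -
      have "cycle_op n V (hterm n b) C = ?e \<cdot>\<^sub>m word n \<beta> (?L C)"
        using cycle_op_word[OF mem[OF that], of \<beta> b, OF \<beta>(1)] cycle_sign_deform_closure[OF C0 that] by simp
      then have "cycle_op n V (hterm n b) C * word n \<beta> Q = ?e \<cdot>\<^sub>m word n \<beta> (?L C @ Q)"
        unfolding word_append using mult_smult_assoc_mat[OF word_carrier word_carrier] by simp
      then have "Proj * (cycle_op n V (hterm n b) C * word n \<beta> Q) = ?e \<cdot>\<^sub>m (Proj * word n \<beta> (?L C @ Q))"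
        using mult_smult_distrib[OF Pc word_carrier] by simp
      moreover have "?e * ?e = 1" by (simp flip: of_real_mult)
      moreover have "1 \<cdot>\<^sub>m (Proj * word n \<beta> (?L C @ Q)) = Proj * word n \<beta> (?L C @ Q)" by (rule eq_matI) auto
      ultimately show ?thesis by (simp add: smult_smult_mat)
    qed
    have "(\<Sum>C\<in>?D. (Proj * word n \<beta> (?L C @ Q)) $$ (r, c))
       = (\<Sum>C\<in>?D. ?e * (Proj * (cycle_op n V (hterm n b) C * word n \<beta> Q)) $$ (r, c))"
      by (rule sum.cong[OF refl]) (use e rc Pc carrier_matD[OF word_carrier[of n \<beta>]] in simp)
    also have "\<dots> = ?e * (\<Sum>C\<in>?D. (Proj * (cycle_op n V (hterm n b) C * word n \<beta> Q)) $$ (r, c))"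
      by (simp add: sum_distrib_left)
    also have "(\<Sum>C\<in>?D. (Proj * (cycle_op n V (hterm n b) C * word n \<beta> Q)) $$ (r, c))
       = (Proj * (?J C0 * word n \<beta> Q)) $$ (r, c)"
    proof -
      have J: "?J C0 * word n \<beta> Q = msum ?N (\<lambda>C. cycle_op n V (hterm n b) C * word n \<beta> Q) ?D"
        unfolding cycle_symmetry_def by (rule msum_mult[OF word_carrier]) (rule cycle_op_carrier[OF mem])
      show ?thesis unfolding J by (rule mult_msum_entry[OF Pc _ rc, symmetric]) (rule copc)
    qed
    also have "Proj * (?J C0 * word n \<beta> Q) = (Proj * ?J C0) * word n \<beta> Q"
      by (rule assoc_mult_mat[OF Pc Jc word_carrier, symmetric])
    also have "\<dots> = complex_of_real (lam C0) \<cdot>\<^sub>m (Proj * word n \<beta> Q)"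
      unfolding lam[OF C0] by (rule mult_smult_assoc_mat[OF Pc word_carrier])
    finally show ?thesis using rc Pc carrier_matD[OF word_carrier[of n \<beta>]] by (simp add: \<mu>_def)
  qed
  have wg: "word_graph n V s (\<lambda>xs. (Proj * word n \<beta> xs) $$ (r, c)) b \<mu>" if rc: "r < ?N" "c < ?N" for r c
  proof (intro word_graph.intro word_graph_axioms.intro)
    show "simplicial_graph n V s" by unfold_locales
    show "word_function n (\<lambda>xs. (Proj * word n \<beta> xs) $$ (r, c))" by (rule word_function_word[OF Pc rc])
    fix j xs assume "j \<in> V"
    then show "(Proj * word n \<beta> (xs @ [j, j])) $$ (r, c) = complex_of_real ((b j)\<^sup>2) * (Proj * word n \<beta> xs) $$ (r, c)"
      unfolding word_square mult_smult_distrib[OF Pc word_carrier] using rc Pc carrier_matD[OF word_carrier[of n \<beta>]] \<beta>(1) by simp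
  next
    fix C0 Q assume "C0 \<in> even_holes n V"
    then show "(\<Sum>C\<in>deform_closure n V C0. (Proj * word n \<beta> ((SOME xs. even_hole_list n V xs \<and> set xs = C) @ Q)) $$ (r, c))
       = complex_of_real (\<mu> C0) * (Proj * word n \<beta> Q) $$ (r, c)"
      using cyc[OF _ rc] unfolding hole_list_def by blast
  qed
  define Y where "Y k = msum ?N (\<lambda>P. complex_of_real (walk b c0 k P) \<cdot>\<^sub>m (Proj * word n \<beta> P)) {P. spath P}" for k
  have Yc: "Y k \<in> carrier_mat ?N ?N" for k unfolding Y_def by simp
  have tc: "complex_of_real x \<cdot>\<^sub>m (Proj * word n \<beta> P) \<in> carrier_mat ?N ?N" for x P
    using Pc mult_carrier_mat[OF Pc word_carrier] by simp
  \<comment> \<open>For odd \<open>deg n j P\<close> the term of \<open>j\<close> changes sign when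
    moved behind the path product, so the commutator is -2 times the product ending in
    \<open>j\<close>; for even degree it vanishes.\<close>
  have step: "H * Y k - Y k * H = (- 2) \<cdot>\<^sub>m Y (Suc k)" for k
  proof (rule eq_matI)
    fix r c assume "r < dim_row ((- 2) \<cdot>\<^sub>m Y (Suc k))" "c < dim_col ((- 2) \<cdot>\<^sub>m Y (Suc k))"
    then have rc: "r < ?N" "c < ?N" using carrier_matD[OF Yc[of "Suc k"]] by simp_all
    let ?f = "walk b c0 k" and ?W = "\<lambda>xs. (Proj * word n \<beta> xs) $$ (r, c)"
    interpret wg: word_graph n V s ?W b \<mu> by (rule wg[OF rc])
    have cycle_weight: "wg.cycle_weight = c0" by (rule ext) (simp add: wg.cycle_weight_def c0_def)
    have popb: "hterm n b j = hterm n \<beta> j" if "j \<in> V" for j unfolding hterm_def using \<beta>(1)[OF that] by simp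
    have L: "(H * (complex_of_real (?f P) \<cdot>\<^sub>m (Proj * word n \<beta> P))) $$ (r, c)
        = (\<Sum>j\<in>V. complex_of_real (?f P) * ((-1) ^ deg n j P * ?W (P @ [j])))" for P
    proof -
      have "H * (complex_of_real (?f P) \<cdot>\<^sub>m (Proj * word n \<beta> P)) = complex_of_real (?f P) \<cdot>\<^sub>m (H * (Proj * word n \<beta> P))"
        by (rule mult_smult_distrib[OF Hc mult_carrier_mat[OF Pc word_carrier]])
      also have "H * (Proj * word n \<beta> P) = Proj * (H * word n \<beta> P)"
        using assoc_mult_mat[OF Hc Pc word_carrier[of n \<beta> P]] assoc_mult_mat[OF Pc Hc word_carrier[of n \<beta> P]] PH by simp
      also have "H * word n \<beta> P = msum ?N (\<lambda>j. hterm n b j * word n \<beta> P) V"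
        unfolding H_def by (rule msum_mult[OF word_carrier hterm_carrier])
      finally have "(H * (complex_of_real (?f P) \<cdot>\<^sub>m (Proj * word n \<beta> P))) $$ (r, c)
         = complex_of_real (?f P) * (Proj * msum ?N (\<lambda>j. hterm n b j * word n \<beta> P) V) $$ (r, c)"
        using rc Pc by (simp add: msum_def)
      also have "(Proj * msum ?N (\<lambda>j. hterm n b j * word n \<beta> P) V) $$ (r, c) = (\<Sum>j\<in>V. (Proj * (hterm n b j * word n \<beta> P)) $$ (r, c))"
        by (rule mult_msum_entry[OF Pc mult_carrier_mat[OF hterm_carrier word_carrier] rc])
      also have "\<dots> = (\<Sum>j\<in>V. (-1) ^ deg n j P * ?W (P @ [j]))"
      proof (rule sum.cong[OF refl])
        fix j assume "j \<in> V"
        then have "(Proj * (hterm n b j * word n \<beta> P)) $$ (r, c) = ?W ([] @ [j] @ P @ [])"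
          using popb by (simp add: word_Cons)
        also have "\<dots> = (-1) ^ deg n j P * ?W ([] @ P @ [j] @ [])" by (rule wg.move)
        finally show "(Proj * (hterm n b j * word n \<beta> P)) $$ (r, c) = (-1) ^ deg n j P * ?W (P @ [j])" by simp
      qed
      finally show ?thesis by (simp add: sum_distrib_left)
    qed
    have Rr: "((complex_of_real (?f P) \<cdot>\<^sub>m (Proj * word n \<beta> P)) * H) $$ (r, c)
        = (\<Sum>j\<in>V. complex_of_real (?f P) * ?W (P @ [j]))" for P
    proof -
      have "(complex_of_real (?f P) \<cdot>\<^sub>m (Proj * word n \<beta> P)) * H = complex_of_real (?f P) \<cdot>\<^sub>m ((Proj * word n \<beta> P) * H)"
        by (rule mult_smult_assoc_mat[OF mult_carrier_mat[OF Pc word_carrier] Hc])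
      also have "(Proj * word n \<beta> P) * H = Proj * (word n \<beta> P * H)"
        by (rule assoc_mult_mat[OF Pc word_carrier Hc])
      also have "word n \<beta> P * H = msum ?N (\<lambda>j. word n \<beta> P * hterm n b j) V"
        unfolding H_def by (rule mult_msum[OF word_carrier hterm_carrier])
      finally have "((complex_of_real (?f P) \<cdot>\<^sub>m (Proj * word n \<beta> P)) * H) $$ (r, c)
         = complex_of_real (?f P) * (Proj * msum ?N (\<lambda>j. word n \<beta> P * hterm n b j) V) $$ (r, c)"
        using rc Pc by (simp add: msum_def)
      also have "(Proj * msum ?N (\<lambda>j. word n \<beta> P * hterm n b j) V) $$ (r, c) = (\<Sum>j\<in>V. (Proj * (word n \<beta> P * hterm n b j)) $$ (r, c))"
        by (rule mult_msum_entry[OF Pc mult_carrier_mat[OF word_carrier hterm_carrier] rc])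
      also have "\<dots> = (\<Sum>j\<in>V. ?W (P @ [j]))"
        by (rule sum.cong[OF refl]) (simp add: popb word_append word_single)
      finally show ?thesis by (simp add: sum_distrib_left)
    qed
    have "(H * Y k - Y k * H) $$ (r, c) = (H * Y k) $$ (r, c) - (Y k * H) $$ (r, c)"
      using rc Hc Yc[of k] by simp
    also have "\<dots> = (\<Sum>P | spath P. (H * (complex_of_real (?f P) \<cdot>\<^sub>m (Proj * word n \<beta> P))) $$ (r, c))
       - (\<Sum>P | spath P. ((complex_of_real (?f P) \<cdot>\<^sub>m (Proj * word n \<beta> P)) * H) $$ (r, c))"
      unfolding Y_def mult_msum_entry[OF Hc tc rc] msum_mult_entry[OF Hc tc rc] ..
    also have "\<dots> = (\<Sum>P | spath P. \<Sum>j\<in>V. -2 * (if odd (deg n j P) then complex_of_real (?f P) * ?W (P @ [j]) else 0))"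
      unfolding L Rr sum_subtractf[symmetric]
      by (rule sum.cong[OF refl], rule sum.cong[OF refl]) simp
    also have "\<dots> = -2 * (\<Sum>P | spath P. \<Sum>j\<in>V. if odd (deg n j P) then complex_of_real (?f P) * ?W (P @ [j]) else 0)"
      by (simp add: sum_distrib_left)
    also have "(\<Sum>P | spath P. \<Sum>j\<in>V. if odd (deg n j P) then complex_of_real (?f P) * ?W (P @ [j]) else 0)
       = (\<Sum>P | spath P. \<Sum>j\<in>{j\<in>V. odd (deg n j P)}. complex_of_real (?f P) * ?W (P @ [j]))"
      by (rule sum.cong[OF refl]) (rule sum.inter_filter[OF finV, symmetric])
    also have "\<dots> = (\<Sum>(P, j)\<in>(SIGMA P:{P. spath P}. {j\<in>V. odd (deg n j P)}). complex_of_real (?f P) * ?W (P @ [j]))"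
      by (rule sum.Sigma) (use finite_spath finV in simp_all)
    also have "(SIGMA P:{P. spath P}. {j\<in>V. odd (deg n j P)}) = odd_pairs" unfolding odd_pairs_def by blast
    also have "(\<Sum>(P, j)\<in>odd_pairs. complex_of_real (?f P) * ?W (P @ [j]))
       = (\<Sum>Q | spath Q. complex_of_real (path_step b c0 ?f Q) * ?W Q)"
      using wg.sum_odd_pairs_words[OF walk_nbhd_invariant[of b c0 k]] unfolding cycle_weight .
    also have "\<dots> = Y (Suc k) $$ (r, c)"
      unfolding Y_def msum_entry[OF rc] using rc Pc carrier_matD[OF word_carrier[of n \<beta>]] by simp
    finally show "(H * Y k - Y k * H) $$ (r, c) = ((- 2) \<cdot>\<^sub>m Y (Suc k)) $$ (r, c)"
      using rc Yc[of "Suc k"] by simp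
  qed (use Hc carrier_matD[OF Yc[of k]] carrier_matD[OF Yc[of "Suc k"]] in simp_all)
  define X where "X k = ((ad (\<i> \<cdot>\<^sub>m H)) ^^ k) (sigma n s)" for k
  have XS: "X (Suc k) = \<i> \<cdot>\<^sub>m (H * X k - X k * H)" if "X k \<in> carrier_mat ?N ?N" for k
  proof -
    have "X (Suc k) = (\<i> \<cdot>\<^sub>m H) * X k - X k * (\<i> \<cdot>\<^sub>m H)" unfolding X_def by (simp add: ad_def)
    also have "\<dots> = \<i> \<cdot>\<^sub>m (H * X k) - \<i> \<cdot>\<^sub>m (X k * H)"
      using mult_smult_assoc_mat[OF Hc that] mult_smult_distrib[OF that Hc] by simp
    also have "\<dots> = \<i> \<cdot>\<^sub>m (H * X k - X k * H)"
      by (rule eq_matI) (use Hc that in \<open>simp_all add: right_diff_distrib\<close>)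
    finally show ?thesis .
  qed
  have Xc: "X k \<in> carrier_mat ?N ?N" for k
  proof (induction k)
    case 0 show ?case unfolding X_def by simp
  next
    case (Suc k)
    show ?case unfolding XS[OF Suc]
      by (rule smult_carrier_mat[OF minus_carrier_mat[OF mult_carrier_mat[OF Suc Hc]]])
  qed
  have main: "Proj * X k = ((- 2 * \<i>) ^ k) \<cdot>\<^sub>m Y k" for k
  proof (induction k)
    case 0
    have "word n \<beta> [s] = sigma n s"
      unfolding word_single hterm_def \<beta>(2) by (rule eq_matI) auto
    then have ws: "Proj * X 0 = Proj * word n \<beta> [s]" unfolding X_def by simp
    show ?case
    proof (rule eq_matI)
      fix r c assume "r < dim_row (((- 2 * \<i>) ^ 0) \<cdot>\<^sub>m Y 0)" "c < dim_col (((- 2 * \<i>) ^ 0) \<cdot>\<^sub>m Y 0)"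
      then have rc: "r < ?N" "c < ?N" using carrier_matD[OF Yc[of 0]] by simp_all
      have "Y 0 $$ (r, c) = (\<Sum>P | spath P. if P = [s] then (Proj * word n \<beta> P) $$ (r, c) else 0)"
        unfolding Y_def msum_entry[OF rc]
        by (rule sum.cong[OF refl]) (use rc Pc carrier_matD[OF word_carrier[of n \<beta>]] in simp)
      also have "\<dots> = (Proj * word n \<beta> [s]) $$ (r, c)" using finite_spath by (simp add: sum.delta)
      finally show "(Proj * X 0) $$ (r, c) = (((- 2 * \<i>) ^ 0) \<cdot>\<^sub>m Y 0) $$ (r, c)"
        unfolding ws using rc Yc[of 0] by simp
    qed (use Pc Xc[of 0] Yc[of 0] in simp_all)
  next
    case (Suc k)
    let ?a = "(- 2 * \<i>) ^ k :: complex"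
    have PX: "Proj * X k \<in> carrier_mat ?N ?N" by (rule mult_carrier_mat[OF Pc Xc])
    have d: "H * X k - X k * H \<in> carrier_mat ?N ?N" by (rule minus_carrier_mat[OF mult_carrier_mat[OF Xc Hc]])
    have "Proj * X (Suc k) = \<i> \<cdot>\<^sub>m (Proj * (H * X k - X k * H))"
      unfolding XS[OF Xc] by (rule mult_smult_distrib[OF Pc d])
    also have "Proj * (H * X k - X k * H) = Proj * (H * X k) - Proj * (X k * H)"
      by (rule mult_minus_distrib_mat[OF Pc mult_carrier_mat[OF Hc Xc] mult_carrier_mat[OF Xc Hc]])
    also have "Proj * (H * X k) = H * (Proj * X k)"
      using assoc_mult_mat[OF Pc Hc Xc[of k]] assoc_mult_mat[OF Hc Pc Xc[of k]] PH by simp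
    also have "Proj * (X k * H) = (Proj * X k) * H" by (rule assoc_mult_mat[OF Pc Xc Hc, symmetric])
    also have "H * (Proj * X k) - (Proj * X k) * H = ?a \<cdot>\<^sub>m (H * Y k) - ?a \<cdot>\<^sub>m (Y k * H)"
      unfolding Suc using mult_smult_distrib[OF Hc Yc[of k]] mult_smult_assoc_mat[OF Yc[of k] Hc] by simp
    also have "\<dots> = ?a \<cdot>\<^sub>m (H * Y k - Y k * H)"
      by (rule eq_matI) (use Hc Yc[of k] in \<open>simp_all add: right_diff_distrib\<close>)
    also have "H * Y k - Y k * H = (- 2) \<cdot>\<^sub>m Y (Suc k)" by (rule step)
    also have "\<i> \<cdot>\<^sub>m (?a \<cdot>\<^sub>m ((- 2) \<cdot>\<^sub>m Y (Suc k))) = ((- 2 * \<i>) ^ Suc k) \<cdot>\<^sub>m Y (Suc k)"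
      by (simp add: smult_smult_mat mult_ac)
    finally show ?case .
  qed
  show ?thesis using that[of c0] main unfolding X_def Y_def H_def by blast
qed

end

section \<open>Adding the simplicial mode to the frustration graph\<close>

theorem theorem3:
  fixes n :: nat and V :: "(nat \<Rightarrow> nat) set" and b :: "(nat \<Rightarrow> nat) \<Rightarrow> real"
    and K :: "(nat \<Rightarrow> nat) set" and jstar :: "nat \<Rightarrow> nat" and Proj :: "complex mat"
  assumes V: "\<forall>j\<in>V. is_pauli_string n j" "finite V"
    and b: "\<forall>j\<in>V. b j \<noteq> 0"
    and cf: "claw_free n V"
    and K: "simplicial_clique n V K"
    and js: "is_pauli_string n jstar" "jstar \<notin> V"
    and mode: "\<forall>j\<in>V. adj n jstar j \<longleftrightarrow> j \<in> K"
    and Proj: "joint_eigenprojector (2^n)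
               (cycle_symmetries n V (\<lambda>j. complex_of_real (b j) \<cdot>\<^sub>m sigma n j)) Proj"
  shows "\<exists>A :: (nat \<Rightarrow> nat) set \<Rightarrow> (nat \<Rightarrow> nat) set \<Rightarrow> real.
     bipartite_weighted_adj (induced_paths n (insert jstar V)) A \<and>
     (\<forall>k. let H = msum (2^n) (\<lambda>j. complex_of_real (b j) \<cdot>\<^sub>m sigma n j) V;
             hs = (\<lambda>j. if j = jstar then sigma n jstar else complex_of_real (b j) \<cdot>\<^sub>m sigma n j);
             IP = induced_paths n (insert jstar V) in
        Proj * ((ad (\<i> \<cdot>\<^sub>m H)) ^^ k) (sigma n jstar)
        = ((- 2 * \<i>) ^ k) \<cdot>\<^sub>m msum (2^n)
            (\<lambda>P. complex_of_real (mpow IP A k {jstar} P) \<cdot>\<^sub>m (Proj * path_op n (insert jstar V) hs jstar P)) IP)"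
proof -
  have KV: "K \<subseteq> V" and Kcl: "\<And>x y. x \<in> K \<Longrightarrow> y \<in> K \<Longrightarrow> x \<noteq> y \<Longrightarrow> adj n x y"
    and Ksimp: "\<And>j x y. j \<in> K \<Longrightarrow> x \<in> V \<Longrightarrow> y \<in> V \<Longrightarrow> adj n j x \<Longrightarrow> adj n j y \<Longrightarrow> x \<notin> K \<Longrightarrow> y \<notin> K \<Longrightarrow> x \<noteq> y \<Longrightarrow> adj n x y"
    using K unfolding simplicial_clique_def is_clique_def nbhd_def by blast+
  \<comment> \<open>\<open>v\<close> is adjacent to \<open>jstar\<close>, so it lies in
    \<open>K\<close>, while \<open>c\<close> and \<open>d\<close> do not. Both then belong to the
    part of the neighbourhood of \<open>v\<close> that simpliciality makes a clique.\<close>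
  have side: False
    if "v \<in> V" "c \<in> V" "d \<in> V" "adj n v jstar" "adj n v c" "adj n v d" "c \<noteq> d"
      "\<not> adj n jstar c" "\<not> adj n jstar d" "\<not> adj n c d" for v c d
  proof -
    have "v \<in> K" using that(1,4) mode adj_sym[of n v jstar] by blast
    moreover have "c \<notin> K" "d \<notin> K" using that(2,3,8,9) mode by blast+
    ultimately show False using Ksimp[of v c d] that by blast
  qed
  interpret simplicial_graph n V jstar
  proof
    show "finite V" "jstar \<notin> V" by fact+
    show "adj n x y" if "x \<in> V" "y \<in> V" "adj n jstar x" "adj n jstar y" "x \<noteq> y" for x y
      using that mode Kcl by blast
    fix v a c d
    assume U: "v \<in> insert jstar V" "a \<in> insert jstar V" "c \<in> insert jstar V" "d \<in> insert jstar V"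
      and ad: "adj n v a" "adj n v c" "adj n v d" and ne: "a \<noteq> c" "a \<noteq> d" "c \<noteq> d"
      and na: "\<not> adj n a c" "\<not> adj n a d" "\<not> adj n c d"
    have nv: "v \<noteq> a" "v \<noteq> c" "v \<noteq> d" using ad by auto
    show False
    proof (cases "v = jstar")
      case True
      \<comment> \<open>Two leaves of a claw centred at \<open>jstar\<close> would be nonadjacent
        members of the clique \<open>K\<close>.\<close>
      then have "a \<in> V" "c \<in> V" using U nv by auto
      then have "a \<in> K" "c \<in> K" using mode ad True by blast+
      then show False using Kcl ne na by blast
    next
      case v: False
      then have vV: "v \<in> V" using U by blast
      consider "a = jstar" | "c = jstar" | "d = jstar" | "a \<in> V" "c \<in> V" "d \<in> V" using U by blast
      then show False
      proof cases
        case 1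
        then show False using side[OF vV, of c d] U ad ne na by blast
      next
        case 2
        then have "\<not> adj n jstar a" using na adj_sym[of n a jstar] by simp
        then show False using side[OF vV, of a d] 2 U ad ne na by blast
      next
        case 3
        then have "\<not> adj n jstar a" "\<not> adj n jstar c" using na adj_sym[of n a jstar] adj_sym[of n c jstar] by simp_all
        then show False using side[OF vV, of a c] 3 U ad ne na by blast
      next
        case 4
        have "distinct [v, a, c, d]" using nv ne by simp
        then show False using cf 4 vV ad na unfolding claw_free_def by blast
      qed
    qed
  qed
  \<comment> \<open>Coefficient 1 at \<open>jstar\<close> makes the bare Pauli string of the mode an
    \<open>hterm\<close>, so that a path product is a single word.\<close>
  define \<beta> where "\<beta> j = (if j = jstar then 1 else b j)" for j
  have \<beta>: "\<And>j. j \<in> V \<Longrightarrow> \<beta> j = b j" "\<beta> jstar = 1" using js(2) unfolding \<beta>_def by auto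
  have hb: "(\<lambda>j. complex_of_real (b j) \<cdot>\<^sub>m sigma n j) = hterm n b" unfolding hterm_def ..
  have "complex_of_real 1 \<cdot>\<^sub>m sigma n jstar = sigma n jstar" by (rule eq_matI) auto
  then have hs: "(\<lambda>j. if j = jstar then sigma n jstar else complex_of_real (b j) \<cdot>\<^sub>m sigma n j) = hterm n \<beta>"
    by (intro ext) (simp add: hterm_def \<beta>_def)
  obtain c where c: "\<And>k. Proj * ((ad (\<i> \<cdot>\<^sub>m msum (2^n) (hterm n b) V)) ^^ k) (sigma n jstar)
     = ((- 2 * \<i>) ^ k) \<cdot>\<^sub>m msum (2^n) (\<lambda>P. complex_of_real (walk b c k P) \<cdot>\<^sub>m (Proj * word n \<beta> P)) {P. spath P}"
    using krylov_expansion[OF Proj[unfolded hb] \<beta>] by blast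
  have Pc: "Proj \<in> carrier_mat (2^n) (2^n)" using Proj unfolding joint_eigenprojector_def by blast
  let ?I = "induced_paths n (insert jstar V)"
  have "msum (2^n) (\<lambda>P. complex_of_real (mpow ?I (path_matrix b c) k {jstar} P) \<cdot>\<^sub>m (Proj * path_op n (insert jstar V) (hterm n \<beta>) jstar P)) ?I
     = msum (2^n) (\<lambda>P. complex_of_real (walk b c k P) \<cdot>\<^sub>m (Proj * word n \<beta> P)) {P. spath P}" (is "msum _ ?g _ = _") for k
  proof (rule eq_matI)
    fix r d assume "r < dim_row (msum (2^n) (\<lambda>P. complex_of_real (walk b c k P) \<cdot>\<^sub>m (Proj * word n \<beta> P)) {P. spath P})"
      "d < dim_col (msum (2^n) (\<lambda>P. complex_of_real (walk b c k P) \<cdot>\<^sub>m (Proj * word n \<beta> P)) {P. spath P})"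
    then have rd: "r < 2^n" "d < 2^n" by (simp_all add: msum_def)
    have poc: "path_op n (insert jstar V) (hterm n \<beta>) jstar P \<in> carrier_mat (2^n) (2^n)" for P
      unfolding path_op_def using word_carrier[of n \<beta>] unfolding word_def .
    have "msum (2^n) ?g ?I $$ (r, d) = (\<Sum>P | spath P. ?g (set P) $$ (r, d))"
      unfolding msum_entry[OF rd]
      by (rule sum_induced_paths) (use mpow_path_matrix(2) rd Pc poc[THEN carrier_matD(1)] poc[THEN carrier_matD(2)] in simp)
    also have "\<dots> = (\<Sum>P | spath P. (complex_of_real (walk b c k P) \<cdot>\<^sub>m (Proj * word n \<beta> P)) $$ (r, d))"
      by (rule sum.cong[OF refl]) (simp add: mpow_path_matrix(1) path_op_spath)
    finally show "msum (2^n) ?g ?I $$ (r, d)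
      = msum (2^n) (\<lambda>P. complex_of_real (walk b c k P) \<cdot>\<^sub>m (Proj * word n \<beta> P)) {P. spath P} $$ (r, d)"
      unfolding msum_entry[OF rd] .
  qed (simp_all add: msum_def)
  then show ?thesis
    unfolding hb hs Let_def by (intro exI[of _ "path_matrix b c"] conjI allI bipartite_path_matrix) (simp add: c)
qed

end
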